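(* Consider the Lipschitz MAB problem on a compact metric space $(X,\mathcal{D})$. For any $d>\mathrm{MaxMinCOV}(X)$ there exists a bandit algorithm $\mathcal{A}$ whose regret dimension is at most $d$; moreover, for every payoff function $\mu$ the instance-specific regret dimension $\mathrm{RegretDim}_\mu(\mathcal{A})$ is at most the zooming dimension of the instance. No algorithm can have regret dimension strictly less than $\mathrm{MaxMinCOV}(X)$.
   Context: Lipschitz MAB problem on a metric space $(X,\mathcal{D})$ of diameter at most $1$: an unknown $\mu:X\to[0,1]$ with $|\mu(x)-\mu(y)|\le\mathcal{D}(x,y)$, and for each arm a reward distribution on $[0,1]$ with mean $\mu(x)$; each round the algorithm picks $x_t$ and receives an independent reward from $x_t$'s distribution. $R_{\mathcal{A}}(t)=t\sup_x\mu(x)-\mathbb{E}[\sum_{s\le t}\mu(x_s)]$. Instance-specific regret dimension: $\mathrm{RegretDim}_\mu(\mathcal{A})=\inf\{d\ge0:\exists C=C(\mu)\ \forall t,\ R_{\mathcal{A}}(t)\le C\,t^{1-1/(d+2)}\}$; the regret dimension is $\mathrm{RegretDim}(\mathcal{A})=\sup_\mu\mathrm{RegretDim}_\mu(\mathcal{A})$ over all Lipschitz payoff functions $\mu$ (with reward distributions). $N_r(Y)$: minimal number of sets of diameter strictly less than $r$ covering $Y$; $\mathrm{COV}(Y)=\inf\{d\ge0:\exists c\ \forall r>0,\ N_r(Y)\le c\,r^{-d}\}$; $\mathrm{MinCOV}(Y)=\inf\{\mathrm{COV}(U):U\subseteq Y\text{ non-empty, open in }(Y,\mathcal{D})\}$;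 $\mathrm{MaxMinCOV}(X)=\sup_{Y\subseteq X}\mathrm{MinCOV}(Y)$. Zooming dimension with multiplier $c>0$: the smallest $d\ge0$ such that for every $r\in(0,1]$, the set $\{x:r/2<\mu^*-\mu(x)\le r\}$ (with $\mu^*=\sup\mu$) can be covered by $c\,r^{-d}$ sets of diameter strictly less than $r/8$; the zooming dimension (without multiplier) is the infimum over $c>0$ of the zooming dimension with multiplier $c$.
   Formalization: In COV the scales are restricted to 0<r≤1 (with all r>0, no d>0 qualifies for non-empty Y since c·r^{-d}→0), and MaxMinCOV takes the supremum over non-empty Y only (MinCOV of the empty set is infinite); reward distributions form a measurable kernel. *)

theory Defs
  imports "HOL-Probability.Probability"
begin

text \<open>
  The guard \<open>bounded S\<close> is needed because \<open>diameter\<close> is a real supremum and carries no information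
  for unbounded sets. The value is \<open>\<infinity>\<close> if no finite cover exists.
\<close>

definition covering_number :: "real \<Rightarrow> 'a::metric_space set \<Rightarrow> enat" where
  "covering_number r Y =
     Inf {enat (card F) | F. finite F \<and> Y \<subseteq> \<Union>F \<and> (\<forall>S\<in>F. bounded S \<and> diameter S < r)}"

text \<open>
  The ambient metric space has diameter at most \<open>1\<close>, so scales range over \<open>0 < r \<le> 1\<close>. Without an
  upper bound on \<open>r\<close>, no \<open>d > 0\<close> could qualify for a nonempty \<open>Y\<close>, since
  \<open>c * r powr (-d)\<close> vanishes as \<open>r\<close> grows.
\<close>

definition COV :: "'a::metric_space set \<Rightarrow> ereal" where
  "COV Y = Inf {ereal d | d. d \<ge> 0 \<and>
     (\<exists>c. \<forall>r\<in>{0<..1}. ereal_of_enat (covering_number r Y) \<le> ereal (c * r powr (-d)))}"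

definition MinCOV :: "'a::metric_space set \<Rightarrow> ereal" where
  "MinCOV Y = Inf {COV U | U. U \<noteq> {} \<and> openin (top_of_set Y) U}"

text \<open>The empty set has to be excluded: \<open>MinCOV {} = \<infinity>\<close>.\<close>

definition MaxMinCOV :: "'a::metric_space set \<Rightarrow> ereal" where
  "MaxMinCOV X = Sup {MinCOV Y | Y. Y \<subseteq> X \<and> Y \<noteq> {}}"

definition zooming_dim_mult :: "'a::metric_space set \<Rightarrow> ('a \<Rightarrow> real) \<Rightarrow> real \<Rightarrow> ereal" where
  "zooming_dim_mult X \<mu> c = Inf {ereal d | d. d \<ge> 0 \<and>
     (\<forall>r\<in>{0<..1}.
        ereal_of_enat (covering_number (r / 8)
            {x\<in>X. r / 2 < (SUP y\<in>X. \<mu> y) - \<mu> x \<and> (SUP y\<in>X. \<mu> y) - \<mu> x \<le> r})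
        \<le> ereal (c * r powr (-d)))}"

definition zooming_dim :: "'a::metric_space set \<Rightarrow> ('a \<Rightarrow> real) \<Rightarrow> ereal" where
  "zooming_dim X \<mu> = (INF c\<in>{0<..}. zooming_dim_mult X \<mu> c)"

definition arm_space :: "'a::metric_space set \<Rightarrow> 'a measure" where
  "arm_space X = restrict_space borel X"

definition round_space :: "'a::metric_space set \<Rightarrow> ('a \<times> real) measure" where
  "round_space X = arm_space X \<Otimes>\<^sub>M borel"

text \<open>
  An instance: the payoff function \<open>\<mu>\<close> and the reward distribution \<open>P x\<close> of each arm \<open>x\<close>, which
  form a probability kernel (so that the law of the interaction with an algorithm is defined).
\<close>

definition lipschitz_mab_instance ::
    "'a::metric_space set \<Rightarrow> ('a \<Rightarrow> real) \<Rightarrow> ('a \<Rightarrow> real measure) \<Rightarrow> bool" where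
  "lipschitz_mab_instance X \<mu> P \<longleftrightarrow>
     \<mu> ` X \<subseteq> {0..1} \<and> 1-lipschitz_on X \<mu> \<and>
     P \<in> arm_space X \<rightarrow>\<^sub>M prob_algebra borel \<and>
     (\<forall>x\<in>X. (AE y in P x. y \<in> {0..1}) \<and> (\<integral>y. y \<partial>P x) = \<mu> x)"

text \<open>
  A (randomized) bandit algorithm maps the history \<open>h\<close> of arms and rewards in rounds
  \<open>0, \<dots>, t - 1\<close> to the distribution of the arm chosen in round \<open>t\<close>.
\<close>

type_synonym 'a bandit_alg = "nat \<Rightarrow> (nat \<Rightarrow> 'a \<times> real) \<Rightarrow> 'a measure"

definition bandit_algorithm :: "'a::metric_space set \<Rightarrow> 'a bandit_alg \<Rightarrow> bool" where
  "bandit_algorithm X A \<longleftrightarrow>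
     (\<forall>t. A t \<in> (\<Pi>\<^sub>M i\<in>{0..<t}. round_space X) \<rightarrow>\<^sub>M prob_algebra (arm_space X))"

definition round_law ::
    "'a::metric_space set \<Rightarrow> 'a bandit_alg \<Rightarrow> ('a \<Rightarrow> real measure) \<Rightarrow>
       nat \<Rightarrow> (nat \<Rightarrow> 'a \<times> real) \<Rightarrow> ('a \<times> real) measure" where
  "round_law X A P t h = A t h \<bind> (\<lambda>x. distr (P x) (round_space X) (Pair x))"

lemma Ionescu_Tulcea_round_law:
  assumes A: "bandit_algorithm X A" and "lipschitz_mab_instance X \<mu> P"
  shows "Ionescu_Tulcea (round_law X A P) (\<lambda>_. round_space X)"
proof -
  have A' [measurable]: "A t \<in> (\<Pi>\<^sub>M i\<in>{0..<t}. round_space X) \<rightarrow>\<^sub>M prob_algebra (arm_space X)" for t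
    using A by (simp add: bandit_algorithm_def)
  have P [measurable]: "P \<in> arm_space X \<rightarrow>\<^sub>M prob_algebra borel"
    using assms by (simp add: lipschitz_mab_instance_def)
  have D: "(\<lambda>x. distr (P x) (round_space X) (Pair x)) \<in> arm_space X \<rightarrow>\<^sub>M prob_algebra (round_space X)"
    unfolding round_space_def by (rule measurable_distr_prob_space2[OF P]) simp
  have K: "round_law X A P t \<in> (\<Pi>\<^sub>M i\<in>{0..<t}. round_space X) \<rightarrow>\<^sub>M prob_algebra (round_space X)" for t
    unfolding round_law_def by (rule measurable_bind_prob_space[OF A' D])
  show ?thesis
  proof (rule Ionescu_Tulcea.intro)
    show "round_law X A P i \<in> (\<Pi>\<^sub>M j\<in>{0..<i}. round_space X) \<rightarrow>\<^sub>M subprob_algebra (round_space X)" for i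
      using K by (rule measurable_prob_algebraD)
    show "prob_space (round_law X A P i h)"
      if "h \<in> space (\<Pi>\<^sub>M j\<in>{0..<i}. round_space X)" for i h
      using measurable_space[OF K that] by (simp add: space_prob_algebra)
  qed
qed

text \<open>
  The joint law of arms and rewards in the first \<open>t\<close> rounds; \<open>\<lambda>_. undefined\<close> is the empty history,
  the only point of a product over \<open>{0..<0}\<close>.
\<close>

definition history_law ::
    "'a::metric_space set \<Rightarrow> 'a bandit_alg \<Rightarrow> ('a \<Rightarrow> real measure) \<Rightarrow>
       nat \<Rightarrow> (nat \<Rightarrow> 'a \<times> real) measure" where
  "history_law X A P t =
     Ionescu_Tulcea.C (round_law X A P) (\<lambda>_. round_space X) 0 t (\<lambda>_. undefined)"

definition regret ::
    "'a::metric_space set \<Rightarrow> 'a bandit_alg \<Rightarrow> ('a \<Rightarrow> real) \<Rightarrow> ('a \<Rightarrow> real measure) \<Rightarrow> nat \<Rightarrow> real" where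
  "regret X A \<mu> P t =
     real t * (SUP x\<in>X. \<mu> x) - (\<integral>h. (\<Sum>s<t. \<mu> (fst (h s))) \<partial>history_law X A P t)"

definition regret_dim_inst ::
    "'a::metric_space set \<Rightarrow> 'a bandit_alg \<Rightarrow> ('a \<Rightarrow> real) \<Rightarrow> ('a \<Rightarrow> real measure) \<Rightarrow> ereal" where
  "regret_dim_inst X A \<mu> P = Inf {ereal d | d. d \<ge> 0 \<and>
     (\<exists>C. \<forall>t. regret X A \<mu> P t \<le> C * real t powr (1 - 1 / (d + 2)))}"

definition regret_dim :: "'a::metric_space set \<Rightarrow> 'a bandit_alg \<Rightarrow> ereal" where
  "regret_dim X A = Sup {regret_dim_inst X A \<mu> P | \<mu> P. lipschitz_mab_instance X \<mu> P}"

end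

theory Submission
  imports Defs "HOL-Probability.Hoeffding"
begin

text \<open>
  Lower bound. Let every nonempty relatively open subset of \<open>Y\<close> have covering dimension greater
  than \<open>d\<close>. Against a given algorithm, one builds a payoff function by adding up nested plateaus of
  height about \<open>r\<close>: inside the current plateau \<open>Y\<close> contains at least \<open>r powr (-d)\<close> points at mutual
  distance \<open>r / 3\<close>, and the next plateau is put around one that the algorithm, run on the payoff
  function built so far, visits rarely during the first \<open>r powr (-(d + 2))\<close> rounds. All later
  modifications happen inside that plateau and have size \<open>O(r)\<close>, so by a likelihood ratio argument
  the algorithm cannot detect them within these rounds and its regret is at least of order
  \<open>r powr (-(d + 1))\<close>.

  Upper bound. If \<open>d\<close> exceeds \<open>MaxMinCOV X\<close>, removing from a closed set all relatively open pieces
  of covering exponent \<open>d\<close> strictly shrinks it, and iterating this transfinitely gives a decreasing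
  chain of closed sets. If a compact set \<open>Z\<close> contains an optimal arm in the last member of the chain
  that has one and all arms of \<open>Z\<close> are nearly optimal, then the smallest member of the chain meeting
  \<open>Z\<close> still contains that arm and is of covering exponent \<open>d\<close> near it. The algorithm works in phases
  of doubling length. In each phase it runs successive elimination at dyadically decreasing scales
  and restricts the surviving region to the smallest member of the chain that it meets. The first
  scale tends to \<open>0\<close> so slowly that the first stage is cheap, yet in all but finitely many phases its
  outcome is precise enough for the restriction to be correct. As restricting only removes arms,
  the bound in terms of the zooming dimension is preserved.
\<close>

section \<open>Covering numbers and separated sets\<close>

text \<open>Where the exponents come from: about r^-2 pulls are needed to notice a change of height
  r. If r^-d disjoint bumps compete for t rounds, one of them gets at most t r^d pulls, and t =
  r^-(d+2) is the longest time for which this stays below r^-2; the regret t r is then t^(1 -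
  1/(d+2)). In the other direction, an arm of gap about 2^-m is pulled about 4^m times, so a shell
  of 2^(m d) such arms costs 2^(m (d+1)), while gaps below 2^-M cost at most 2^-M per round; over
  2^k rounds the two balance at M = k/(d+2). Since dimensions are infima, factors polynomial in k
  are free, and the lower bound may spend the difference of two exponents \<open>e < d\<close> on
  shrinking weights. The obstacle in the upper bound is that the precision needed for a correct
  restriction depends on the unknown payoff, so no first scale is right for all instances. A single
  algorithm must also meet both upper bounds; hence one phase is analysed for an abstract exponent
  \<open>e\<close>, which is instantiated twice. That analysis is pathwise: the run is almost surely
  a deterministic function of the rewards, and phase k has bounded noise up to probability
  \<open>8 / 4 ^ k\<close>.\<close>

lemma separated_card_le_cover:
  assumes "finite F" "Y \<subseteq> \<Union>F" "\<forall>S\<in>F. bounded S \<and> diameter S < r"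
    and "L \<subseteq> Y" "pairwise (\<lambda>x y. r \<le> dist x y) L"
  shows "finite L \<and> card L \<le> card F"
proof -
  have "\<forall>x\<in>L. \<exists>S\<in>F. x \<in> S"
    using assms by auto
  then obtain f where f: "\<And>x. x \<in> L \<Longrightarrow> f x \<in> F \<and> x \<in> f x"
    by metis
  \<comment> \<open>A covering set has diameter below \<open>r\<close>, so it cannot hold two
    \<open>r\<close>-separated points.\<close>
  have "inj_on f L"
  proof (rule inj_onI, rule ccontr)
    fix x y assume xy: "x \<in> L" "y \<in> L" "f x = f y" "x \<noteq> y"
    then have "dist x y \<le> diameter (f x)"
      using f assms(3) by (intro diameter_bounded_bound) metis+
    moreover have "diameter (f x) < r"
      using f xy assms(3) by auto
    moreover have "r \<le> dist x y"
      using assms(5) xy by (auto simp: pairwise_def)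
    ultimately show False by simp
  qed
  moreover have "f ` L \<subseteq> F"
    using f by auto
  ultimately show ?thesis
    using assms(1) card_inj_on_le finite_imageD finite_subset by metis
qed

lemma covering_number_le:
  assumes "finite F" "Y \<subseteq> \<Union>F" "\<forall>S\<in>F. bounded S \<and> diameter S < r"
  shows "covering_number r Y \<le> enat (card F)"
  unfolding covering_number_def using assms by (intro Inf_lower) auto

text \<open>An infimum in \<open>enat\<close> is a least element unless the set is empty, and the
  empty set would give \<open>\<infinity>\<close>.\<close>

lemma covering_number_attained:
  assumes "covering_number r Y = enat n"
  obtains F where "finite F" "Y \<subseteq> \<Union>F" "\<forall>S\<in>F. bounded S \<and> diameter S < r" "card F = n"
proof -
  let ?A = "{enat (card F) | F. finite F \<and> Y \<subseteq> \<Union>F \<and> (\<forall>S\<in>F. bounded S \<and> diameter S < r)}"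
  have "?A \<noteq> {}"
    using assms unfolding covering_number_def Inf_enat_def by (auto split: if_splits)
  then have "Inf ?A \<in> ?A"
    unfolding Inf_enat_def by (metis (mono_tags, lifting) LeastI_ex ex_in_conv)
  then show ?thesis
    using assms that unfolding covering_number_def by auto
qed

lemma ereal_of_enat_le_ereal:
  assumes "ereal_of_enat k \<le> ereal b"
  obtains n where "k = enat n" "real n \<le> b"
  using assms by (cases k) auto

lemma separated_card_le_covering_number:
  assumes "ereal_of_enat (covering_number r Y) \<le> ereal b"
    and "L \<subseteq> Y" "pairwise (\<lambda>x y. r \<le> dist x y) L"
  shows "finite L \<and> real (card L) \<le> b"
proof -
  obtain n where n: "covering_number r Y = enat n" "real n \<le> b"
    using assms(1) by (rule ereal_of_enat_le_ereal)
  obtain F where F: "finite F" "Y \<subseteq> \<Union>F" "\<forall>S\<in>F. bounded S \<and> diameter S < r" "card F = n"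
    using n(1) by (rule covering_number_attained)
  show ?thesis
    using separated_card_le_cover[OF F(1-3) assms(2,3)] F(4) n(2) by auto
qed

lemma covering_number_mono:
  assumes "Y \<subseteq> Z"
  shows "covering_number r Y \<le> covering_number r Z"
proof (cases "covering_number r Z")
  case (enat n)
  then obtain F where "finite F" "Z \<subseteq> \<Union>F" "\<forall>S\<in>F. bounded S \<and> diameter S < r" "card F = n"
    by (rule covering_number_attained)
  then show ?thesis
    using enat assms covering_number_le[of F Y r] by auto
qed simp

lemma covering_number_Un:
  "covering_number r (Y \<union> Z) \<le> covering_number r Y + covering_number r Z"
proof (cases "covering_number r Y"; cases "covering_number r Z")
  fix m n assume mn: "covering_number r Y = enat m" "covering_number r Z = enat n"
  obtain F where F: "finite F" "Y \<subseteq> \<Union>F" "\<forall>S\<in>F. bounded S \<and> diameter S < r" "card F = m"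
    using mn(1) by (rule covering_number_attained)
  obtain G where G: "finite G" "Z \<subseteq> \<Union>G" "\<forall>S\<in>G. bounded S \<and> diameter S < r" "card G = n"
    using mn(2) by (rule covering_number_attained)
  have "covering_number r (Y \<union> Z) \<le> enat (card (F \<union> G))"
    using F G by (intro covering_number_le) auto
  also have "\<dots> \<le> enat (m + n)"
    using F G card_Un_le[of F G] by simp
  finally show ?thesis
    using mn by simp
qed auto

lemma diameter_ball_le:
  fixes x :: "'a::metric_space"
  assumes "0 < s"
  shows "diameter (ball x s) \<le> 2 * s"
proof -
  have "dist y z \<le> 2 * s" if "y \<in> ball x s" "z \<in> ball x s" for y z
    using that dist_triangle[of y z x] by (simp add: dist_commute)
  then show ?thesis
    using assms by (auto simp: diameter_def intro!: cSUP_least)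
qed

text \<open>A separated set of maximal size is a net, since an uncovered point could be added to it.
  The maximum exists because finitely many balls of radius \<open>s / 3\<close>, of diameter below
  \<open>s\<close>, cover \<open>X\<close> and bound the size of all separated sets.\<close>

lemma finite_separated_net:
  fixes X :: "'a::metric_space set"
  assumes "compact X" "Y \<subseteq> X" "0 < s"
  obtains L where "finite L" "L \<subseteq> Y" "pairwise (\<lambda>x y. s \<le> dist x y) L"
    "Y \<subseteq> (\<Union>x\<in>L. ball x s)"
proof -
  obtain K where K: "finite K" "X \<subseteq> (\<Union>x\<in>K. ball x (s / 3))"
    by (rule compactE_image[OF assms(1), of X "\<lambda>x. ball x (s / 3)"]) (use assms(3) in auto)
  have diam: "diameter (ball x (s / 3)) < s" for x :: 'a
    using diameter_ball_le[of "s / 3" x] assms by simp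
  let ?sep = "\<lambda>L. L \<subseteq> Y \<and> pairwise (\<lambda>x y. s \<le> dist x y) L"
  have bound: "finite L \<and> card L \<le> card ((\<lambda>x. ball x (s / 3)) ` K)" if "?sep L" for L
    using K assms diam that by (intro separated_card_le_cover[where r = s and Y = Y]) auto
  have "?sep {}"
    by simp
  then have "\<exists>L. ?sep L \<and> (\<forall>L'. ?sep L' \<longrightarrow> card L' \<le> card L)"
    using bound by (intro ex_has_greatest_nat[where k = "{}" and b = "Suc (card ((\<lambda>x. ball x (s / 3)) ` K))"])
       (auto simp: less_Suc_eq_le)
  then obtain L where L: "?sep L" "\<And>L'. ?sep L' \<Longrightarrow> card L' \<le> card L"
    by blast
  have "finite L"
    using bound L(1) by simp
  have "Y \<subseteq> (\<Union>x\<in>L. ball x s)"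
  proof (rule subsetI, rule ccontr)
    fix y assume y: "y \<in> Y" "y \<notin> (\<Union>x\<in>L. ball x s)"
    then have far: "s \<le> dist x y" if "x \<in> L" for x
      using that by (auto simp: not_less)
    have "?sep (insert y L)"
      using L(1) y(1) far by (auto simp: pairwise_insert dist_commute)
    moreover have "y \<notin> L"
      using far[of y] assms by auto
    ultimately show False
      using L(2)[of "insert y L"] \<open>finite L\<close> by simp
  qed
  then show ?thesis
    using that L(1) \<open>finite L\<close> by blast
qed

lemma covering_number_le_card_net:
  assumes "finite L" "Y \<subseteq> (\<Union>x\<in>L. ball x s)" "0 < s" "2 * s < r"
  shows "covering_number r Y \<le> enat (card L)"
proof -
  have diam: "diameter (ball x s) < r" for x :: 'a
    using diameter_ball_le[of s x] assms by simp
  have "covering_number r Y \<le> enat (card ((\<lambda>x. ball x s) ` L))"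
    using assms diam by (intro covering_number_le) auto
  also have "\<dots> \<le> enat (card L)"
    using card_image_le[OF assms(1)] by simp
  finally show ?thesis .
qed

text \<open>The infimum \<open>COV\<close> need not be attained; the condition for one fixed
  exponent passes to subsets and finite unions with explicit constants.\<close>

definition covered_with_exponent :: "real \<Rightarrow> 'a::metric_space set \<Rightarrow> bool" where
  "covered_with_exponent d Y \<longleftrightarrow>
     (\<exists>c. \<forall>r\<in>{0<..1}. ereal_of_enat (covering_number r Y) \<le> ereal (c * r powr (-d)))"

text \<open>Scales are at most 1, so raising the exponent only weakens the bound.\<close>

lemma covered_with_exponent_if_COV_less:
  assumes "COV Y < ereal d"
  shows "covered_with_exponent d Y"
proof -
  obtain e c where e: "0 \<le> e" "e < d"
    and c: "\<forall>r\<in>{0<..1}. ereal_of_enat (covering_number r Y) \<le> ereal (c * r powr (-e))"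
    using assms unfolding COV_def Inf_less_iff by auto
  have "ereal_of_enat (covering_number r Y) \<le> ereal (max c 0 * r powr (-d))" if "r \<in> {0<..1}" for r
  proof (rule order_trans[OF bspec[OF c that]])
    have "r powr (-e) \<le> r powr (-d)"
      using that e by (intro powr_mono') auto
    then show "ereal (c * r powr (-e)) \<le> ereal (max c 0 * r powr (-d))"
      using mult_mono[of c "max c 0" "r powr (-e)" "r powr (-d)"] by simp
  qed
  then show ?thesis
    unfolding covered_with_exponent_def by blast
qed

lemma covered_with_exponent_subset:
  assumes "covered_with_exponent d Z" "Y \<subseteq> Z"
  shows "covered_with_exponent d Y"
proof -
  obtain c where c: "\<forall>r\<in>{0<..1}. ereal_of_enat (covering_number r Z) \<le> ereal (c * r powr (-d))"
    using assms(1) unfolding covered_with_exponent_def by (elim exE)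
  have "ereal_of_enat (covering_number r Y) \<le> ereal_of_enat (covering_number r Z)" for r
    using covering_number_mono[OF assms(2)] by simp
  then have "\<forall>r\<in>{0<..1}. ereal_of_enat (covering_number r Y) \<le> ereal (c * r powr (-d))"
    using c order_trans by (intro ballI) fast
  then show ?thesis
    unfolding covered_with_exponent_def by (rule exI)
qed

lemma covered_with_exponent_Union:
  assumes "finite F" "\<And>U. U \<in> F \<Longrightarrow> covered_with_exponent d U"
  shows "covered_with_exponent d (\<Union>F)"
  using assms
proof (induction F rule: finite_induct)
  case empty
  have "covering_number r ({}::'a set) \<le> enat 0" for r
    using covering_number_le[of "{}" "{}" r] by simp
  then have "covering_number r ({}::'a set) = 0" for r
    unfolding zero_enat_def by (rule antisym) (simp flip: zero_enat_def)
  then have "\<forall>r\<in>{0<..1}. ereal_of_enat (covering_number r ({}::'a set)) \<le> ereal (0 * r powr (-d))"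
    by simp
  then show ?case
    unfolding covered_with_exponent_def Union_empty by blast
next
  case (insert U F)
  have "covered_with_exponent d U" "covered_with_exponent d (\<Union>F)"
    using insert by auto
  then obtain a b
    where a: "\<forall>r\<in>{0<..1}. ereal_of_enat (covering_number r U) \<le> ereal (a * r powr (-d))"
      and b: "\<forall>r\<in>{0<..1}. ereal_of_enat (covering_number r (\<Union>F)) \<le> ereal (b * r powr (-d))"
    unfolding covered_with_exponent_def by (elim exE)
  have "ereal_of_enat (covering_number r (\<Union>(insert U F))) \<le> ereal ((a + b) * r powr (-d))"
    if "r \<in> {0<..1}" for r
  proof -
    have "ereal_of_enat (covering_number r (\<Union>(insert U F)))
        \<le> ereal_of_enat (covering_number r U + covering_number r (\<Union>F))"
      using covering_number_Un[of r U "\<Union>F"] by simp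
    also have "\<dots> \<le> ereal (a * r powr (-d)) + ereal (b * r powr (-d))"
      unfolding ereal_of_enat_add using bspec[OF a that] bspec[OF b that] by (rule add_mono)
    finally show ?thesis
      by (simp add: algebra_simps)
  qed
  then have "\<forall>r\<in>{0<..1}. ereal_of_enat (covering_number r (\<Union>(insert U F))) \<le> ereal ((a + b) * r powr (-d))"
    by (rule ballI)
  then show ?case
    unfolding covered_with_exponent_def by (rule exI)
qed

section \<open>Transfinite decomposition into fat pieces\<close>

text \<open>An analogue of the Cantor-Bendixson derivative, with relatively open sets of covering
  exponent \<open>d\<close> in the role of isolated points.\<close>

definition fat_derivative :: "real \<Rightarrow> 'a::metric_space set \<Rightarrow> 'a set" where
  "fat_derivative d S = S - \<Union>{U. openin (top_of_set S) U \<and> covered_with_exponent d U}"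

text \<open>Transfinite iteration without ordinals: the derivative gives successors, intersections
  give limits, and the empty family gives the initial set, as
  \<open>X \<inter> \<Inter>{} = X\<close>.\<close>

inductive_set fat_decomposition :: "real \<Rightarrow> 'a::metric_space set \<Rightarrow> 'a set set"
  for d :: real and X :: "'a set" where
  derivative: "S \<in> fat_decomposition d X \<Longrightarrow> fat_derivative d S \<in> fat_decomposition d X"
| Inter: "(\<And>S. S \<in> N \<Longrightarrow> S \<in> fat_decomposition d X) \<Longrightarrow> X \<inter> \<Inter>N \<in> fat_decomposition d X"

lemma fat_derivative_subset: "fat_derivative d S \<subseteq> S"
  by (auto simp: fat_derivative_def)

lemma compact_fat_derivative:
  assumes "compact S"
  shows "compact (fat_derivative d S)"
proof -
  have "openin (top_of_set S) (\<Union>{U. openin (top_of_set S) U \<and> covered_with_exponent d U})"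
    by (rule openin_Union) auto
  then have "closedin (top_of_set S) (fat_derivative d S)"
    unfolding fat_derivative_def by (intro closedin_diff) auto
  then show ?thesis
    using assms closedin_compact by blast
qed

lemma fat_decomposition_compact:
  assumes "compact X" "S \<in> fat_decomposition d X"
  shows "compact S \<and> S \<subseteq> X"
  using assms(2)
proof induction
  case (derivative S)
  then show ?case
    using compact_fat_derivative fat_derivative_subset[of d S] by blast
next
  case (Inter N)
  then have "closed (\<Inter>N)"
    by (intro closed_Inter) (auto intro: compact_imp_closed)
  then show ?case
    using assms(1) by (auto intro: compact_Int_closed)
qed

text \<open>First half of the comparability argument of the Bourbaki-Witt theorem: the hypothesis on
  \<open>B\<close> makes it an extreme point, and induction on \<open>A\<close> shows that an
  extreme point is comparable with every member.\<close>

lemma fat_decomposition_subset_derivative_aux: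
  assumes "A \<in> fat_decomposition d X"
    and "\<And>C. C \<in> fat_decomposition d X \<Longrightarrow> B \<subset> C \<Longrightarrow> B \<subseteq> fat_derivative d C"
    and "B \<subseteq> X"
  shows "A \<subseteq> fat_derivative d B \<or> B \<subseteq> A"
  using assms(1)
proof induction
  case (derivative A)
  then show ?case
    using assms(2)[of A] fat_derivative_subset[of d A] by blast
next
  case (Inter N)
  then show ?case
    using assms(3) by blast
qed

lemma fat_decomposition_subset: "B \<in> fat_decomposition d X \<Longrightarrow> B \<subseteq> X"
proof (induction rule: fat_decomposition.induct)
  case (derivative S)
  then show ?case
    using fat_derivative_subset[of d S] by blast
qed auto

text \<open>Second half of the Bourbaki-Witt argument: induction on \<open>B\<close> shows that
  every member is extreme. So the members form a chain in which nothing lies strictly between a set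
  and its derivative.\<close>

lemma fat_decomposition_subset_derivative:
  assumes "A \<in> fat_decomposition d X" "B \<in> fat_decomposition d X"
  shows "A \<subseteq> fat_derivative d B \<or> B \<subseteq> A"
proof -
  have "\<forall>A\<in>fat_decomposition d X. B \<subset> A \<longrightarrow> B \<subseteq> fat_derivative d A"
    using assms(2)
  proof induction
    case (derivative B)
    have *: "A \<subseteq> fat_derivative d B \<or> B \<subseteq> A" if "A \<in> fat_decomposition d X" for A
      by (rule fat_decomposition_subset_derivative_aux[OF that])
        (use derivative.IH fat_decomposition_subset[OF derivative.hyps] in blast)+
    show ?case
    proof (intro ballI impI)
      fix A assume A: "A \<in> fat_decomposition d X" "fat_derivative d B \<subset> A"
      then have "B \<subseteq> A"
        using *[OF A(1)] by auto
      then show "fat_derivative d B \<subseteq> fat_derivative d A"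
        using derivative.IH A(1) fat_derivative_subset[of d B] by (cases "B = A") auto
    qed
  next
    case (Inter N)
    have *: "A \<subseteq> fat_derivative d S \<or> S \<subseteq> A" if "A \<in> fat_decomposition d X" "S \<in> N" for A S
      by (rule fat_decomposition_subset_derivative_aux[OF that(1)])
        (use Inter.IH[OF that(2)] fat_decomposition_subset[OF Inter.hyps[OF that(2)]] in blast)+
    show ?case
    proof (intro ballI impI)
      fix A assume A: "A \<in> fat_decomposition d X" "X \<inter> \<Inter>N \<subset> A"
      then obtain S where S: "S \<in> N" "\<not> A \<subseteq> S"
        using fat_decomposition_subset[OF A(1)] by blast
      then have "S \<subset> A"
        using *[OF A(1) S(1)] fat_derivative_subset[of d S] by blast
      then show "X \<inter> \<Inter>N \<subseteq> fat_derivative d A"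
        using bspec[OF Inter.IH[OF S(1)] A(1)] S(1) by auto
    qed
  qed
  then show ?thesis
    by (intro fat_decomposition_subset_derivative_aux[OF assms(1)])
      (use fat_decomposition_subset[OF assms(2)] in blast)+
qed

text \<open>The point where \<open>MaxMinCOV\<close> enters: it bounds \<open>MinCOV S\<close> for
  all nonempty subsets, so each of them has a nonempty relatively open piece to be removed.\<close>

lemma fat_derivative_psubset:
  fixes S :: "'a::metric_space set"
  assumes "MaxMinCOV X < ereal d" "S \<subseteq> X" "S \<noteq> {}"
  shows "fat_derivative d S \<subset> S"
proof -
  have "MinCOV S \<le> MaxMinCOV X"
    unfolding MaxMinCOV_def using assms by (intro Sup_upper) auto
  then have "MinCOV S < ereal d"
    using assms by simp
  then obtain U where "U \<noteq> {}" "openin (top_of_set S) U" "COV U < ereal d"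
    unfolding MinCOV_def Inf_less_iff by auto
  moreover from this have "covered_with_exponent d U" "U \<subseteq> S"
    by (auto intro: covered_with_exponent_if_COV_less dest: openin_imp_subset)
  ultimately show ?thesis
    unfolding fat_derivative_def by blast
qed

text \<open>Determined by \<open>Z\<close> alone and not by the payoff function, because the
  algorithm has to evaluate it.\<close>

definition fat_restriction :: "real \<Rightarrow> 'a::metric_space set \<Rightarrow> 'a set \<Rightarrow> 'a set" where
  "fat_restriction d X Z = Z \<inter> \<Inter>{S \<in> fat_decomposition d X. S \<inter> Z \<noteq> {}}"

lemma fat_restriction_subset: "fat_restriction d X Z \<subseteq> Z"
  by (auto simp: fat_restriction_def)

lemma compact_fat_restriction:
  assumes "compact X" "compact Z"
  shows "compact (fat_restriction d X Z)"
  unfolding fat_restriction_def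
proof (rule compact_Int_closed[OF assms(2) closed_Inter])
  show "\<forall>S\<in>{S \<in> fat_decomposition d X. S \<inter> Z \<noteq> {}}. closed S"
    using fat_decomposition_compact[OF assms(1)] by (auto intro: compact_imp_closed)
qed

lemma compact_superlevel_set:
  fixes f :: "'a::metric_space \<Rightarrow> real"
  assumes "compact X" "continuous_on X f"
  shows "compact {x\<in>X. c \<le> f x}"
proof -
  have "closedin (top_of_set X) (X \<inter> f -` {c..})"
    using assms by (intro continuous_closedin_preimage) auto
  moreover have "X \<inter> f -` {c..} = {x\<in>X. c \<le> f x}"
    by auto
  ultimately show ?thesis
    using assms closedin_compact by metis
qed

text \<open>The derivative of the last member \<open>M\<close> with an optimal arm has none, hence
  by compactness stays a positive gap away from the optimum. A member that meets a nearly optimal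
  \<open>Z\<close> is therefore not inside this derivative, so by comparability it contains
  \<open>M\<close>.\<close>

theorem fat_restriction_near_optimum:
  fixes f :: "'a::metric_space \<Rightarrow> real"
  assumes "compact X" "X \<noteq> {}" "MaxMinCOV X < ereal d" "continuous_on X f"
  obtains x \<epsilon> Q where "x \<in> X" "\<And>y. y \<in> X \<Longrightarrow> f y \<le> f x" "0 < \<epsilon>" "covered_with_exponent d Q"
    "\<And>Z. x \<in> Z \<Longrightarrow> Z \<subseteq> X \<Longrightarrow> (\<And>z. z \<in> Z \<Longrightarrow> f x - f z < \<epsilon>) \<Longrightarrow>
       x \<in> fat_restriction d X Z \<and> fat_restriction d X Z \<subseteq> Q"
proof -
  let ?C = "fat_decomposition d X"
  obtain x0 where x0: "x0 \<in> X" "\<And>y. y \<in> X \<Longrightarrow> f y \<le> f x0"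
    using continuous_attains_sup[OF assms(1,2,4)] by blast
  define Opt where "Opt = {x\<in>X. f x0 \<le> f x}"
  have "compact Opt" "x0 \<in> Opt"
    using assms compact_superlevel_set x0 by (auto simp: Opt_def)
  define \<F> where "\<F> = {S \<in> ?C. S \<inter> Opt \<noteq> {}}"
  define M where "M = X \<inter> \<Inter>\<F>"
  have MC: "M \<in> ?C"
    unfolding M_def by (rule fat_decomposition.Inter) (auto simp: \<F>_def)
  have M: "compact M" "M \<subseteq> X"
    using fat_decomposition_compact[OF assms(1) MC] by auto
  have XC: "X \<in> ?C"
    using fat_decomposition.Inter[of "{}" d X] by simp
  \<comment> \<open>By comparability a finite subfamily has a smallest member, as needed for the
    finite intersection property.\<close>
  have chain: "\<Inter>G \<in> G" if "finite G" "G \<noteq> {}" "G \<subseteq> \<F>" for G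
    using that
  proof (induction G rule: finite_ne_induct)
    case (insert S G)
    then have "S \<in> ?C" "\<Inter>G \<in> G" "\<Inter>G \<in> ?C"
      by (auto simp: \<F>_def)
    then have "S \<subseteq> \<Inter>G \<or> \<Inter>G \<subseteq> S"
      using fat_decomposition_subset_derivative[of S d X "\<Inter>G"] fat_derivative_subset[of d "\<Inter>G"] by blast
    then have "S \<inter> \<Inter>G = S \<or> S \<inter> \<Inter>G = \<Inter>G"
      by blast
    then show ?case
      using \<open>\<Inter>G \<in> G\<close> by auto
  qed simp
  \<comment> \<open>The chain may descend infinitely; compactness of \<open>Opt\<close> keeps an
    optimal arm in the intersection.\<close>
  have "Opt \<inter> \<Inter>\<F> \<noteq> {}"
  proof (rule compact_imp_fip[OF \<open>compact Opt\<close>])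
    show "closed S" if "S \<in> \<F>" for S
      using that fat_decomposition_compact[OF assms(1)] by (auto simp: \<F>_def intro: compact_imp_closed)
    show "Opt \<inter> \<Inter>G \<noteq> {}" if "finite G" "G \<subseteq> \<F>" for G
    proof (cases "G = {}")
      case False
      then have "\<Inter>G \<in> \<F>"
        using chain that by blast
      then show ?thesis
        by (auto simp: \<F>_def)
    qed (use \<open>x0 \<in> Opt\<close> in auto)
  qed
  moreover have "X \<in> \<F>"
    using XC x0 \<open>x0 \<in> Opt\<close> by (auto simp: \<F>_def)
  ultimately obtain x where x: "x \<in> M" "x \<in> Opt"
    by (auto simp: M_def)
  have opt: "f y \<le> f x" if "y \<in> X" for y
    using x(2) x0(2)[OF that] by (auto simp: Opt_def)
  let ?M' = "fat_derivative d M"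
  have "?M' \<subset> M"
    using fat_derivative_psubset[OF assms(3) M(2)] x by blast
  \<comment> \<open>If it met \<open>Opt\<close>, the derivative would belong to \<open>\<F>\<close>
    and so contain \<open>M\<close>, against the strict inclusion.\<close>
  then have disj: "?M' \<inter> Opt = {}"
    using fat_decomposition.derivative[OF MC] by (auto simp: \<F>_def M_def)
  have M': "compact ?M'" "?M' \<subseteq> X"
    using compact_fat_derivative[OF M(1)] fat_derivative_subset[of d M] M(2) by auto
  obtain e where e: "0 < e" "\<And>z. z \<in> ?M' \<Longrightarrow> e \<le> f x - f z"
  proof (cases "?M' = {}")
    case True
    then show ?thesis
      using that[of 1] by simp
  next
    case False
    then obtain y where y: "y \<in> ?M'" "\<And>z. z \<in> ?M' \<Longrightarrow> f z \<le> f y"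
      using continuous_attains_sup[OF M'(1)] continuous_on_subset[OF assms(4) M'(2)] by blast
    have "f y < f x"
      using disj y(1) M'(2) x(2) by (auto simp: Opt_def)
    then show ?thesis
      using y that[of "f x - f y"] by force
  qed
  \<comment> \<open>The margin \<open>e / 2\<close> makes \<open>Q\<close> compact and disjoint from
    the derivative, so each of its points has a neighbourhood in \<open>M\<close> of exponent
    \<open>d\<close>, and finitely many of these suffice.\<close>
  define Q where "Q = {z\<in>M. f x - e / 2 \<le> f z}"
  have "compact Q"
    unfolding Q_def using M continuous_on_subset[OF assms(4) M(2)] by (intro compact_superlevel_set)
  have "\<exists>T. open T \<and> q \<in> T \<and> covered_with_exponent d (M \<inter> T)" if q: "q \<in> Q" for q
  proof -
    have "q \<notin> ?M'"
      using e(1) e(2)[of q] that by (auto simp: Q_def)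
    then obtain U where "openin (top_of_set M) U" "covered_with_exponent d U" "q \<in> U"
      using q by (auto simp: fat_derivative_def Q_def)
    then show ?thesis
      unfolding openin_open by auto
  qed
  then obtain T where T: "\<And>q. q \<in> Q \<Longrightarrow> open (T q) \<and> q \<in> T q \<and> covered_with_exponent d (M \<inter> T q)"
    by metis
  obtain D where D: "D \<subseteq> Q" "finite D" "Q \<subseteq> (\<Union>q\<in>D. T q)"
    using compactE_image[OF \<open>compact Q\<close>, of Q T] T by blast
  have "covered_with_exponent d (\<Union>((\<lambda>q. M \<inter> T q) ` D))"
    using D T by (intro covered_with_exponent_Union) auto
  moreover have "Q \<subseteq> \<Union>((\<lambda>q. M \<inter> T q) ` D)"
    using D by (auto simp: Q_def)
  ultimately have covQ: "covered_with_exponent d Q"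
    by (rule covered_with_exponent_subset)
  show ?thesis
  proof (rule that[of x "e / 2" Q])
    show "x \<in> X"
      using x M by auto
    fix Z assume Z: "x \<in> Z" "Z \<subseteq> X" "\<And>z. z \<in> Z \<Longrightarrow> f x - f z < e / 2"
    have "x \<in> S" if S: "S \<in> ?C" "S \<inter> Z \<noteq> {}" for S
    proof -
      have "\<not> S \<subseteq> ?M'"
        using S(2) e Z(3) by (force simp: subset_iff)
      then show ?thesis
        using fat_decomposition_subset_derivative[OF S(1) MC] x by auto
    qed
    moreover have "M \<in> {S \<in> ?C. S \<inter> Z \<noteq> {}}"
      using MC x Z by auto
    ultimately show "x \<in> fat_restriction d X Z \<and> fat_restriction d X Z \<subseteq> Q"
      using Z(1,3) by (force simp: fat_restriction_def Q_def)
  qed (use e covQ opt in auto)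
qed

section \<open>Law of the interaction and concentration of rewards\<close>

locale mab_run =
  fixes X :: "'a::metric_space set" and A :: "'a bandit_alg" and \<mu> :: "'a \<Rightarrow> real"
    and P :: "'a \<Rightarrow> real measure"
  assumes algorithm: "bandit_algorithm X A" and inst: "lipschitz_mab_instance X \<mu> P"
begin

sublocale Ionescu_Tulcea "round_law X A P" "\<lambda>_. round_space X"
  using algorithm inst by (rule Ionescu_Tulcea_round_law)

abbreviation history_space :: "nat \<Rightarrow> (nat \<Rightarrow> 'a \<times> real) measure" where
  "history_space n \<equiv> Pi\<^sub>M {0..<n} (\<lambda>_. round_space X)"
abbreviation "H n \<equiv> history_law X A P n"

section \<open>Recursive description of the law of the history\<close>

lemma empty_history: "(\<lambda>_. undefined) \<in> space (history_space 0)"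
  by (simp add: space_PiM)

lemma sets_H [measurable_cong]: "sets (H n) = sets (history_space n)"
  unfolding history_law_def using sets_C[OF empty_history, of n] by simp

lemma space_H: "space (H n) = space (history_space n)"
  using sets_H by (rule sets_eq_imp_space_eq)

lemma prob_space_H: "prob_space (H n)"
  unfolding history_law_def by (rule prob_space_C[OF empty_history])

lemma H_Suc: "H (Suc n) = H n \<bind> eP n"
  unfolding history_law_def by simp

lemma measurable_fun_upd_history:
  "h \<in> space (history_space n) \<Longrightarrow> fun_upd h n \<in> round_space X \<rightarrow>\<^sub>M history_space (Suc n)"
  by (rule measurable_fun_upd[where J = "{0..<n}"]) auto

lemma nn_integral_H_Suc:
  assumes [measurable]: "f \<in> borel_measurable (history_space (Suc n))"
  shows "(\<integral>\<^sup>+h. f h \<partial>H (Suc n)) = (\<integral>\<^sup>+h. \<integral>\<^sup>+w. f (h(n := w)) \<partial>round_law X A P n h \<partial>H n)"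
proof -
  have "eP n \<in> H n \<rightarrow>\<^sub>M subprob_algebra (history_space (Suc n))"
    by measurable
  then show ?thesis
    unfolding H_Suc
    by (subst nn_integral_bind[where B = "history_space (Suc n)"])
      (auto simp: space_H intro!: nn_integral_cong nn_integral_eP)
qed

lemma nn_integral_H_0: 
  assumes "f \<in> borel_measurable (history_space 0)"
  shows "(\<integral>\<^sup>+h. f h \<partial>H 0) = f (\<lambda>_. undefined)"
  using assms empty_history unfolding history_law_def by (auto intro!: nn_integral_return)

lemma AE_H_Suc:
  assumes Q: "Measurable.pred (history_space (Suc n)) Q"
  shows "(AE h in H (Suc n). Q h) \<longleftrightarrow> (AE h in H n. AE w in round_law X A P n h. Q (h(n := w)))"
proof -
  have "eP n \<in> H n \<rightarrow>\<^sub>M subprob_algebra (history_space (Suc n))"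
    by measurable
  then have "(AE h in H (Suc n). Q h) \<longleftrightarrow> (AE h in H n. AE h' in eP n h. Q h')"
    unfolding H_Suc using Q by (rule AE_bind)
  also have "\<dots> \<longleftrightarrow> (AE h in H n. AE w in round_law X A P n h. Q (h(n := w)))"
  proof (intro AE_cong)
    fix h assume "h \<in> space (H n)"
    then have h: "h \<in> space (history_space n)"
      by (simp add: space_H)
    have "fun_upd h n \<in> round_law X A P n h \<rightarrow>\<^sub>M history_space (Suc n)"
      using measurable_fun_upd_history[OF h] sets_P[OF h] by (simp cong: measurable_cong_sets)
    then show "(AE h' in eP n h. Q h') \<longleftrightarrow> (AE w in round_law X A P n h. Q (h(n := w)))"
      unfolding eP_def by (rule AE_distr_iff) (use Q in measurable)
  qed
  finally show ?thesis .
qed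

lemma measurable_arms [measurable]: "A n \<in> history_space n \<rightarrow>\<^sub>M prob_algebra (arm_space X)"
  using algorithm by (simp add: bandit_algorithm_def)

lemma measurable_rewards [measurable]: "P \<in> arm_space X \<rightarrow>\<^sub>M prob_algebra borel"
  using inst by (simp add: lipschitz_mab_instance_def)

lemma space_arm_space: "space (arm_space X) = X"
  by (simp add: arm_space_def space_restrict_space)

lemma prob_space_rewards: "x \<in> X \<Longrightarrow> prob_space (P x)"
  using measurable_space[OF measurable_rewards, of x] by (simp add: space_arm_space space_prob_algebra)

lemma sets_rewards: "x \<in> X \<Longrightarrow> sets (P x) = sets borel"
  using measurable_space[OF measurable_rewards, of x] by (simp add: space_arm_space space_prob_algebra)

lemma prob_space_arms: "h \<in> space (history_space n) \<Longrightarrow> prob_space (A n h)"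
  using measurable_space[OF measurable_arms] by (simp add: space_prob_algebra)

lemma sets_arms: "h \<in> space (history_space n) \<Longrightarrow> sets (A n h) = sets (arm_space X)"
  using measurable_space[OF measurable_arms] by (simp add: space_prob_algebra)

lemma space_arms: "h \<in> space (history_space n) \<Longrightarrow> space (A n h) = X"
  using sets_eq_imp_space_eq[OF sets_arms] space_arm_space by simp

lemma measurable_round_kernel:
  "(\<lambda>x. distr (P x) (round_space X) (Pair x)) \<in> arm_space X \<rightarrow>\<^sub>M prob_algebra (round_space X)"
  unfolding round_space_def by (rule measurable_distr_prob_space2[OF measurable_rewards]) simp

lemma measurable_Pair_round: "x \<in> X \<Longrightarrow> Pair x \<in> P x \<rightarrow>\<^sub>M round_space X"
  unfolding round_space_def using sets_rewards[of x] 
  by (intro measurable_Pair) (auto simp: space_arm_space cong: measurable_cong_sets)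

lemma nn_integral_round_law:
  assumes h: "h \<in> space (history_space n)" and g [measurable]: "g \<in> borel_measurable (round_space X)"
  shows "(\<integral>\<^sup>+w. g w \<partial>round_law X A P n h) = (\<integral>\<^sup>+x. \<integral>\<^sup>+y. g (x, y) \<partial>P x \<partial>A n h)"
proof -
  have "(\<lambda>x. distr (P x) (round_space X) (Pair x)) \<in> A n h \<rightarrow>\<^sub>M subprob_algebra (round_space X)"
    using measurable_prob_algebraD[OF measurable_round_kernel] sets_arms[OF h]
    by (simp cong: measurable_cong_sets)
  then have "(\<integral>\<^sup>+w. g w \<partial>round_law X A P n h)
      = (\<integral>\<^sup>+x. \<integral>\<^sup>+w. g w \<partial>distr (P x) (round_space X) (Pair x) \<partial>A n h)"
    unfolding round_law_def by (intro nn_integral_bind[where B = "round_space X"]) auto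
  also have "\<dots> = (\<integral>\<^sup>+x. \<integral>\<^sup>+y. g (x, y) \<partial>P x \<partial>A n h)"
    using space_arms[OF h] by (intro nn_integral_cong nn_integral_distr measurable_Pair_round) auto
  finally show ?thesis .
qed

lemma AE_round_law:
  assumes h: "h \<in> space (history_space n)" and Q [measurable]: "Measurable.pred (round_space X) Q"
  shows "(AE w in round_law X A P n h. Q w) \<longleftrightarrow> (AE x in A n h. AE y in P x. Q (x, y))"
proof -
  have "(\<lambda>x. distr (P x) (round_space X) (Pair x)) \<in> A n h \<rightarrow>\<^sub>M subprob_algebra (round_space X)"
    using measurable_prob_algebraD[OF measurable_round_kernel] sets_arms[OF h]
    by (simp cong: measurable_cong_sets)
  then have "(AE w in round_law X A P n h. Q w)
      \<longleftrightarrow> (AE x in A n h. AE w in distr (P x) (round_space X) (Pair x). Q w)"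
    unfolding round_law_def using Q by (rule AE_bind)
  also have "\<dots> \<longleftrightarrow> (AE x in A n h. AE y in P x. Q (x, y))"
    using space_arms[OF h] by (intro AE_cong AE_distr_iff measurable_Pair_round) auto
  finally show ?thesis .
qed

lemma nn_integral_round_law_le:
  assumes h: "h \<in> space (history_space n)" and g [measurable]: "g \<in> borel_measurable (round_space X)"
    and le: "\<And>x. x \<in> X \<Longrightarrow> (\<integral>\<^sup>+y. g (x, y) \<partial>P x) \<le> c"
  shows "(\<integral>\<^sup>+w. g w \<partial>round_law X A P n h) \<le> c"
proof -
  have "(\<integral>\<^sup>+w. g w \<partial>round_law X A P n h) \<le> (\<integral>\<^sup>+x. c \<partial>A n h)"
    unfolding nn_integral_round_law[OF h g] using space_arms[OF h] le by (intro nn_integral_mono) auto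
  also have "\<dots> = c"
    using prob_space.emeasure_space_1[OF prob_space_arms[OF h]] by simp
  finally show ?thesis .
qed

lemma measurable_payoff [measurable]: "\<mu> \<in> borel_measurable (arm_space X)"
  unfolding arm_space_def using inst
  by (intro borel_measurable_continuous_on_restrict lipschitz_on_continuous_on[where L = 1])
    (simp add: lipschitz_mab_instance_def)

lemma measurable_fst_round [measurable]: "fst \<in> round_space X \<rightarrow>\<^sub>M arm_space X"
  and measurable_snd_round [measurable]: "snd \<in> borel_measurable (round_space X)"
  by (simp_all add: round_space_def)

lemma measurable_round_component [measurable]:
  "s < n \<Longrightarrow> (\<lambda>h. h s) \<in> history_space n \<rightarrow>\<^sub>M round_space X"
  by (rule measurable_component_singleton) simp

lemma measurable_arm_component [measurable]:
  "s < n \<Longrightarrow> (\<lambda>h. fst (h s)) \<in> history_space n \<rightarrow>\<^sub>M arm_space X"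
  by (rule measurable_compose[OF measurable_round_component]) auto

lemma measurable_reward_component [measurable]:
  "s < n \<Longrightarrow> (\<lambda>h. snd (h s)) \<in> borel_measurable (history_space n)"
  by (rule measurable_compose[OF measurable_round_component]) auto

lemma measurable_payoff_component [measurable]:
  "s < n \<Longrightarrow> (\<lambda>h. \<mu> (fst (h s))) \<in> borel_measurable (history_space n)"
  by (rule measurable_compose[OF measurable_arm_component]) auto

lemma arm_in_space: "h \<in> space (history_space n) \<Longrightarrow> s < n \<Longrightarrow> fst (h s) \<in> X"
  using measurable_space[OF measurable_arm_component] by (simp add: space_arm_space)

lemma payoff_in_unit: "x \<in> X \<Longrightarrow> 0 \<le> \<mu> x \<and> \<mu> x \<le> 1"
  using inst by (auto simp: lipschitz_mab_instance_def)

section \<open>Regret as the expected sum of gaps\<close>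

definition opt :: real where "opt = (SUP x\<in>X. \<mu> x)"

lemma payoff_le_opt: "x \<in> X \<Longrightarrow> \<mu> x \<le> opt"
  unfolding opt_def using payoff_in_unit by (intro cSUP_upper bdd_aboveI2[where M = 1]) auto

text \<open>The regret becomes a nonnegative integral here, where boundedness of the payoff settles
  integrability; later estimates work with \<open>ennreal\<close> only.\<close>

lemma ennreal_regret:
  "ennreal (regret X A \<mu> P t) = (\<integral>\<^sup>+h. ennreal (\<Sum>s<t. opt - \<mu> (fst (h s))) \<partial>H t)"
  and regret_nonneg: "0 \<le> regret X A \<mu> P t"
proof -
  interpret prob_space "H t"
    by (rule prob_space_H)
  have int: "integrable (H t) (\<lambda>h. \<Sum>s<t. \<mu> (fst (h s)))"
  proof (rule integrable_const_bound[where B = "real t"])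
    show "AE h in H t. norm (\<Sum>s<t. \<mu> (fst (h s))) \<le> real t"
    proof (rule AE_I2)
      fix h assume h: "h \<in> space (H t)"
      have "norm (\<Sum>s<t. \<mu> (fst (h s))) \<le> (\<Sum>s<t. 1)"
        using arm_in_space[of h t] payoff_in_unit[of "fst (h _)"] h
        by (intro sum_norm_le) (auto simp: space_H abs_le_iff intro: order_trans[of _ 0])
      then show "norm (\<Sum>s<t. \<mu> (fst (h s))) \<le> real t"
        by simp
    qed
  qed measurable
  have eq: "(\<Sum>s<t. opt - \<mu> (fst (h s))) = real t * opt - (\<Sum>s<t. \<mu> (fst (h s)))" for h :: "nat \<Rightarrow> 'a \<times> real"
    by (simp add: sum_subtractf)
  have R: "regret X A \<mu> P t = (\<integral>h. (\<Sum>s<t. opt - \<mu> (fst (h s))) \<partial>H t)"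
    unfolding eq using int by (simp add: regret_def opt_def prob_space)
  have nn: "AE h in H t. 0 \<le> (\<Sum>s<t. opt - \<mu> (fst (h s)))"
    using arm_in_space payoff_le_opt by (intro AE_I2 sum_nonneg) (auto simp: space_H)
  show "ennreal (regret X A \<mu> P t) = (\<integral>\<^sup>+h. ennreal (\<Sum>s<t. opt - \<mu> (fst (h s))) \<partial>H t)"
    unfolding R using int nn by (intro nn_integral_eq_integral[symmetric]) (auto simp: eq)
  show "0 \<le> regret X A \<mu> P t"
    unfolding R using nn by (rule integral_nonneg_AE)
qed

text \<open>Gaps are nonnegative. This reduces the upper bound at an arbitrary time to the next
  power of two.\<close>

lemma regret_mono: "t \<le> u \<Longrightarrow> regret X A \<mu> P t \<le> regret X A \<mu> P u"
proof (induction rule: dec_induct)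
  case (step n)
  have "ennreal (regret X A \<mu> P n)
      = (\<integral>\<^sup>+h. \<integral>\<^sup>+w. ennreal (\<Sum>s<n. opt - \<mu> (fst ((h(n := w)) s))) \<partial>round_law X A P n h \<partial>H n)"
    unfolding ennreal_regret
    using prob_space.emeasure_space_1[OF prob_space_P] by (intro nn_integral_cong) (simp add: space_H)
  also have "\<dots> = (\<integral>\<^sup>+h. ennreal (\<Sum>s<n. opt - \<mu> (fst (h s))) \<partial>H (Suc n))"
    by (rule nn_integral_H_Suc[symmetric]) measurable
  also have "\<dots> \<le> (\<integral>\<^sup>+h. ennreal (\<Sum>s<Suc n. opt - \<mu> (fst (h s))) \<partial>H (Suc n))"
    using arm_in_space payoff_le_opt by (intro nn_integral_mono ennreal_leI) (auto simp: space_H)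
  also have "\<dots> = ennreal (regret X A \<mu> P (Suc n))"
    by (rule ennreal_regret[symmetric])
  finally show ?case
    using step regret_nonneg by simp
qed simp

text \<open>Hoeffding's lemma for a variable with values in an interval of length 1. It is stated
  for positive multipliers, so negative \<open>c\<close> is treated through
  \<open>-y\<close>.\<close>

lemma reward_exp_moment:
  assumes x: "x \<in> X"
  shows "(\<integral>\<^sup>+y. ennreal (exp (c * (y - \<mu> x))) \<partial>P x) \<le> ennreal (exp (c\<^sup>2 / 8))"
proof -
  interpret prob_space "P x"
    using x by (rule prob_space_rewards)
  have [measurable_cong]: "sets (P x) = sets borel"
    using x by (rule sets_rewards)
  have ae: "AE y in P x. y \<in> {0..1}" and mean: "(\<integral>y. y \<partial>P x) = \<mu> x"
    using inst x by (auto simp: lipschitz_mab_instance_def)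
  interpret pos: interval_bounded_random_variable "P x" "\<lambda>y. y" 0 1
    using ae by unfold_locales auto
  interpret neg: interval_bounded_random_variable "P x" "\<lambda>y. -y" "-1" 0
    using ae by unfold_locales auto
  consider "c = 0" | "c > 0" | "c < 0"
    by linarith
  then show ?thesis
  proof cases
    case 1
    then show ?thesis
      using emeasure_space_1 by simp
  next
    case 2
    then show ?thesis
      using pos.Hoeffdings_lemma_nn_integral[of c] by (simp add: mean)
  next
    case 3
    have "-c * (-y - expectation (\<lambda>y. -y)) = c * (y - \<mu> x)" for y
      by (simp add: mean algebra_simps)
    then show ?thesis
      using neg.Hoeffdings_lemma_nn_integral[of "-c"] 3 by simp
  qed
qed

text \<open>Exponential supermartingale: whichever arm the past selects, one more round contributes
  a factor of conditional mean at most \<open>exp ((c n)\<^sup>2 / 8)\<close>. The free weights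
  allow restricting the sum to an interval and choosing its sign.\<close>

lemma noise_exp_moment:
  "(\<integral>\<^sup>+h. ennreal (exp (\<Sum>s<n. c s * (snd (h s) - \<mu> (fst (h s))))) \<partial>H n)
    \<le> ennreal (exp (\<Sum>s<n. (c s)\<^sup>2 / 8))"
proof (induction n)
  case 0
  show ?case
    using prob_space.emeasure_space_1[OF prob_space_H] by simp
next
  case (Suc n)
  let ?Z = "\<lambda>n h. \<Sum>s<n. c s * (snd (h s) - \<mu> (fst (h s)))"
  let ?g = "\<lambda>w. ennreal (exp (c n * (snd w - \<mu> (fst w))))"
  have "(\<integral>\<^sup>+h. ennreal (exp (?Z (Suc n) h)) \<partial>H (Suc n))
      = (\<integral>\<^sup>+h. \<integral>\<^sup>+w. ennreal (exp (?Z (Suc n) (h(n := w)))) \<partial>round_law X A P n h \<partial>H n)"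
    by (rule nn_integral_H_Suc) measurable
  also have "\<dots> = (\<integral>\<^sup>+h. \<integral>\<^sup>+w. ennreal (exp (?Z n h)) * ?g w \<partial>round_law X A P n h \<partial>H n)"
    by (simp add: exp_add ennreal_mult')
  also have "\<dots> = (\<integral>\<^sup>+h. ennreal (exp (?Z n h)) * (\<integral>\<^sup>+w. ?g w \<partial>round_law X A P n h) \<partial>H n)"
    using sets_P by (intro nn_integral_cong nn_integral_cmult) (simp add: space_H cong: measurable_cong_sets)
  also have "\<dots> \<le> (\<integral>\<^sup>+h. ennreal (exp (?Z n h)) * ennreal (exp ((c n)\<^sup>2 / 8)) \<partial>H n)"
    using reward_exp_moment
    by (intro nn_integral_mono mult_left_mono nn_integral_round_law_le) (auto simp: space_H)
  also have "\<dots> = (\<integral>\<^sup>+h. ennreal (exp (?Z n h)) \<partial>H n) * ennreal (exp ((c n)\<^sup>2 / 8))"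
    by (rule nn_integral_multc) measurable
  also have "\<dots> \<le> ennreal (exp (\<Sum>s<n. (c s)\<^sup>2 / 8)) * ennreal (exp ((c n)\<^sup>2 / 8))"
    using Suc by (rule mult_right_mono) simp
  also have "\<dots> = ennreal (exp (\<Sum>s<Suc n. (c s)\<^sup>2 / 8))"
    by (simp add: exp_add ennreal_mult')
  finally show ?case .
qed

text \<open>Chernoff bound with weights that vanish outside the interval; the sign \<open>c\<close>
  selects the tail.\<close>

lemma interval_noise_upper_tail:
  assumes ab: "a < b" "b \<le> n" and "0 \<le> \<kappa>" and c: "c = 1 \<or> c = -1"
  shows "measure (H n) {h\<in>space (H n). sqrt (2 * \<kappa> * real (b - a)) \<le> c * (\<Sum>s=a..<b. snd (h s) - \<mu> (fst (h s)))}
    \<le> exp (- 4 * \<kappa>)"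
proof -
  interpret prob_space "H n"
    by (rule prob_space_H)
  define m where "m = real (b - a)"
  have m: "0 < m"
    using ab by (simp add: m_def)
  define \<epsilon> where "\<epsilon> = sqrt (2 * \<kappa> * m)"
  have \<epsilon>: "0 \<le> \<epsilon>" "\<epsilon>\<^sup>2 = 2 * \<kappa> * m"
    using m assms(3) by (auto simp: \<epsilon>_def)
  \<comment> \<open>This value minimises the exponent
    \<open>- (l * \<epsilon>) + l\<^sup>2 * m / 8\<close>.\<close>
  define l where "l = 4 * \<epsilon> / m"
  let ?S = "\<lambda>h. c * (\<Sum>s=a..<b. snd (h s) - \<mu> (fst (h s)))"
  let ?w = "\<lambda>s. if a \<le> s \<and> s < b then l * c else 0"
  have [measurable]: "(\<lambda>h. \<Sum>s=a..<b. snd (h s) - \<mu> (fst (h s))) \<in> borel_measurable (history_space n)"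
    using ab by (intro borel_measurable_sum borel_measurable_diff) auto
  have sub: "{s. s < n \<and> a \<le> s \<and> s < b} = {a..<b}"
    using ab by auto
  have S: "l * ?S h = (\<Sum>s<n. ?w s * (snd (h s) - \<mu> (fst (h s))))" for h :: "nat \<Rightarrow> 'a \<times> real"
    by (simp add: if_distrib[of "\<lambda>t. t * _"] sum.If_cases sub lessThan_def Int_def sum_distrib_left
        mult.assoc conj_assoc cong: if_cong)
  have W: "(\<Sum>s<n. (?w s)\<^sup>2 / 8) = l\<^sup>2 * m / 8"
    using c by (auto simp: if_distrib[of "\<lambda>t. t\<^sup>2 / 8"] sum.If_cases sub lessThan_def Int_def m_def
        power_mult_distrib conj_assoc cong: if_cong)
  have "emeasure (H n) {h\<in>space (H n). \<epsilon> \<le> ?S h}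
      \<le> (\<integral>\<^sup>+h. ennreal (exp (- (l * \<epsilon>))) * ennreal (exp (l * ?S h)) \<partial>H n)"
  proof -
    have "emeasure (H n) {h\<in>space (H n). \<epsilon> \<le> ?S h} = (\<integral>\<^sup>+h. indicator {h\<in>space (H n). \<epsilon> \<le> ?S h} h \<partial>H n)"
      by (rule nn_integral_indicator[symmetric]) measurable
    also have "\<dots> \<le> (\<integral>\<^sup>+h. ennreal (exp (- (l * \<epsilon>))) * ennreal (exp (l * ?S h)) \<partial>H n)"
    proof (rule nn_integral_mono)
      fix h
      have "1 \<le> ennreal (exp (- (l * \<epsilon>))) * ennreal (exp (l * ?S h))" if "\<epsilon> \<le> ?S h"
      proof -
        have "l * \<epsilon> \<le> l * ?S h"
          using that \<epsilon> m by (intro mult_left_mono) (auto simp: l_def)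
        then have "1 \<le> exp (- (l * \<epsilon>)) * exp (l * ?S h)"
          by (simp flip: exp_add)
        then show ?thesis
          by (simp flip: ennreal_mult')
      qed
      then show "indicator {h\<in>space (H n). \<epsilon> \<le> ?S h} h \<le> ennreal (exp (- (l * \<epsilon>))) * ennreal (exp (l * ?S h))"
        by (auto split: split_indicator)
    qed
    finally show ?thesis .
  qed
  also have "\<dots> = ennreal (exp (- (l * \<epsilon>))) * (\<integral>\<^sup>+h. ennreal (exp (l * ?S h)) \<partial>H n)"
    by (rule nn_integral_cmult) measurable
  also have "\<dots> \<le> ennreal (exp (- (l * \<epsilon>))) * ennreal (exp (l\<^sup>2 * m / 8))"
    unfolding S using noise_exp_moment[where c = ?w and n = n] unfolding W by (rule mult_left_mono) simp
  also have "\<dots> = ennreal (exp (- 4 * \<kappa>))"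
  proof -
    have "- (l * \<epsilon>) + l\<^sup>2 * m / 8 = - 2 * \<epsilon>\<^sup>2 / m"
      using m by (simp add: l_def field_simps power2_eq_square)
    also have "\<dots> = - 4 * \<kappa>"
      using m \<epsilon> by simp
    finally show ?thesis
      by (simp flip: ennreal_mult' exp_add)
  qed
  finally show ?thesis
    unfolding \<epsilon>_def m_def emeasure_eq_measure by simp
qed

text \<open>
  The blocks of the algorithm start at random times, so concentration is required on all intervals
  with deterministic end points at once.
\<close>

definition noise_bounded :: "nat \<Rightarrow> (nat \<Rightarrow> 'a \<times> real) \<Rightarrow> bool" where
  "noise_bounded k h \<longleftrightarrow> (\<forall>b\<in>{2^k..2^Suc k}. \<forall>a\<in>{2^k..<b}.
     \<bar>\<Sum>s=a..<b. snd (h s) - \<mu> (fst (h s))\<bar> \<le> sqrt (2 * real k * real (b - a)))"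

lemma measurable_noise_bounded:
  assumes "2^Suc k \<le> n"
  shows "Measurable.pred (history_space n) (noise_bounded k)"
proof -
  have "(\<lambda>h. \<Sum>s=a..<b. snd (h s) - \<mu> (fst (h s))) \<in> borel_measurable (history_space n)"
    if "b \<in> {2^k..2^Suc k}" for a b
    using that assms by (intro borel_measurable_sum borel_measurable_diff) auto
  note [measurable] = this
  show ?thesis
    unfolding noise_bounded_def by measurable
qed

text \<open>Union bound over at most \<open>4 * 4^k\<close> pairs of end points; each fails with
  probability at most \<open>2 * exp (- 4 * real k)\<close>, which is at most
  \<open>2 / 16^k\<close> because \<open>exp 1\<close> is at least 2. Multiplied by the phase length
  \<open>2^k\<close>, the result stays bounded.\<close>

lemma prob_noise_unbounded:
  assumes "2^Suc k \<le> n"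
  shows "measure (H n) {h\<in>space (H n). \<not> noise_bounded k h} \<le> 8 / 4 ^ k"
proof -
  interpret prob_space "H n"
    by (rule prob_space_H)
  let ?I = "{2^k..2^Suc k::nat}"
  let ?E = "\<lambda>a b c. {h\<in>space (H n). sqrt (2 * real k * real (b - a)) \<le> c * (\<Sum>s=a..<b. snd (h s) - \<mu> (fst (h s)))}"
  define D where "D = (\<lambda>(a, b). if a < b then ?E a b 1 \<union> ?E a b (-1) else {})"
  have [measurable]: "(\<lambda>h. \<Sum>s=a..<b. snd (h s) - \<mu> (fst (h s))) \<in> borel_measurable (history_space n)"
    if "b \<in> ?I" for a b
    using that assms by (intro borel_measurable_sum borel_measurable_diff) auto
  have E_sets: "?E a b c \<in> events" if "b \<in> ?I" for a b c
    using that by measurable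
  have D_sets: "D p \<in> events" if "p \<in> ?I \<times> ?I" for p
    using that E_sets by (auto simp: D_def split: prod.splits)
  have D_prob: "prob (D p) \<le> 2 * exp (- 4 * real k)" if "p \<in> ?I \<times> ?I" for p
  proof (cases "fst p < snd p")
    case True
    have "prob (?E (fst p) (snd p) 1 \<union> ?E (fst p) (snd p) (-1)) \<le> exp (- 4 * real k) + exp (- 4 * real k)"
      using that True assms
      by (intro order_trans[OF measure_Un_le] add_mono interval_noise_upper_tail E_sets) auto
    then show ?thesis
      using True by (simp add: D_def case_prod_beta)
  qed (simp add: D_def case_prod_beta)
  have sub: "{h\<in>space (H n). \<not> noise_bounded k h} \<subseteq> (\<Union>p\<in>?I \<times> ?I. D p)"
  proof
    fix h assume h: "h \<in> {h\<in>space (H n). \<not> noise_bounded k h}"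
    then obtain a b where ab: "b \<in> ?I" "a \<in> {2^k..<b}"
      "\<not> \<bar>\<Sum>s=a..<b. snd (h s) - \<mu> (fst (h s))\<bar> \<le> sqrt (2 * real k * real (b - a))"
      by (auto simp: noise_bounded_def)
    then have "h \<in> D (a, b)"
      using h by (auto simp: D_def)
    moreover have "(a, b) \<in> ?I \<times> ?I"
      using ab by auto
    ultimately show "h \<in> (\<Union>p\<in>?I \<times> ?I. D p)"
      by blast
  qed
  have "prob {h\<in>space (H n). \<not> noise_bounded k h} \<le> prob (\<Union>p\<in>?I \<times> ?I. D p)"
    using sub D_sets by (intro finite_measure_mono) auto
  also have "\<dots> \<le> (\<Sum>p\<in>?I \<times> ?I. prob (D p))"
    using D_sets by (intro finite_measure_subadditive_finite) auto
  also have "\<dots> \<le> (\<Sum>p\<in>?I \<times> ?I. 2 * exp (- 4 * real k))"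
    using D_prob by (rule sum_mono)
  also have "\<dots> = real ((2^k + 1) * (2^k + 1)) * (2 * exp (- 4 * real k))"
    by (simp add: card_cartesian_product)
  also have "\<dots> \<le> (4 * 4^k) * (2 * (1 / 16^k))"
  proof (rule mult_mono)
    have "real (2^k + 1) \<le> 2 * 2^k"
      using one_le_power[of "2::real" k] by simp
    then have "real (2^k + 1) * real (2^k + 1) \<le> (2 * 2^k) * (2 * 2^k)"
      by (intro mult_mono) auto
    moreover have "(2 * 2^k) * (2 * 2^k) = (4 * 4^k :: real)"
      by (simp flip: power_mult_distrib)
    ultimately show "real ((2^k + 1) * (2^k + 1)) \<le> 4 * 4^k"
      by (simp only: of_nat_mult)
    have "2 ^ 4 \<le> exp (1::real) ^ 4"
      using exp_ge_add_one_self[of 1] by (intro power_mono) auto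
    then have "16 ^ k \<le> (exp (1::real) ^ 4) ^ k"
      by (intro power_mono) auto
    also have "\<dots> = exp (4 * real k)"
      by (simp flip: exp_of_nat_mult power_mult)
    finally show "2 * exp (- 4 * real k) \<le> 2 * (1 / 16^k)"
      by (simp add: exp_minus field_simps)
  qed auto
  also have "\<dots> = 8 / 4^k"
  proof -
    have "(16::real)^k = 4^k * 4^k"
      by (simp flip: power_mult_distrib)
    then show ?thesis
      by simp
  qed
  finally show ?thesis .
qed

end

section \<open>Change of measure between Bernoulli instances\<close>

definition bernoulli_reward :: "real \<Rightarrow> real measure" where
  "bernoulli_reward p = distr (measure_pmf (bernoulli_pmf p)) borel of_bool"

lemma prob_space_bernoulli_reward: "prob_space (bernoulli_reward p)"
  unfolding bernoulli_reward_def by (intro prob_space.prob_space_distr prob_space_measure_pmf) simp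

lemma sets_bernoulli_reward [measurable_cong]: "sets (bernoulli_reward p) = sets borel"
  by (simp add: bernoulli_reward_def)

lemma space_bernoulli_reward [simp]: "space (bernoulli_reward p) = UNIV"
  by (simp add: bernoulli_reward_def)

lemma nn_integral_bernoulli_reward:
  assumes "0 \<le> p" "p \<le> 1" "g \<in> borel_measurable borel"
  shows "(\<integral>\<^sup>+y. g y \<partial>bernoulli_reward p) = g 1 * ennreal p + g 0 * ennreal (1 - p)"
proof -
  have "(\<integral>\<^sup>+y. g y \<partial>bernoulli_reward p) = (\<integral>\<^sup>+b. g (of_bool b) \<partial>measure_pmf (bernoulli_pmf p))"
    unfolding bernoulli_reward_def using assms(3) by (intro nn_integral_distr) auto
  then show ?thesis
    using assms(1,2) by simp
qed

lemma measurable_bernoulli_reward: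
  assumes f [measurable]: "f \<in> borel_measurable M" and "\<And>x. x \<in> space M \<Longrightarrow> 0 \<le> f x \<and> f x \<le> 1"
  shows "(\<lambda>x. bernoulli_reward (f x)) \<in> M \<rightarrow>\<^sub>M prob_algebra borel"
proof (intro measurable_prob_algebraI measurable_subprob_algebra)
  fix S :: "real set" assume S: "S \<in> sets borel"
  have "emeasure (bernoulli_reward (f x)) S
      = indicator S 1 * ennreal (f x) + indicator S 0 * ennreal (1 - f x)" if "x \<in> space M" for x
  proof -
    have "emeasure (bernoulli_reward (f x)) S = (\<integral>\<^sup>+y. indicator S y \<partial>bernoulli_reward (f x))"
      using S by (simp add: sets_bernoulli_reward)
    also have "\<dots> = indicator S 1 * ennreal (f x) + indicator S 0 * ennreal (1 - f x)"
      using S assms(2)[OF that] by (intro nn_integral_bernoulli_reward) auto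
    finally show ?thesis .
  qed
  moreover have "(\<lambda>x. indicator S 1 * ennreal (f x) + indicator S 0 * ennreal (1 - f x)) \<in> borel_measurable M"
    by measurable
  ultimately show "(\<lambda>x. emeasure (bernoulli_reward (f x)) S) \<in> borel_measurable M"
    by (simp cong: measurable_cong)
qed (auto intro: prob_space_bernoulli_reward prob_space_imp_subprob_space simp: sets_bernoulli_reward)

lemma bernoulli_instance:
  fixes X :: "'a::metric_space set"
  assumes lip: "1-lipschitz_on X f" and f: "f ` X \<subseteq> {0..1}"
  shows "lipschitz_mab_instance X f (\<lambda>x. bernoulli_reward (f x))"
proof -
  have "f \<in> borel_measurable (arm_space X)"
    unfolding arm_space_def
    using lip by (intro borel_measurable_continuous_on_restrict lipschitz_on_continuous_on[where L = 1])
  then have kernel: "(\<lambda>x. bernoulli_reward (f x)) \<in> arm_space X \<rightarrow>\<^sub>M prob_algebra borel"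
    using f by (intro measurable_bernoulli_reward) (auto simp: arm_space_def space_restrict_space)
  have "AE y in bernoulli_reward p. y \<in> {0..1}" for p
    unfolding bernoulli_reward_def by (subst AE_distr_iff) auto
  moreover have "(\<integral>y. y \<partial>bernoulli_reward (f x)) = f x" if "x \<in> X" for x
  proof -
    have "(\<integral>y. y \<partial>bernoulli_reward (f x)) = (\<integral>b. of_bool b \<partial>measure_pmf (bernoulli_pmf (f x)))"
      unfolding bernoulli_reward_def by (rule integral_distr) auto
    also have "\<dots> = f x"
      using f that by (subst integral_bernoulli_pmf) auto
    finally show ?thesis .
  qed
  ultimately show ?thesis
    using lip f kernel by (simp add: lipschitz_mab_instance_def)
qed

text \<open>A drift argument: if one round raises \<open>T\<close> in conditional mean by at most a
  cost of the chosen arm, then \<open>T\<close> is bounded in mean by the expected total cost. It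
  serves for a squared martingale and for its sum of squared increments.\<close>

lemma (in mab_run) nn_integral_additive_bound:
  assumes T: "\<And>n. T n \<in> borel_measurable (history_space n)"
    and q [measurable]: "q \<in> borel_measurable (arm_space X)"
    and T_0: "T 0 (\<lambda>_. undefined) = 0"
    and step: "\<And>n h x. h \<in> space (history_space n) \<Longrightarrow> x \<in> X \<Longrightarrow>
       (\<integral>\<^sup>+y. T (Suc n) (h(n := (x, y))) \<partial>P x) \<le> T n h + q x"
  shows "(\<integral>\<^sup>+h. T n h \<partial>H n) \<le> (\<integral>\<^sup>+h. (\<Sum>s<n. q (fst (h s))) \<partial>H n)"
proof (induction n)
  case 0
  show ?case
    using T[of 0] by (simp add: nn_integral_H_0 T_0)
next
  case (Suc n)
  have msum: "(\<lambda>h. \<Sum>s<n. q (fst (h s))) \<in> borel_measurable (history_space n)" for n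
    by (intro borel_measurable_sum measurable_compose[OF measurable_arm_component q]) auto
  have mono: "(\<integral>\<^sup>+w. g w \<partial>round_law X A P n h) = (\<integral>\<^sup>+x. \<integral>\<^sup>+y. g (x, y) \<partial>P x \<partial>A n h)"
    if "h \<in> space (H n)" "g \<in> borel_measurable (round_space X)" for h and g :: "'a \<times> real \<Rightarrow> ennreal"
    using that by (intro nn_integral_round_law) (auto simp: space_H)
  have split: "(\<integral>\<^sup>+x. f h + q x \<partial>A n h) = f h + (\<integral>\<^sup>+x. q x \<partial>A n h)"
    if "h \<in> space (H n)" for h and f :: "(nat \<Rightarrow> 'a \<times> real) \<Rightarrow> ennreal"
    using that sets_arms[of h n] prob_space.emeasure_space_1[OF prob_space_arms[of h n]]
    by (subst nn_integral_add) (auto simp: space_H cong: measurable_cong_sets)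
  have meas: "(\<lambda>h. \<integral>\<^sup>+x. q x \<partial>A n h) \<in> borel_measurable (H n)"
    using measurable_compose[OF measurable_prob_algebraD[OF measurable_arms]
        nn_integral_measurable_subprob_algebra[OF q], of n] by (simp cong: measurable_cong_sets add: sets_H)
  have "(\<integral>\<^sup>+h. T (Suc n) h \<partial>H (Suc n)) = (\<integral>\<^sup>+h. \<integral>\<^sup>+w. T (Suc n) (h(n := w)) \<partial>round_law X A P n h \<partial>H n)"
    by (rule nn_integral_H_Suc[OF T])
  also have "\<dots> = (\<integral>\<^sup>+h. \<integral>\<^sup>+x. \<integral>\<^sup>+y. T (Suc n) (h(n := (x, y))) \<partial>P x \<partial>A n h \<partial>H n)"
    using measurable_compose[OF measurable_fun_upd_history T[of "Suc n"]]
    by (intro nn_integral_cong mono) (auto simp: space_H)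
  also have "\<dots> \<le> (\<integral>\<^sup>+h. \<integral>\<^sup>+x. T n h + q x \<partial>A n h \<partial>H n)"
    using space_arms by (intro nn_integral_mono step) (auto simp: space_H)
  also have "\<dots> = (\<integral>\<^sup>+h. T n h + (\<integral>\<^sup>+x. q x \<partial>A n h) \<partial>H n)"
    by (intro nn_integral_cong split)
  also have "\<dots> = (\<integral>\<^sup>+h. T n h \<partial>H n) + (\<integral>\<^sup>+h. \<integral>\<^sup>+x. q x \<partial>A n h \<partial>H n)"
    using T[of n] meas by (intro nn_integral_add) (auto cong: measurable_cong_sets simp: sets_H)
  also have "\<dots> \<le> (\<integral>\<^sup>+h. (\<Sum>s<n. q (fst (h s))) \<partial>H n) + (\<integral>\<^sup>+h. \<integral>\<^sup>+x. q x \<partial>A n h \<partial>H n)"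
    using Suc by (rule add_right_mono)
  also have "\<dots> = (\<integral>\<^sup>+h. (\<Sum>s<n. q (fst (h s))) + (\<integral>\<^sup>+x. q x \<partial>A n h) \<partial>H n)"
    using meas msum[of n] by (intro nn_integral_add[symmetric]) (auto cong: measurable_cong_sets simp: sets_H)
  also have "\<dots> = (\<integral>\<^sup>+h. \<integral>\<^sup>+x. (\<Sum>s<n. q (fst (h s))) + q x \<partial>A n h \<partial>H n)"
    by (intro nn_integral_cong split[symmetric])
  also have "\<dots> = (\<integral>\<^sup>+h. \<integral>\<^sup>+x. \<integral>\<^sup>+y. (\<Sum>s<Suc n. q (fst ((h(n := (x, y))) s))) \<partial>P x \<partial>A n h \<partial>H n)"
    using space_arms prob_space.emeasure_space_1[OF prob_space_rewards]
    by (intro nn_integral_cong) (simp add: space_H)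
  also have "\<dots> = (\<integral>\<^sup>+h. \<integral>\<^sup>+w. (\<Sum>s<Suc n. q (fst ((h(n := w)) s))) \<partial>round_law X A P n h \<partial>H n)"
    by (intro nn_integral_cong mono[symmetric]) auto
  also have "\<dots> = (\<integral>\<^sup>+h. (\<Sum>s<Suc n. q (fst (h s))) \<partial>H (Suc n))"
    by (rule nn_integral_H_Suc[symmetric]) (rule msum)
  finally show ?case .
qed

text \<open>
  Bounds the likelihood ratio below by a quadratic in its relative increments, so that only
  second moments under the base instance are needed.
\<close>

lemma prod_one_plus_ge:
  fixes \<sigma> :: "nat \<Rightarrow> real"
  assumes "\<And>s. s < n \<Longrightarrow> \<bar>\<sigma> s\<bar> \<le> 1 / 2"
  shows "1 + (\<Sum>s<n. \<sigma> s) - 2 * (\<Sum>s<n. (\<sigma> s)\<^sup>2) \<le> (\<Prod>s<n. 1 + \<sigma> s)"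
proof -
  have "exp (\<sigma> s - 2 * (\<sigma> s)\<^sup>2) \<le> 1 + \<sigma> s" if "s < n" for s
  proof -
    have "\<sigma> s - 2 * (\<sigma> s)\<^sup>2 \<le> ln (1 + \<sigma> s)"
      using abs_ln_one_plus_x_minus_x_bound[OF assms[OF that]] by linarith
    then have "exp (\<sigma> s - 2 * (\<sigma> s)\<^sup>2) \<le> exp (ln (1 + \<sigma> s))"
      by simp
    also have "\<dots> = 1 + \<sigma> s"
      using assms[OF that] by (intro exp_ln) linarith
    finally show ?thesis .
  qed
  then have "(\<Prod>s<n. exp (\<sigma> s - 2 * (\<sigma> s)\<^sup>2)) \<le> (\<Prod>s<n. 1 + \<sigma> s)"
    by (intro prod_mono) auto
  moreover have "(\<Prod>s<n. exp (\<sigma> s - 2 * (\<sigma> s)\<^sup>2)) = exp (\<Sum>s<n. \<sigma> s - 2 * (\<sigma> s)\<^sup>2)"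
    by (simp add: exp_sum)
  moreover have "1 + (\<Sum>s<n. \<sigma> s - 2 * (\<sigma> s)\<^sup>2) \<le> exp (\<Sum>s<n. \<sigma> s - 2 * (\<sigma> s)\<^sup>2)"
    by (rule exp_ge_add_one_self)
  ultimately have "1 + (\<Sum>s<n. \<sigma> s - 2 * (\<sigma> s)\<^sup>2) \<le> (\<Prod>s<n. 1 + \<sigma> s)"
    by linarith
  then show ?thesis
    by (simp add: sum_subtractf sum_distrib_left)
qed

text \<open>Base payoff \<open>f\<close> and perturbed payoff \<open>g\<close>. Means in
  \<open>{1/4..3/4}\<close> and a change of at most \<open>1 / 8\<close> keep the relative
  likelihood increment of one reward within \<open>1 / 2\<close>, the range required by
  \<open>prod_one_plus_ge\<close>.\<close>

locale needle =
  fixes X :: "'a::metric_space set" and A :: "'a bandit_alg" and f g :: "'a \<Rightarrow> real"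
    and B :: "'a set" and \<delta> :: real
  assumes alg: "bandit_algorithm X A"
    and lip_f: "1-lipschitz_on X f" and lip_g: "1-lipschitz_on X g"
    and range_f: "f ` X \<subseteq> {1/4..3/4}" and range_g: "g ` X \<subseteq> {1/4..3/4}"
    and B: "B \<in> sets (arm_space X)"
    and \<delta>: "0 \<le> \<delta>" "\<delta> \<le> 1 / 8"
    and diff: "\<And>x. x \<in> X \<Longrightarrow> \<bar>g x - f x\<bar> \<le> \<delta> * indicator B x"
begin

sublocale F: mab_run X A f "\<lambda>x. bernoulli_reward (f x)"
proof (unfold_locales, rule alg, rule bernoulli_instance[OF lip_f])
  show "f ` X \<subseteq> {0..1}"
    by (rule order_trans[OF range_f]) auto
qed
sublocale G: mab_run X A g "\<lambda>x. bernoulli_reward (g x)"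
proof (unfold_locales, rule alg, rule bernoulli_instance[OF lip_g])
  show "g ` X \<subseteq> {0..1}"
    by (rule order_trans[OF range_g]) auto
qed

text \<open>\<open>1 + \<sigma>\<close> is the likelihood ratio of one Bernoulli reward under
  \<open>g\<close> against \<open>f\<close>; rewards other than 0 and 1 have probability zero and
  are treated like 0.\<close>

definition \<sigma> :: "'a \<times> real \<Rightarrow> real" where
  "\<sigma> = (\<lambda>(x, y). if y = 1 then (g x - f x) / f x else - ((g x - f x) / (1 - f x)))"

lemma range: "x \<in> X \<Longrightarrow> 1/4 \<le> f x \<and> f x \<le> 3/4 \<and> 1/4 \<le> g x \<and> g x \<le> 3/4"
  using range_f range_g by fastforce

lemma measurable_\<sigma> [measurable]: "\<sigma> \<in> borel_measurable (round_space X)"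
proof -
  have "\<sigma> = (\<lambda>w. if snd w = 1 then (g (fst w) - f (fst w)) / f (fst w)
      else - ((g (fst w) - f (fst w)) / (1 - f (fst w))))"
    by (auto simp: \<sigma>_def)
  then show ?thesis
    by simp
qed

lemma \<sigma>_bound: "x \<in> X \<Longrightarrow> \<bar>\<sigma> (x, y)\<bar> \<le> 1 / 2"
proof -
  assume x: "x \<in> X"
  have d: "\<bar>g x - f x\<bar> \<le> 1 / 8"
    using diff[OF x] \<delta> by (auto split: split_indicator_asm)
  have "\<bar>g x - f x\<bar> / c \<le> 1 / 2" if "1/4 \<le> c" for c
    using d that by (simp add: field_simps)
  from this[of "f x"] this[of "1 - f x"] show ?thesis
    using range[OF x] by (auto simp: \<sigma>_def abs_divide)
qed

lemma nn_integral_f: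
  "x \<in> X \<Longrightarrow> q \<in> borel_measurable borel \<Longrightarrow>
    (\<integral>\<^sup>+y. q y \<partial>bernoulli_reward (f x)) = q 1 * ennreal (f x) + q 0 * ennreal (1 - f x)"
  using range[of x] by (intro nn_integral_bernoulli_reward) auto

lemma nn_integral_g:
  "x \<in> X \<Longrightarrow> q \<in> borel_measurable borel \<Longrightarrow>
    (\<integral>\<^sup>+y. q y \<partial>bernoulli_reward (g x)) = q 1 * ennreal (g x) + q 0 * ennreal (1 - g x)"
  using range[of x] by (intro nn_integral_bernoulli_reward) auto

lemma measurable_Pair_arm: "x \<in> X \<Longrightarrow> Pair x \<in> borel \<rightarrow>\<^sub>M round_space X"
  unfolding round_space_def by (intro measurable_Pair) (auto simp: F.space_arm_space)

lemma round_change_of_measure: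
  assumes h: "h \<in> space (F.history_space n)" and q [measurable]: "q \<in> borel_measurable (round_space X)"
  shows "(\<integral>\<^sup>+w. q w \<partial>round_law X A (\<lambda>x. bernoulli_reward (g x)) n h)
    = (\<integral>\<^sup>+w. q w * ennreal (1 + \<sigma> w) \<partial>round_law X A (\<lambda>x. bernoulli_reward (f x)) n h)"
proof -
  have "(\<integral>\<^sup>+y. q (x, y) \<partial>bernoulli_reward (g x))
      = (\<integral>\<^sup>+y. q (x, y) * ennreal (1 + \<sigma> (x, y)) \<partial>bernoulli_reward (f x))" if x: "x \<in> X" for x
  proof -
    have 1: "(\<lambda>y. q (x, y)) \<in> borel_measurable borel"
      by (rule measurable_compose[OF measurable_Pair_arm[OF x] q])
    have 2: "(\<lambda>y. q (x, y) * ennreal (1 + \<sigma> (x, y))) \<in> borel_measurable borel"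
      by (rule measurable_compose[OF measurable_Pair_arm[OF x], of "\<lambda>w. q w * ennreal (1 + \<sigma> w)"]) measurable
    have "(1 + \<sigma> (x, 1)) * f x = g x" "(1 + \<sigma> (x, 0)) * (1 - f x) = 1 - g x"
      using range[OF x] by (auto simp: \<sigma>_def field_simps)
    then have "ennreal (1 + \<sigma> (x, 1)) * ennreal (f x) = ennreal (g x)"
      "ennreal (1 + \<sigma> (x, 0)) * ennreal (1 - f x) = ennreal (1 - g x)"
      using range[OF x] by (simp_all flip: ennreal_mult'')
    then show ?thesis
      unfolding nn_integral_f[OF x 2] nn_integral_g[OF x 1] by (simp add: mult.assoc)
  qed
  then show ?thesis
    using h F.space_arms[OF h]
    by (subst G.nn_integral_round_law[OF h q], subst F.nn_integral_round_law[OF h])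
      (auto intro!: nn_integral_cong)
qed

text \<open>The arms are drawn from the same kernel under both payoffs, so only the reward
  likelihoods enter the density.\<close>

lemma change_of_measure:
  assumes "q \<in> borel_measurable (F.history_space n)"
  shows "(\<integral>\<^sup>+h. q h \<partial>G.H n) = (\<integral>\<^sup>+h. q h * ennreal (\<Prod>s<n. 1 + \<sigma> (h s)) \<partial>F.H n)"
  using assms
proof (induction n arbitrary: q)
  case 0
  then show ?case
    by (simp add: G.nn_integral_H_0 F.nn_integral_H_0)
next
  case (Suc n)
  note [measurable] = Suc.prems
  let ?P = "\<lambda>x. bernoulli_reward (g x)" and ?Q = "\<lambda>x. bernoulli_reward (f x)"
  have [measurable]: "(\<lambda>h. \<integral>\<^sup>+h'. q h' \<partial>G.eP n h) \<in> borel_measurable (F.history_space n)"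
    using measurable_compose[OF G.measurable_eP nn_integral_measurable_subprob_algebra[OF Suc.prems]] .
  have L: "(\<lambda>h. ennreal (\<Prod>s<n. 1 + \<sigma> (h s))) \<in> borel_measurable (F.history_space n)" for n
    by measurable
  have "(\<integral>\<^sup>+h. q h \<partial>G.H (Suc n)) = (\<integral>\<^sup>+h. \<integral>\<^sup>+h'. q h' \<partial>G.eP n h \<partial>G.H n)"
    unfolding G.H_Suc by (rule nn_integral_bind[where B = "F.history_space (Suc n)"]) measurable
  \<comment> \<open>The induction hypothesis is applied to the test function with its last round
    integrated out under \<open>g\<close>, hence the generalisation over \<open>q\<close>.\<close>
  also have "\<dots> = (\<integral>\<^sup>+h. (\<integral>\<^sup>+h'. q h' \<partial>G.eP n h) * ennreal (\<Prod>s<n. 1 + \<sigma> (h s)) \<partial>F.H n)"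
    by (rule Suc.IH) measurable
  also have "\<dots> = (\<integral>\<^sup>+h. \<integral>\<^sup>+w. q (h(n := w)) * ennreal (\<Prod>s<Suc n. 1 + \<sigma> ((h(n := w)) s))
      \<partial>round_law X A ?Q n h \<partial>F.H n)"
  proof (rule nn_integral_cong)
    fix h assume "h \<in> space (F.H n)"
    then have h: "h \<in> space (F.history_space n)"
      by (simp add: F.space_H)
    have qm [measurable]: "(\<lambda>w. q (h(n := w))) \<in> borel_measurable (round_space X)"
      by (rule measurable_compose[OF F.measurable_fun_upd_history[OF h] Suc.prems])
    have nonneg: "0 \<le> (\<Prod>s<n. 1 + \<sigma> (h s))"
    proof (rule prod_nonneg)
      fix s assume "s \<in> {..<n}"
      then have "fst (h s) \<in> X"
        using F.arm_in_space[OF h] by simp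
      from \<sigma>_bound[OF this, of "snd (h s)"] show "0 \<le> 1 + \<sigma> (h s)"
        by simp
    qed
    have "(\<integral>\<^sup>+h'. q h' \<partial>G.eP n h) * ennreal (\<Prod>s<n. 1 + \<sigma> (h s))
        = (\<integral>\<^sup>+w. q (h(n := w)) * ennreal (1 + \<sigma> w) \<partial>round_law X A ?Q n h) * ennreal (\<Prod>s<n. 1 + \<sigma> (h s))"
      by (simp only: G.nn_integral_eP[OF h Suc.prems] round_change_of_measure[OF h qm])
    also have "\<dots> = (\<integral>\<^sup>+w. q (h(n := w)) * ennreal (1 + \<sigma> w) * ennreal (\<Prod>s<n. 1 + \<sigma> (h s)) \<partial>round_law X A ?Q n h)"
      using F.sets_P[OF h] by (intro nn_integral_multc[symmetric]) (simp cong: measurable_cong_sets)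
    also have "\<dots> = (\<integral>\<^sup>+w. q (h(n := w)) * ennreal (\<Prod>s<Suc n. 1 + \<sigma> ((h(n := w)) s)) \<partial>round_law X A ?Q n h)"
      using nonneg by (intro nn_integral_cong) (simp add: ennreal_mult'' mult_ac)
    finally show "(\<integral>\<^sup>+h'. q h' \<partial>G.eP n h) * ennreal (\<Prod>s<n. 1 + \<sigma> (h s))
        = (\<integral>\<^sup>+w. q (h(n := w)) * ennreal (\<Prod>s<Suc n. 1 + \<sigma> ((h(n := w)) s)) \<partial>round_law X A ?Q n h)" .
  qed
  also have "\<dots> = (\<integral>\<^sup>+h. q h * ennreal (\<Prod>s<Suc n. 1 + \<sigma> (h s)) \<partial>F.H (Suc n))"
    by (rule F.nn_integral_H_Suc[symmetric]) measurable
  finally show ?case .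
qed

text \<open>Under \<open>f\<close> the increment has mean zero, so the cross term with
  \<open>a\<close> vanishes, and variance \<open>e\<^sup>2 / (p * (1 - p))\<close>.\<close>

lemma quadratic_moment:
  assumes x: "x \<in> X"
  shows "(\<integral>\<^sup>+y. ennreal ((a + \<sigma> (x, y))\<^sup>2) \<partial>bernoulli_reward (f x)) \<le> ennreal (a\<^sup>2) + ennreal (6 * \<delta>\<^sup>2 * indicator B x)"
    and "(\<integral>\<^sup>+y. ennreal ((\<sigma> (x, y))\<^sup>2) \<partial>bernoulli_reward (f x)) \<le> ennreal (6 * \<delta>\<^sup>2 * indicator B x)"
proof -
  define p e where "p = f x" and "e = g x - f x"
  have p: "1/4 \<le> p" "p \<le> 3/4"
    using range[OF x] by (auto simp: p_def)
  \<comment> \<open>Gives \<open>p * (1 - p) \<ge> 3/16\<close>, and the factor 16/3 is rounded up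
    to 6.\<close>
  have "0 \<le> (p - 1/4) * (3/4 - p)"
    using p by simp
  moreover have "(p - 1/4) * (3/4 - p) = p * (1 - p) - 3/16"
    by (simp add: field_simps)
  ultimately have pp: "3/16 \<le> p * (1 - p)"
    by linarith
  have e: "e\<^sup>2 \<le> \<delta>\<^sup>2 * indicator B x"
    using power_mono[OF diff[OF x], of 2] by (auto simp: e_def power_mult_distrib split: split_indicator_asm)
  have "e\<^sup>2 / (p * (1 - p)) \<le> e\<^sup>2 / (3/16)"
    using pp p by (intro divide_left_mono mult_pos_pos) auto
  also have "\<dots> \<le> 6 * e\<^sup>2"
    by simp
  finally have v: "e\<^sup>2 / (p * (1 - p)) \<le> 6 * \<delta>\<^sup>2 * indicator B x"
    using e by simp
  have \<sigma>: "\<sigma> (x, 1) = e / p" "\<sigma> (x, 0) = - (e / (1 - p))"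
    by (auto simp: \<sigma>_def p_def e_def)
  have 1: "(\<integral>\<^sup>+y. ennreal ((a + \<sigma> (x, y))\<^sup>2) \<partial>bernoulli_reward (f x)) = ennreal (a\<^sup>2 + e\<^sup>2 / (p * (1 - p)))" for a
  proof -
    have [measurable]: "(\<lambda>y. \<sigma> (x, y)) \<in> borel_measurable borel"
      by (rule measurable_compose[OF measurable_Pair_arm[OF x] measurable_\<sigma>])
    have "(\<integral>\<^sup>+y. ennreal ((a + \<sigma> (x, y))\<^sup>2) \<partial>bernoulli_reward (f x))
        = ennreal ((a + e / p)\<^sup>2) * ennreal p + ennreal ((a - e / (1 - p))\<^sup>2) * ennreal (1 - p)"
      by (subst nn_integral_f[OF x]) (simp_all add: \<sigma> flip: p_def)
    also have "\<dots> = ennreal ((a + e / p)\<^sup>2 * p + (a - e / (1 - p))\<^sup>2 * (1 - p))"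
      using p by (simp add: ennreal_mult'')
    also have "(a + e / p)\<^sup>2 * p + (a - e / (1 - p))\<^sup>2 * (1 - p) = a\<^sup>2 + e\<^sup>2 / (p * (1 - p))"
    proof -
      have sq: "(a + b / c)\<^sup>2 * c = a\<^sup>2 * c + 2 * a * b + b\<^sup>2 / c" if "0 < c" for b c
        using that by (simp add: field_simps power2_eq_square)
      have "(a + e / p)\<^sup>2 * p = a\<^sup>2 * p + 2 * a * e + e\<^sup>2 / p"
        using p by (intro sq) simp
      moreover have "(a - e / (1 - p))\<^sup>2 * (1 - p) = a\<^sup>2 * (1 - p) - 2 * a * e + e\<^sup>2 / (1 - p)"
        using p sq[of "1 - p" "- e"] by simp
      moreover have "e\<^sup>2 / p + e\<^sup>2 / (1 - p) = e\<^sup>2 / (p * (1 - p))"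
        using p by (simp add: field_simps)
      ultimately show ?thesis
        by (simp add: algebra_simps)
    qed
    finally show ?thesis .
  qed
  show "(\<integral>\<^sup>+y. ennreal ((a + \<sigma> (x, y))\<^sup>2) \<partial>bernoulli_reward (f x)) \<le> ennreal (a\<^sup>2) + ennreal (6 * \<delta>\<^sup>2 * indicator B x)"
    unfolding 1 using v by (simp flip: ennreal_plus add: ennreal_leI)
  show "(\<integral>\<^sup>+y. ennreal ((\<sigma> (x, y))\<^sup>2) \<partial>bernoulli_reward (f x)) \<le> ennreal (6 * \<delta>\<^sup>2 * indicator B x)"
    using 1[of 0] v by (simp add: ennreal_leI)
qed

definition visits :: "nat \<Rightarrow> (nat \<Rightarrow> 'a \<times> real) \<Rightarrow> real" where
  "visits n h = (\<Sum>s<n. indicator B (fst (h s)))"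

lemma measurable_visits [measurable]: "visits n \<in> borel_measurable (F.history_space n)"
proof -
  have "indicator B \<in> borel_measurable (arm_space X)"
    using B by measurable
  then have "(\<lambda>h. indicator B (fst (h s))) \<in> borel_measurable (F.history_space n)" if "s < n" for s
    by (rule measurable_compose[OF F.measurable_arm_component[OF that]])
  then show ?thesis
    unfolding visits_def[abs_def] by (intro borel_measurable_sum) auto
qed

lemma visits_bounds: "0 \<le> visits n h" "visits n h \<le> real n"
proof -
  show "0 \<le> visits n h"
    by (simp add: visits_def sum_nonneg)
  have "visits n h \<le> (\<Sum>s<n. 1)"
    unfolding visits_def by (rule sum_mono) (auto split: split_indicator)
  then show "visits n h \<le> real n"
    by simp
qed

text \<open>The increments form a martingale, so second moments add up, and only rounds inside
  \<open>B\<close> contribute.\<close>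

lemma noise_moments:
  "(\<integral>\<^sup>+h. ennreal ((\<Sum>s<n. \<sigma> (h s))\<^sup>2) \<partial>F.H n) \<le> (\<integral>\<^sup>+h. ennreal (6 * \<delta>\<^sup>2 * visits n h) \<partial>F.H n)"
  "(\<integral>\<^sup>+h. ennreal (\<Sum>s<n. (\<sigma> (h s))\<^sup>2) \<partial>F.H n) \<le> (\<integral>\<^sup>+h. ennreal (6 * \<delta>\<^sup>2 * visits n h) \<partial>F.H n)"
proof -
  let ?q = "\<lambda>x. ennreal (6 * \<delta>\<^sup>2 * indicator B x)"
  have q [measurable]: "?q \<in> borel_measurable (arm_space X)"
    using B by measurable
  have sum: "(\<Sum>s<n. ?q (fst (h s))) = ennreal (6 * \<delta>\<^sup>2 * visits n h)" for h
    by (simp add: visits_def sum_distrib_left)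
  have prob: "emeasure (bernoulli_reward (f x)) UNIV = 1" for x
    using prob_space.emeasure_space_1[OF prob_space_bernoulli_reward, of "f x"]
    by (simp add: bernoulli_reward_def)
  have [measurable]: "(\<lambda>y. \<sigma> (x, y)) \<in> borel_measurable borel" if "x \<in> X" for x
    by (rule measurable_compose[OF measurable_Pair_arm[OF that] measurable_\<sigma>])
  show "(\<integral>\<^sup>+h. ennreal ((\<Sum>s<n. \<sigma> (h s))\<^sup>2) \<partial>F.H n) \<le> (\<integral>\<^sup>+h. ennreal (6 * \<delta>\<^sup>2 * visits n h) \<partial>F.H n)"
    unfolding sum[symmetric]
  proof (rule F.nn_integral_additive_bound[where T = "\<lambda>n h. ennreal ((\<Sum>s<n. \<sigma> (h s))\<^sup>2)", OF _ q])
    fix n h x assume "x \<in> X"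
    then show "(\<integral>\<^sup>+y. ennreal ((\<Sum>s<Suc n. \<sigma> ((h(n := (x, y))) s))\<^sup>2) \<partial>bernoulli_reward (f x))
      \<le> ennreal ((\<Sum>s<n. \<sigma> (h s))\<^sup>2) + ?q x"
      using quadratic_moment(1)[of x "\<Sum>s<n. \<sigma> (h s)"] by simp
  qed auto
  show "(\<integral>\<^sup>+h. ennreal (\<Sum>s<n. (\<sigma> (h s))\<^sup>2) \<partial>F.H n) \<le> (\<integral>\<^sup>+h. ennreal (6 * \<delta>\<^sup>2 * visits n h) \<partial>F.H n)"
    unfolding sum[symmetric]
  proof (rule F.nn_integral_additive_bound[where T = "\<lambda>n h. ennreal (\<Sum>s<n. (\<sigma> (h s))\<^sup>2)", OF _ q])
    fix n h x assume x: "x \<in> X"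
    have "(\<integral>\<^sup>+y. ennreal (\<Sum>s<Suc n. (\<sigma> ((h(n := (x, y))) s))\<^sup>2) \<partial>bernoulli_reward (f x))
        = (\<integral>\<^sup>+y. ennreal (\<Sum>s<n. (\<sigma> (h s))\<^sup>2) + ennreal ((\<sigma> (x, y))\<^sup>2) \<partial>bernoulli_reward (f x))"
      by (simp add: sum_nonneg)
    also have "\<dots> = ennreal (\<Sum>s<n. (\<sigma> (h s))\<^sup>2) + (\<integral>\<^sup>+y. ennreal ((\<sigma> (x, y))\<^sup>2) \<partial>bernoulli_reward (f x))"
      using x by (subst nn_integral_add) (auto simp: prob)
    also have "\<dots> \<le> ennreal (\<Sum>s<n. (\<sigma> (h s))\<^sup>2) + ?q x"
      using quadratic_moment(2)[OF x] by (rule add_left_mono)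
    finally show "(\<integral>\<^sup>+y. ennreal (\<Sum>s<Suc n. (\<sigma> ((h(n := (x, y))) s))\<^sup>2) \<partial>bernoulli_reward (f x))
      \<le> ennreal (\<Sum>s<n. (\<sigma> (h s))\<^sup>2) + ?q x" .
  qed auto
qed

text \<open>Pointwise, \<open>q\<close> exceeds its likelihood-weighted version by at most
  \<open>- S + 2 * V\<close>, where \<open>S\<close> and \<open>V\<close> are the sums of the
  increments and of their squares. The linear term is traded for
  \<open>1 / 16 + 4 * S\<^sup>2\<close>, and both second moments are at most \<open>v\<close>,
  whence \<open>6 * v\<close>.\<close>

lemma nn_integral_change_bound:
  assumes q [measurable]: "q \<in> borel_measurable (F.history_space n)" and q01: "\<And>h. 0 \<le> q h \<and> q h \<le> 1"
    and v: "(\<integral>\<^sup>+h. ennreal (6 * \<delta>\<^sup>2 * visits n h) \<partial>F.H n) \<le> ennreal v" "0 \<le> v"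
  shows "(\<integral>\<^sup>+h. ennreal (q h) \<partial>F.H n) \<le> (\<integral>\<^sup>+h. ennreal (q h) \<partial>G.H n) + ennreal (1 / 16 + 6 * v)"
proof -
  let ?L = "\<lambda>h. \<Prod>s<n. 1 + \<sigma> (h s)" and ?S = "\<lambda>h. \<Sum>s<n. \<sigma> (h s)" and ?V = "\<lambda>h. \<Sum>s<n. (\<sigma> (h s))\<^sup>2"
  have point: "ennreal (q h) \<le> ennreal (q h) * ennreal (?L h) + ennreal (1 / 16) + 4 * ennreal ((?S h)\<^sup>2) + 2 * ennreal (?V h)"
    if h: "h \<in> space (F.H n)" for h
  proof -
    have \<sigma>: "\<bar>\<sigma> (h s)\<bar> \<le> 1 / 2" if "s < n" for s
      using \<sigma>_bound[of "fst (h s)" "snd (h s)"] F.arm_in_space[of h n s] that h by (simp add: F.space_H)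
    have L: "1 + ?S h - 2 * ?V h \<le> ?L h"
      by (rule prod_one_plus_ge) (rule \<sigma>)
    have L0: "0 \<le> ?L h"
    proof (rule prod_nonneg)
      fix s assume "s \<in> {..<n}"
      then show "0 \<le> 1 + \<sigma> (h s)"
        using \<sigma>[of s] by simp
    qed
    have V: "0 \<le> ?V h"
      by (rule sum_nonneg) simp
    \<comment> \<open>Completing the square; four times this inequality bounds
      \<open>- S\<close>.\<close>
    have "0 \<le> (1 / 8 + ?S h)\<^sup>2"
      by simp
    also have "(1 / 8 + ?S h)\<^sup>2 = 1 / 64 + ?S h / 4 + (?S h)\<^sup>2"
      by (simp add: field_simps power2_eq_square)
    finally have S: "- ?S h \<le> 1 / 16 + 4 * (?S h)\<^sup>2"
      by simp
    let ?R = "1 / 16 + 4 * (?S h)\<^sup>2 + 2 * ?V h"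
    have "q h * (1 - ?L h) \<le> q h * ?R"
      using q01[of h] L S by (intro mult_left_mono) auto
    also have "\<dots> \<le> 1 * ?R"
      using q01[of h] V by (intro mult_right_mono) (auto intro!: add_nonneg_nonneg)
    finally have "q h \<le> q h * ?L h + 1 / 16 + 4 * (?S h)\<^sup>2 + 2 * ?V h"
      by (simp add: algebra_simps)
    then have "ennreal (q h) \<le> ennreal (q h * ?L h + 1 / 16 + 4 * (?S h)\<^sup>2 + 2 * ?V h)"
      by (rule ennreal_leI)
    also have "\<dots> = ennreal (q h) * ennreal (?L h) + ennreal (1 / 16) + 4 * ennreal ((?S h)\<^sup>2) + 2 * ennreal (?V h)"
      using q01[of h] L0 V by (simp add: ennreal_mult)
    finally show ?thesis .
  qed
  have "(\<integral>\<^sup>+h. ennreal (q h) \<partial>F.H n) \<le> (\<integral>\<^sup>+h. ennreal (q h) * ennreal (?L h) + ennreal (1 / 16)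
      + 4 * ennreal ((?S h)\<^sup>2) + 2 * ennreal (?V h) \<partial>F.H n)"
    by (rule nn_integral_mono) (rule point)
  also have "\<dots> = (\<integral>\<^sup>+h. ennreal (q h) * ennreal (?L h) \<partial>F.H n) + ennreal (1 / 16)
      + 4 * (\<integral>\<^sup>+h. ennreal ((?S h)\<^sup>2) \<partial>F.H n) + 2 * (\<integral>\<^sup>+h. ennreal (?V h) \<partial>F.H n)"
    using prob_space.emeasure_space_1[OF F.prob_space_H]
    by (simp add: nn_integral_add nn_integral_cmult)
  also have "(\<integral>\<^sup>+h. ennreal (q h) * ennreal (?L h) \<partial>F.H n) = (\<integral>\<^sup>+h. ennreal (q h) \<partial>G.H n)"
    by (rule change_of_measure[symmetric]) measurable
  also have "(\<integral>\<^sup>+h. ennreal (q h) \<partial>G.H n) + ennreal (1 / 16)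
      + 4 * (\<integral>\<^sup>+h. ennreal ((?S h)\<^sup>2) \<partial>F.H n) + 2 * (\<integral>\<^sup>+h. ennreal (?V h) \<partial>F.H n)
    \<le> (\<integral>\<^sup>+h. ennreal (q h) \<partial>G.H n) + ennreal (1 / 16) + 4 * ennreal v + 2 * ennreal v"
    using noise_moments[of n] v(1) by (intro add_mono mult_left_mono order_refl) (auto intro: order_trans)
  also have "\<dots> = (\<integral>\<^sup>+h. ennreal (q h) \<partial>G.H n) + ennreal (1 / 16 + 6 * v)"
  proof -
    have "ennreal (1 / 16) + (4 * ennreal v + 2 * ennreal v) = ennreal (1 / 16 + 6 * v)"
      using v(2) by (simp add: ennreal_mult flip: distrib_right)
    then show ?thesis
      by (simp add: add.assoc)
  qed
  finally show ?thesis .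
qed

text \<open>The fraction \<open>q\<close> of rounds outside \<open>B\<close> has mean at least
  \<open>1 - 1 / N \<ge> 1 / 2\<close> under \<open>f\<close>. Changing to \<open>g\<close> costs at
  most \<open>1 / 16 + 6 / 96 = 1 / 8\<close>, so a mean of at least \<open>1 / 4\<close> remains,
  and every such round loses \<gamma>.\<close>

lemma regret_lower_bound:
  assumes few: "(\<integral>\<^sup>+h. ennreal (visits t h) \<partial>F.H t) \<le> ennreal (real t / N)" and N: "2 \<le> N"
    and scale: "6 * \<delta>\<^sup>2 * (real t / N) \<le> 1 / 96"
    and \<gamma>: "0 \<le> \<gamma>" "\<And>x. x \<in> X \<Longrightarrow> x \<notin> B \<Longrightarrow> \<gamma> \<le> (SUP x\<in>X. g x) - g x"
  shows "real t * \<gamma> / 4 \<le> regret X A g (\<lambda>x. bernoulli_reward (g x)) t"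
proof (cases "t = 0")
  case True
  then show ?thesis
    using G.regret_nonneg[of 0] by simp
next
  case False
  define q where "q h = 1 - visits t h / real t" for h
  have q [measurable]: "q \<in> borel_measurable (F.history_space t)"
    unfolding q_def[abs_def] by measurable
  have q01: "0 \<le> q h \<and> q h \<le> 1" for h
    using visits_bounds[of t h] False by (auto simp: q_def)
  have "(\<integral>\<^sup>+h. ennreal (6 * \<delta>\<^sup>2 * visits t h) \<partial>F.H t) = ennreal (6 * \<delta>\<^sup>2) * (\<integral>\<^sup>+h. ennreal (visits t h) \<partial>F.H t)"
    using visits_bounds(1) by (simp add: ennreal_mult nn_integral_cmult)
  also have "\<dots> \<le> ennreal (6 * \<delta>\<^sup>2) * ennreal (real t / N)"
    using few by (rule mult_left_mono) simp
  also have "\<dots> \<le> ennreal (1 / 96)"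
    using scale N by (simp flip: ennreal_mult add: ennreal_leI)
  finally have v: "(\<integral>\<^sup>+h. ennreal (6 * \<delta>\<^sup>2 * visits t h) \<partial>F.H t) \<le> ennreal (1 / 96)" .
  have "(\<integral>\<^sup>+h. ennreal (q h) \<partial>F.H t) \<le> (\<integral>\<^sup>+h. ennreal (q h) \<partial>G.H t) + ennreal (1 / 16 + 6 * (1 / 96))"
    using q q01 v by (rule nn_integral_change_bound) simp
  then have 1: "(\<integral>\<^sup>+h. ennreal (q h) \<partial>F.H t) \<le> (\<integral>\<^sup>+h. ennreal (q h) \<partial>G.H t) + ennreal (1 / 8)"
    by simp
  have "1 = (\<integral>\<^sup>+h. ennreal (q h) + ennreal (1 / real t) * ennreal (visits t h) \<partial>F.H t)"
  proof -
    have "ennreal (q h) + ennreal (1 / real t) * ennreal (visits t h) = 1" for h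
      using q01[of h] visits_bounds(1)[of t h] False
      by (simp flip: ennreal_mult ennreal_plus add: q_def)
    then show ?thesis
      using prob_space.emeasure_space_1[OF F.prob_space_H] by simp
  qed
  also have "\<dots> = (\<integral>\<^sup>+h. ennreal (q h) \<partial>F.H t) + ennreal (1 / real t) * (\<integral>\<^sup>+h. ennreal (visits t h) \<partial>F.H t)"
    by (simp add: nn_integral_add nn_integral_cmult)
  also have "\<dots> \<le> ((\<integral>\<^sup>+h. ennreal (q h) \<partial>G.H t) + ennreal (1 / 8)) + ennreal (1 / real t) * ennreal (real t / N)"
    using 1 few by (intro add_mono mult_left_mono) auto
  also have "\<dots> \<le> (\<integral>\<^sup>+h. ennreal (q h) \<partial>G.H t) + ennreal (3 / 4)"
  proof -
    have "ennreal (1 / 8) + ennreal (1 / real t) * ennreal (real t / N) \<le> ennreal (3 / 4)"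
      using N False by (simp flip: ennreal_mult ennreal_plus add: ennreal_leI field_simps)
    then show ?thesis
      by (simp add: add.assoc add_left_mono)
  qed
  finally have 2: "ennreal (1 / 4) \<le> (\<integral>\<^sup>+h. ennreal (q h) \<partial>G.H t)"
    by (cases "\<integral>\<^sup>+h. ennreal (q h) \<partial>G.H t") (auto simp flip: ennreal_1 ennreal_plus)
  have "ennreal (real t * \<gamma> / 4) = ennreal (real t * \<gamma>) * ennreal (1 / 4)"
    using \<gamma>(1) by (simp flip: ennreal_mult)
  also have "\<dots> \<le> ennreal (real t * \<gamma>) * (\<integral>\<^sup>+h. ennreal (q h) \<partial>G.H t)"
    using 2 by (rule mult_left_mono) simp
  also have "\<dots> = (\<integral>\<^sup>+h. ennreal (real t * \<gamma>) * ennreal (q h) \<partial>G.H t)"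
    by (rule nn_integral_cmult[symmetric]) measurable
  also have "\<dots> \<le> (\<integral>\<^sup>+h. ennreal (\<Sum>s<t. G.opt - g (fst (h s))) \<partial>G.H t)"
  proof (rule nn_integral_mono)
    fix h assume h: "h \<in> space (G.H t)"
    have "real t * \<gamma> * q h = \<gamma> * (real t - visits t h)"
      using False by (simp add: q_def field_simps)
    also have "\<dots> = (\<Sum>s<t. \<gamma> * (1 - indicator B (fst (h s))))"
      by (simp add: visits_def sum_subtractf sum_distrib_left right_diff_distrib)
    also have "\<dots> \<le> (\<Sum>s<t. G.opt - g (fst (h s)))"
      using h \<gamma>(2) G.arm_in_space[of h t] G.payoff_le_opt
      by (intro sum_mono) (auto simp: G.space_H G.opt_def split: split_indicator)
    finally have "real t * \<gamma> * q h \<le> (\<Sum>s<t. G.opt - g (fst (h s)))" .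
    then show "ennreal (real t * \<gamma>) * ennreal (q h) \<le> ennreal (\<Sum>s<t. G.opt - g (fst (h s)))"
      using q01[of h] \<gamma>(1) by (simp flip: ennreal_mult add: ennreal_leI)
  qed
  also have "\<dots> = ennreal (regret X A g (\<lambda>x. bernoulli_reward (g x)) t)"
    by (rule G.ennreal_regret[symmetric])
  finally show ?thesis
    using G.regret_nonneg by simp
qed

end

section \<open>Nested plateaus and the lower bound\<close>

text \<open>A cone cut off at height \<rho>: flat on a ball, to leave room for later plateaus, and
  supported in a ball of twice that radius.\<close>

definition plateau :: "'a::metric_space \<Rightarrow> real \<Rightarrow> 'a \<Rightarrow> real" where
  "plateau y \<rho> x = max 0 (min \<rho> (2 * \<rho> - dist x y))"

lemma plateau_bounds: "0 \<le> \<rho> \<Longrightarrow> 0 \<le> plateau y \<rho> x \<and> plateau y \<rho> x \<le> \<rho>"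
  by (simp add: plateau_def)

lemma plateau_inside: "0 \<le> \<rho> \<Longrightarrow> dist x y \<le> \<rho> \<Longrightarrow> plateau y \<rho> x = \<rho>"
  by (simp add: plateau_def)

lemma plateau_outside: "0 \<le> \<rho> \<Longrightarrow> 2 * \<rho> \<le> dist x y \<Longrightarrow> plateau y \<rho> x = 0"
  by (simp add: plateau_def)

lemma plateau_lipschitz: "\<bar>plateau y \<rho> x - plateau y \<rho> z\<bar> \<le> dist x z"
  using dist_triangle[of x y z] dist_triangle[of z y x] by (auto simp: plateau_def dist_commute)

text \<open>\<open>COV U\<close> being large only says that the covering bound fails for each
  constant at some scale; a constant beyond the size of one fixed net forces that scale to be
  small.\<close>

lemma COV_greater_packing:
  fixes X :: "'a::metric_space set"
  assumes "compact X" "U \<subseteq> X" "ereal d < COV U" "0 \<le> d" "0 < r0"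
  obtains r L where "0 < r" "r < r0" "r \<le> 1" "finite L" "L \<subseteq> U"
    "pairwise (\<lambda>x y. r / 3 \<le> dist x y) L" "r powr (-d) \<le> real (card L)"
proof -
  define r1 where "r1 = min r0 1"
  have r1: "0 < r1" "r1 \<le> 1"
    using assms by (auto simp: r1_def)
  obtain L1 where L1: "finite L1" "U \<subseteq> (\<Union>x\<in>L1. ball x (r1 / 3))"
    using finite_separated_net[OF assms(1,2), of "r1 / 3"] r1 by (metis divide_pos_pos zero_less_numeral)
  define c where "c = 1 + real (card L1)"
  have "\<not> (\<forall>r\<in>{0<..1}. ereal_of_enat (covering_number r U) \<le> ereal (c * r powr (-d)))"
  proof
    assume "\<forall>r\<in>{0<..1}. ereal_of_enat (covering_number r U) \<le> ereal (c * r powr (-d))"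
    then have "COV U \<le> ereal d"
      unfolding COV_def using assms(4) by (intro Inf_lower) auto
    then show False
      using assms(3) by simp
  qed
  then obtain r where r: "0 < r" "r \<le> 1" "ereal (c * r powr (-d)) < ereal_of_enat (covering_number r U)"
    by (auto simp: not_le)
  have rd: "1 \<le> r powr (-d)"
    using r assms(4) by (simp add: powr_minus one_le_inverse_iff powr_le1)
  have "r < r1"
  proof (rule ccontr)
    assume "\<not> r < r1"
    then have "covering_number r U \<le> enat (card L1)"
      using L1 r1 by (intro covering_number_le_card_net[of _ _ "r1 / 3"]) auto
    then have "ereal_of_enat (covering_number r U) \<le> ereal (real (card L1))"
      using ereal_of_enat_le_iff[of _ "enat (card L1)"] by simp
    also have "real (card L1) \<le> c * 1"
      by (simp add: c_def)
    also have "c * 1 \<le> c * r powr (-d)"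
      using rd by (intro mult_left_mono) (auto simp: c_def)
    finally show False
      using r(3) by simp
  qed
  obtain L where L: "finite L" "L \<subseteq> U" "pairwise (\<lambda>x y. r / 3 \<le> dist x y) L" "U \<subseteq> (\<Union>x\<in>L. ball x (r / 3))"
    using finite_separated_net[OF assms(1,2), of "r / 3"] r(1) by (metis divide_pos_pos zero_less_numeral)
  have "covering_number r U \<le> enat (card L)"
    using L r by (intro covering_number_le_card_net[of _ _ "r / 3"]) auto
  then have "ereal_of_enat (covering_number r U) \<le> ereal (real (card L))"
    using ereal_of_enat_le_iff[of _ "enat (card L)"] by simp
  then have "ereal (c * r powr (-d)) < ereal (real (card L))"
    using r(3) by (rule less_le_trans[rotated])
  moreover have "1 * r powr (-d) \<le> c * r powr (-d)"
    by (intro mult_right_mono) (auto simp: c_def)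
  ultimately have "r powr (-d) \<le> real (card L)"
    by simp
  then show ?thesis
    using that[of r L] r L \<open>r < r1\<close> by (auto simp: r1_def)
qed

lemma powr_neg_unbounded:
  fixes \<beta> B :: real
  assumes "0 < \<beta>"
  obtains r0 where "0 < r0" "\<And>r. 0 < r \<Longrightarrow> r < r0 \<Longrightarrow> B < r powr (-\<beta>)"
proof -
  define r0 where "r0 = max B 1 powr (-1 / \<beta>)"
  have "B < r powr (-\<beta>)" if "0 < r" "r < r0" for r
  proof -
    have "r0 powr (-\<beta>) < r powr (-\<beta>)"
      using that assms by (intro powr_less_mono2_neg) auto
    moreover have "r0 powr (-\<beta>) = max B 1"
      using assms by (simp add: r0_def powr_powr)
    ultimately show ?thesis
      by simp
  qed
  moreover have "0 < r0"
    by (simp add: r0_def)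
  ultimately show ?thesis
    using that by blast
qed

text \<open>Disjoint sets share the \<open>t\<close> rounds, so their expected visits cannot all
  exceed the average.\<close>

lemma (in mab_run) visits_pigeonhole:
  assumes L: "finite L" "L \<noteq> {}" and B: "\<And>y. y \<in> L \<Longrightarrow> B y \<in> sets (arm_space X)" and disj: "disjoint_family_on B L"
  shows "\<exists>y\<in>L. (\<integral>\<^sup>+h. ennreal (\<Sum>s<t. indicator (B y) (fst (h s))) \<partial>H t) \<le> ennreal (real t / real (card L))"
proof (rule ccontr)
  assume "\<not> ?thesis"
  then have less: "ennreal (real t / real (card L)) < (\<integral>\<^sup>+h. ennreal (\<Sum>s<t. indicator (B y) (fst (h s))) \<partial>H t)" if "y \<in> L" for y
    using that by (simp add: not_le)
  have m: "(\<lambda>h. ennreal (\<Sum>s<t. indicator (B y) (fst (h s)))) \<in> borel_measurable (H t)" if "y \<in> L" for y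
  proof -
    have "indicator (B y) \<in> borel_measurable (arm_space X)"
      using B[OF that] by measurable
    then have "(\<lambda>h. indicator (B y) (fst (h s)) :: real) \<in> borel_measurable (history_space t)" if "s < t" for s
      by (rule measurable_compose[OF measurable_arm_component[OF that]])
    then have "(\<lambda>h. \<Sum>s<t. indicator (B y) (fst (h s)) :: real) \<in> borel_measurable (history_space t)"
      by (intro borel_measurable_sum) auto
    then show ?thesis
      by measurable
  qed
  let ?I = "\<lambda>y. \<integral>\<^sup>+h. ennreal (\<Sum>s<t. indicator (B y) (fst (h s))) \<partial>H t"
  have "(\<Sum>y\<in>L. ?I y) = (\<integral>\<^sup>+h. (\<Sum>y\<in>L. ennreal (\<Sum>s<t. indicator (B y) (fst (h s)))) \<partial>H t)"
    using m by (intro nn_integral_sum[symmetric]) auto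
  also have "\<dots> \<le> (\<integral>\<^sup>+h. ennreal (real t) \<partial>H t)"
  proof (rule nn_integral_mono)
    fix h
    have "(\<Sum>y\<in>L. \<Sum>s<t. indicator (B y) (fst (h s)) :: real) = (\<Sum>s<t. \<Sum>y\<in>L. indicator (B y) (fst (h s)))"
      by (rule sum.swap)
    also have "\<dots> = (\<Sum>s<t. indicator (\<Union>y\<in>L. B y) (fst (h s)))"
      using L disj by (simp add: indicator_UN_disjoint)
    also have "\<dots> \<le> (\<Sum>s<t. 1)"
      by (intro sum_mono) (auto split: split_indicator)
    finally show "(\<Sum>y\<in>L. ennreal (\<Sum>s<t. indicator (B y) (fst (h s)))) \<le> ennreal (real t)"
      by (simp add: sum_nonneg ennreal_leI)
  qed
  also have "\<dots> = ennreal (real t)"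
    using prob_space.emeasure_space_1[OF prob_space_H] by simp
  finally have le: "(\<Sum>y\<in>L. ?I y) \<le> ennreal (real t)" .
  \<comment> \<open>The strict comparison of sums is carried out in the reals, which needs finite
    integrals.\<close>
  have fin: "?I y = ennreal (enn2real (?I y))" if "y \<in> L" for y
  proof -
    have "?I y \<le> ennreal (real t)"
      using member_le_sum[of y L ?I] that L(1) le by (auto intro: order_trans)
    then show ?thesis
      using ennreal_enn2real_if[of "?I y"] by (auto simp: top_unique)
  qed
  have "ennreal (\<Sum>y\<in>L. enn2real (?I y)) = (\<Sum>y\<in>L. ?I y)"
    using fin by (subst sum_ennreal[symmetric]) (auto intro!: sum.cong)
  then have "(\<Sum>y\<in>L. enn2real (?I y)) \<le> real t"
    using le by (metis ennreal_le_iff of_nat_0_le_iff)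
  moreover have "real t / real (card L) < enn2real (?I y)" if "y \<in> L" for y
    using less[OF that] fin[OF that] by (metis ennreal_leI not_le)
  then have "(\<Sum>y\<in>L. real t / real (card L)) < (\<Sum>y\<in>L. enn2real (?I y))"
    using L by (intro sum_strict_mono) auto
  moreover have "(\<Sum>y\<in>L. real t / real (card L)) = real t"
    using L by simp
  ultimately show False
    by simp
qed

text \<open>The room between \<open>e\<close> and \<open>d\<close> absorbs the decreasing weights
  and still leaves a growing factor \<open>k\<close> in the regret.\<close>

locale lower_bound =
  fixes X :: "'a::metric_space set" and A :: "'a bandit_alg" and Y :: "'a set" and d e :: real
  assumes compact: "compact X" and alg: "bandit_algorithm X A"
    and Y: "Y \<subseteq> X" "Y \<noteq> {}" and e: "0 \<le> e" "e < d" and d_less: "ereal d < MinCOV Y"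
begin

text \<open>The sum of the weights below \<open>k\<close> is \<open>1/2 - (1/2) ^ (k + 1)\<close>,
  the Lipschitz budget in \<open>admissible\<close>; the limit is thus Lipschitz with constant
  1/2.\<close>

definition w :: "nat \<Rightarrow> real" where "w k = (1/2) ^ (k + 2)"

type_synonym 'b stage = "('b \<Rightarrow> real) \<times> 'b \<times> real"

text \<open>A stage consists of the payoff built so far and the centre and radius of its top
  plateau. Since this plateau is flat and maximal, a bump placed inside it raises the maximum by the
  full height of the bump.\<close>

definition admissible :: "nat \<Rightarrow> 'a stage \<Rightarrow> bool" where
  "admissible k = (\<lambda>(f, y, \<rho>). y \<in> Y \<and> 0 < \<rho> \<and> \<rho> \<le> 1 \<and>
     (\<forall>x z. \<bar>f x - f z\<bar> \<le> (1/2 - (1/2) ^ (k + 1)) * dist x z) \<and>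
     (\<forall>x. 1/2 \<le> f x \<and> f x \<le> 1/2 + (1/2 - (1/2) ^ (k + 1)) / 2) \<and>
     (\<forall>x. f x \<le> f y) \<and> (\<forall>x. dist x y \<le> \<rho> \<longrightarrow> f x = f y))"

text \<open>\<open>t\<close> and \<open>N\<close> certify few visits under the payoff before the new
  bump is added. The doubled height \<open>2 * w k * \<rho>'\<close> makes allowance for all later
  modifications.\<close>

definition refines :: "nat \<Rightarrow> 'a stage \<Rightarrow> 'a stage \<Rightarrow> bool" where
  "refines k = (\<lambda>(f, y, \<rho>) (f', y', \<rho>'). \<rho>' \<le> \<rho> / 12 \<and> \<rho>' \<le> 1 / 12 \<and> dist y' y < \<rho> / 2 \<and>
     f' = (\<lambda>x. f x + w k * plateau y' \<rho>' x) \<and>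
     (\<exists>t N. 1 \<le> t \<and> 2 \<le> N \<and> 6 * (2 * w k * \<rho>')\<^sup>2 * (real t / N) \<le> 1 / 96 \<and>
       (\<integral>\<^sup>+h. ennreal (\<Sum>s<t. indicator (X \<inter> ball y' (2 * \<rho>')) (fst (h s)))
          \<partial>history_law X A (\<lambda>x. bernoulli_reward (f x)) t) \<le> ennreal (real t / N) \<and>
       real k * real t powr (1 - 1 / (e + 2)) < real t * (w k * \<rho>') / 4))"

lemma w_bounds: "0 < w k" "w k \<le> 1/4" "w (Suc k) = w k / 2"
  by (auto simp: w_def power_le_one)

lemma admissible_lipschitz:
  assumes "admissible k (f, y, \<rho>)"
  shows "1-lipschitz_on X f" "f ` X \<subseteq> {1/4..3/4}"
proof -
  have p: "0 \<le> (1/2::real) ^ (k + 1)" "(1/2::real) ^ (k + 1) \<le> 1/2"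
    by (auto simp: power_le_one)
  show "1-lipschitz_on X f"
  proof (rule lipschitz_onI)
    fix x z
    have "\<bar>f x - f z\<bar> \<le> (1/2 - (1/2) ^ (k + 1)) * dist x z"
      using assms by (auto simp: admissible_def)
    also have "1/2 - (1/2) ^ (k + 1) \<le> (1::real)"
      using p by linarith
    then have "(1/2 - (1/2) ^ (k + 1)) * dist x z \<le> 1 * dist x z"
      by (rule mult_right_mono) simp
    finally show "dist (f x) (f z) \<le> 1 * dist x z"
      by (simp add: dist_real_def)
  qed simp
  show "f ` X \<subseteq> {1/4..3/4}"
  proof
    fix v assume "v \<in> f ` X"
    then have "1/2 \<le> v" "v \<le> 1/2 + (1/2 - (1/2) ^ (k + 1)) / 2"
      using assms by (auto simp: admissible_def)
    then show "v \<in> {1/4..3/4}"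
      using p unfolding atLeastAtMost_iff by argo
  qed
qed

text \<open>The support of the new plateau has radius at most \<open>\<rho> / 6\<close> around a
  point within \<open>\<rho> / 2\<close> of \<open>y\<close>, so it lies in the flat part of the old
  one.\<close>

lemma admissible_step:
  assumes adm: "admissible k (f, y, \<rho>)"
    and y': "y' \<in> Y" "dist y' y < \<rho> / 2" and \<rho>': "0 < \<rho>'" "\<rho>' \<le> \<rho> / 12" "\<rho>' \<le> 1 / 12"
  shows "admissible (Suc k) (\<lambda>x. f x + w k * plateau y' \<rho>' x, y', \<rho>')"
proof -
  define l where "l = (1/2::real) - (1/2) ^ (k + 1)"
  have L: "1/2 - (1/2) ^ (Suc k + 1) = l + w k"
    by (simp add: w_def l_def)
  have pl: "0 \<le> w k * plateau y' \<rho>' x \<and> w k * plateau y' \<rho>' x \<le> w k * \<rho>'" for x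
    using plateau_bounds[of \<rho>' y' x] \<rho>' w_bounds(1)[of k] by (auto intro: mult_left_mono)
  have f: "\<And>x z. \<bar>f x - f z\<bar> \<le> l * dist x z" "\<And>x. 1/2 \<le> f x"
    "\<And>x. f x \<le> 1/2 + l / 2" "\<And>x. f x \<le> f y" "\<And>x. dist x y \<le> \<rho> \<Longrightarrow> f x = f y"
    and \<rho>: "0 < \<rho>"
    using adm unfolding admissible_def l_def by blast+
  have fy': "f y' = f y"
    using f(5)[of y'] y' \<rho> by simp
  have ply': "plateau y' \<rho>' y' = \<rho>'"
    using \<rho>' by (intro plateau_inside) auto
  show ?thesis
    unfolding admissible_def prod.case
  proof (intro conjI allI impI)
    fix x z
    have "\<bar>w k * plateau y' \<rho>' x - w k * plateau y' \<rho>' z\<bar> = w k * \<bar>plateau y' \<rho>' x - plateau y' \<rho>' z\<bar>"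
      using w_bounds(1)[of k] by (simp add: abs_mult flip: right_diff_distrib)
    also have "\<dots> \<le> w k * dist x z"
      using w_bounds(1)[of k] plateau_lipschitz by (intro mult_left_mono) auto
    finally show "\<bar>f x + w k * plateau y' \<rho>' x - (f z + w k * plateau y' \<rho>' z)\<bar>
        \<le> (1/2 - (1/2) ^ (Suc k + 1)) * dist x z"
      unfolding L using f(1)[of x z] by (simp add: distrib_right)
  next
    fix x
    show "1/2 \<le> f x + w k * plateau y' \<rho>' x"
      using f(2)[of x] pl[of x] by linarith
    have "w k * \<rho>' \<le> w k * (1/2)"
      using \<rho>' w_bounds(1)[of k] by (intro mult_left_mono) auto
    then show "f x + w k * plateau y' \<rho>' x \<le> 1/2 + (1/2 - (1/2) ^ (Suc k + 1)) / 2"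
      unfolding L using f(3)[of x] conjunct2[OF pl[of x]] by argo
    show "f x + w k * plateau y' \<rho>' x \<le> f y' + w k * plateau y' \<rho>' y'"
      unfolding ply' fy' using f(4)[of x] pl[of x] by linarith
  next
    fix x assume x: "dist x y' \<le> \<rho>'"
    have "dist x y \<le> \<rho>"
      using dist_triangle[of x y y'] x y' \<rho>' \<rho> by linarith
    then have "f x = f y"
      by (rule f(5))
    then show "f x + w k * plateau y' \<rho>' x = f y' + w k * plateau y' \<rho>' y'"
      unfolding ply' fy' using plateau_inside[OF _ x] \<rho>' by simp
  qed (use y' \<rho>' in auto)
qed

text \<open>The neighbourhood \<open>U\<close> of \<open>y\<close> in \<open>Y\<close> has covering
  dimension above \<open>d\<close>, which gives a large packing at an arbitrarily small scale; the
  pigeonhole principle then picks a rarely visited centre.\<close>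

lemma exists_refinement:
  assumes adm: "admissible k (f, y, \<rho>)"
  shows "\<exists>S'. admissible (Suc k) S' \<and> refines k (f, y, \<rho>) S'"
proof -
  have y: "y \<in> Y" and \<rho>: "0 < \<rho>"
    using adm by (auto simp: admissible_def)
  interpret R: mab_run X A f "\<lambda>x. bernoulli_reward (f x)"
  proof (unfold_locales, rule alg, rule bernoulli_instance)
    show "f ` X \<subseteq> {0..1}"
      by (rule order_trans[OF admissible_lipschitz(2)[OF adm]]) auto
  qed (rule admissible_lipschitz(1)[OF adm])
  define U where "U = Y \<inter> ball y (\<rho> / 2)"
  have "openin (top_of_set Y) U" "y \<in> U" "U \<subseteq> X"
    using y \<rho> Y by (auto simp: U_def intro: openin_open_Int)
  then have "MinCOV Y \<le> COV U"
    unfolding MinCOV_def by (intro Inf_lower) auto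
  then have dU: "ereal d < COV U"
    using d_less by simp
  \<comment> \<open>With \<open>t\<close> about \<open>r powr (-(d + 2))\<close>, the product
    \<open>t powr (1 / (e + 2)) * r\<close> is about \<open>r powr (-\<beta>)\<close>; it measures
    by how much the regret exceeds the rate for \<open>e\<close>.\<close>
  define \<beta> where "\<beta> = (d + 2) / (e + 2) - 1"
  have \<beta>: "0 < \<beta>"
    using e by (simp add: \<beta>_def field_simps)
  have d0: "0 < d"
    using e by simp
  obtain r1 where r1: "0 < r1" "\<And>r. 0 < r \<Longrightarrow> r < r1 \<Longrightarrow> 2 < r powr (-d)"
    using powr_neg_unbounded[OF d0, of 2] by blast
  \<comment> \<open>The factor 96 is 48 from \<open>\<rho>' / 4 = r / 48\<close>, doubled for the
    rounding of \<open>t\<close>.\<close>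
  obtain r2 where r2: "0 < r2" "\<And>r. 0 < r \<Longrightarrow> r < r2 \<Longrightarrow> 96 * real k / w k < r powr (-\<beta>)"
    using powr_neg_unbounded[OF \<beta>, of "96 * real k / w k"] by blast
  obtain r L where r: "0 < r" "r < min (min r1 r2) \<rho>" "r \<le> 1" and L: "finite L" "L \<subseteq> U"
    "pairwise (\<lambda>x y. r / 3 \<le> dist x y) L" "r powr (-d) \<le> real (card L)"
    using COV_greater_packing[OF compact \<open>U \<subseteq> X\<close> dU, of "min (min r1 r2) \<rho>"] d0 r1(1) r2(1) \<rho>
    by (metis less_imp_le min_less_iff_conj)
  define N where "N = real (card L)"
  \<comment> \<open>Chosen so that the average \<open>t / N\<close> is at most
    \<open>r powr (-2)\<close>, too few visits to detect a change of order \<open>r\<close>.\<close>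
  define t where "t = nat \<lfloor>r powr (-(d + 2))\<rfloor>"
  \<comment> \<open>The supports have radius \<open>2 * \<rho>' = r / 6\<close>, half the separation
    of the centres, and are disjoint.\<close>
  define \<rho>' where "\<rho>' = r / 12"
  have N: "2 \<le> N" "r powr (-d) \<le> N"
    using r1(2)[of r] r L by (auto simp: N_def)
  have rt1: "1 \<le> r powr (-(d + 2))"
    using r d0 powr_mono'[of "-(d + 2)" 0 r] by simp
  have t_le: "real t \<le> r powr (-(d + 2))"
    unfolding t_def using rt1 by (simp add: of_nat_nat)
  have t1: "1 \<le> t"
    unfolding t_def using rt1 by (simp add: le_nat_iff)
  have t_ge: "r powr (-(d + 2)) / 2 \<le> real t"
  proof -
    have "r powr (-(d + 2)) < real t + 1"
      unfolding t_def using rt1 by (simp add: of_nat_nat)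
    then show ?thesis
      using t1 by simp
  qed
  have scale: "6 * (2 * w k * \<rho>')\<^sup>2 * (real t / N) \<le> 1 / 96"
  proof -
    have "real t / N \<le> r powr (-(d + 2)) / r powr (-d)"
      using t_le N r by (intro frac_le) auto
    also have "\<dots> = r powr (-2)"
      by (simp flip: powr_diff)
    also have "\<dots> = 1 / r\<^sup>2"
      using r powr_realpow[of r 2] by (simp add: powr_minus divide_inverse)
    finally have "(2 * w k * \<rho>')\<^sup>2 * (real t / N) \<le> (2 * w k * \<rho>')\<^sup>2 * (1 / r\<^sup>2)"
      by (rule mult_left_mono) simp
    also have "\<dots> = (w k)\<^sup>2 / 36"
      using r by (simp add: \<rho>'_def field_simps power2_eq_square)
    also have "\<dots> \<le> (1/4)\<^sup>2 / 36"
      using w_bounds[of k] by (intro divide_right_mono power_mono) auto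
    finally show ?thesis
      by (simp add: power2_eq_square)
  qed
  have grow: "real k * real t powr (1 - 1 / (e + 2)) < real t * (w k * \<rho>') / 4"
  proof -
    define a where "a = 1 / (e + 2)"
    have a: "0 < a" "a \<le> 1"
      using e by (auto simp: a_def)
    have "r powr (-\<beta>) / 2 = r powr (-(d + 2) * a) * r * (1/2)"
    proof -
      have "-\<beta> = -(d + 2) * a + 1"
        using e by (simp add: \<beta>_def a_def field_simps)
      then show ?thesis
        using r by (simp add: powr_add)
    qed
    also have "\<dots> \<le> r powr (-(d + 2) * a) * r * (1/2) powr a"
      using a r powr_mono'[of a 1 "1/2::real"] by (intro mult_left_mono) auto
    also have "\<dots> = (r powr (-(d + 2)) / 2) powr a * r"
      by (simp add: powr_divide powr_powr)
    also have "\<dots> \<le> real t powr a * r"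
      using a r t_ge by (intro mult_right_mono powr_mono2) auto
    finally have "r powr (-\<beta>) / 2 \<le> real t powr a * r" .
    moreover have "96 * real k / w k < r powr (-\<beta>)"
      using r2(2) r by simp
    ultimately have "96 * real k / w k < 2 * (real t powr a * r)"
      by simp
    then have k: "real k < real t powr a * (w k * \<rho>') / 4"
      using w_bounds(1)[of k] by (simp add: \<rho>'_def field_simps)
    have "real k * real t powr (1 - a) < (real t powr a * (w k * \<rho>') / 4) * real t powr (1 - a)"
      using k t1 by (intro mult_strict_right_mono) auto
    also have "\<dots> = (real t powr a * real t powr (1 - a)) * (w k * \<rho>') / 4"
      by simp
    also have "real t powr a * real t powr (1 - a) = real t"
      using t1 by (simp flip: powr_add)
    finally show ?thesis
      by (simp add: a_def)
  qed
  have disj: "disjoint_family_on (\<lambda>y. X \<inter> ball y (2 * \<rho>')) L"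
  proof (unfold disjoint_family_on_def, intro ballI impI)
    fix u v assume "u \<in> L" "v \<in> L" "u \<noteq> v"
    then have "r / 3 \<le> dist u v"
      using L(3) by (auto simp: pairwise_def)
    then show "(X \<inter> ball u (2 * \<rho>')) \<inter> (X \<inter> ball v (2 * \<rho>')) = {}"
      using dist_triangle_half_l[of u _ "r / 3" v] by (auto simp: \<rho>'_def dist_commute disjoint_iff)
  qed
  have "L \<noteq> {}"
    using N by (auto simp: N_def)
  then obtain y' where y': "y' \<in> L"
    "(\<integral>\<^sup>+h. ennreal (\<Sum>s<t. indicator (X \<inter> ball y' (2 * \<rho>')) (fst (h s))) \<partial>R.H t) \<le> ennreal (real t / N)"
    using R.visits_pigeonhole[OF L(1) _ _ disj, of t]
    by (auto simp: arm_space_def sets_restrict_space N_def)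
  have y'Y: "y' \<in> Y" "dist y' y < \<rho> / 2"
    using y'(1) L(2) by (auto simp: U_def dist_commute)
  have \<rho>': "0 < \<rho>'" "\<rho>' \<le> \<rho> / 12" "\<rho>' \<le> 1 / 12"
    using r by (auto simp: \<rho>'_def)
  have "refines k (f, y, \<rho>) (\<lambda>x. f x + w k * plateau y' \<rho>' x, y', \<rho>')"
    unfolding refines_def prod.case using \<rho>' y'Y t1 N(1) scale y'(2) grow by blast
  then show ?thesis
    using admissible_step[OF adm y'Y \<rho>'] by blast
qed

text \<open>The limit \<open>g\<close> is compared with each \<open>f k\<close> directly: they
  differ only on the support of plateau \<open>Suc k\<close>, by at most twice its height, so the
  certificate of every stage applies to \<open>g\<close>. Hence for every \<open>k\<close> the
  regret at some time exceeds \<open>k\<close> times the rate.\<close>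

theorem regret_dim_ge: "ereal e \<le> regret_dim X A"
proof -
  obtain y0 where y0: "y0 \<in> Y"
    using Y by blast
  have "admissible 0 (\<lambda>_. 1/2, y0, 1)"
    using y0 by (simp add: admissible_def)
  then have "\<exists>S. \<forall>k. admissible k (S k) \<and> refines k (S k) (S (Suc k))"
  proof (intro dependent_nat_choice)
    assume "admissible 0 (\<lambda>_. 1/2, y0, 1)"
    then show "\<exists>S. admissible 0 S" ..
  next
    show "\<exists>S'. admissible (Suc k) S' \<and> refines k S S'" if "admissible k S" for k and S :: "'a stage"
      using that exists_refinement by (cases S rule: prod_cases3) simp
  qed
  then obtain S where S: "\<And>k. admissible k (S k)" "\<And>k. refines k (S k) (S (Suc k))"
    by blast
  define f where "f k = fst (S k)" for k
  define y where "y k = fst (snd (S k))" for k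
  define \<rho> where "\<rho> k = snd (snd (S k))" for k
  have Sk: "S k = (f k, y k, \<rho> k)" for k
    by (simp add: f_def y_def \<rho>_def)
  note adm = S(1)[unfolded Sk]
  have \<rho>_pos: "0 < \<rho> k" for k
    using adm[of k] by (auto simp: admissible_def)
  have yX: "y k \<in> X" for k
    using adm[of k] Y by (auto simp: admissible_def)
  have f_max: "f k x \<le> f k (y k)" and f_flat: "dist x (y k) \<le> \<rho> k \<Longrightarrow> f k x = f k (y k)"
    and f_ge: "1/2 \<le> f k x" and f_lip: "\<bar>f k x - f k z\<bar> \<le> (1/2 - (1/2) ^ (k + 1)) * dist x z"
    and f_le: "f k x \<le> 1/2 + (1/2 - (1/2) ^ (k + 1)) / 2" for k x z
    using adm[of k] unfolding admissible_def prod.case by blast+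
  have ref: "\<rho> (Suc k) \<le> \<rho> k / 12" "\<rho> (Suc k) \<le> 1 / 12" "dist (y (Suc k)) (y k) < \<rho> k / 2"
    "f (Suc k) = (\<lambda>x. f k x + w k * plateau (y (Suc k)) (\<rho> (Suc k)) x)" for k
    using S(2)[of k] unfolding Sk refines_def prod.case by blast+
  have inc: "0 \<le> w k * plateau (y (Suc k)) (\<rho> (Suc k)) x"
    "w k * plateau (y (Suc k)) (\<rho> (Suc k)) x \<le> w k * \<rho> (Suc k)" for k x
    using plateau_bounds[of "\<rho> (Suc k)" "y (Suc k)" x] \<rho>_pos[of "Suc k"] w_bounds(1)[of k]
    by (auto intro: mult_left_mono)
  have f_incr: "f k x \<le> f (Suc k) x" for k x
    using inc(1)[of k x] by (simp add: ref(4))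
  have f_upper: "f k x \<le> 3/4" "\<bar>f k x - f k z\<bar> \<le> 1/2 * dist x z" for k x z
  proof -
    have p: "0 \<le> (1/2::real) ^ (k + 1)"
      by simp
    then show "f k x \<le> 3/4"
      using f_le[of k x] by argo
    show "\<bar>f k x - f k z\<bar> \<le> 1/2 * dist x z"
      by (rule order_trans[OF f_lip mult_right_mono[OF _ zero_le_dist]]) (use p in argo)
  qed
  define g where "g x = lim (\<lambda>k. f k x)" for x
  have lim: "(\<lambda>k. f k x) \<longlonglongrightarrow> g x" for x
  proof -
    have "convergent (\<lambda>k. f k x)"
    proof (rule Bseq_mono_convergent)
      show "Bseq (\<lambda>k. f k x)"
      proof (rule BseqI'[of _ 1])
        show "norm (f n x) \<le> 1" for n
          using f_ge[of n x] f_upper(1)[of n x] by simp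
      qed
      show "\<forall>m n. m \<le> n \<longrightarrow> f m x \<le> f n x"
        using f_incr lift_Suc_mono_le[of "\<lambda>k. f k x"] by blast
    qed
    then show ?thesis
      unfolding g_def convergent_LIMSEQ_iff .
  qed
  have g_ge: "f k x \<le> g x" for k x
    using lim f_incr by (intro incseq_le) (auto simp: incseq_Suc_iff)
  have g_le: "g x \<le> 3/4" for x
    by (rule LIMSEQ_le_const2[OF lim]) (use f_upper(1) in blast)
  have g_lip: "1-lipschitz_on X g"
  proof (rule lipschitz_onI)
    fix x z
    have "(\<lambda>k. \<bar>f k x - f k z\<bar>) \<longlonglongrightarrow> \<bar>g x - g z\<bar>"
      by (intro tendsto_intros lim)
    then have "\<bar>g x - g z\<bar> \<le> 1/2 * dist x z"
      by (rule LIMSEQ_le_const2) (use f_upper(2) in blast)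
    then show "dist (g x) (g z) \<le> 1 * dist x z"
      using zero_le_dist[of x z] unfolding dist_real_def by linarith
  qed simp
  have g_range: "g ` X \<subseteq> {1/4..3/4}"
  proof clarify
    fix x
    show "g x \<in> {1/4..3/4}"
      using g_ge[of 0 x] f_ge[of 0 x] g_le[of x] by simp
  qed
  \<comment> \<open>The subtracted term is the budget left to the stages after \<open>m\<close>; the
    induction closes because the heights at least halve.\<close>
  have tail: "f m x - f k x \<le> 2 * w k * \<rho> (Suc k) - 2 * w m * \<rho> (Suc m)" if "k \<le> m" for k m x
    using that
  proof (induction rule: dec_induct)
    case (step m)
    have "2 * w (Suc m) * \<rho> (Suc (Suc m)) \<le> w m * \<rho> (Suc m)"
      using ref(1)[of "Suc m"] \<rho>_pos[of "Suc m"] w_bounds(1)[of m]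
      by (simp add: w_bounds(3))
    then show ?case
      using step.IH inc(2)[of m x] by (simp add: ref(4))
  qed simp
  have g_diff: "g x - f k x \<le> 2 * w k * \<rho> (Suc k)" for k x
  proof -
    have "(\<lambda>m. f m x - f k x) \<longlonglongrightarrow> g x - f k x"
      by (intro tendsto_intros lim)
    moreover have "f m x - f k x \<le> 2 * w k * \<rho> (Suc k)" if "k \<le> m" for m
    proof -
      have "0 \<le> 2 * w m * \<rho> (Suc m)"
        using w_bounds(1)[of m] \<rho>_pos[of "Suc m"] by simp
      then show ?thesis
        using tail[OF that, of x] by linarith
    qed
    ultimately show ?thesis
      by (intro LIMSEQ_le_const2) blast+
  qed
  \<comment> \<open>The supporting balls are nested, so later stages change nothing outside the ball
    of plateau \<open>Suc k\<close>.\<close>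
  have nested: "dist (y (Suc m)) (y (Suc k)) + 2 * \<rho> (Suc m) \<le> 2 * \<rho> (Suc k)" if "k \<le> m" for k m
    using that
  proof (induction rule: dec_induct)
    case (step m)
    then show ?case
      using dist_triangle[of "y (Suc (Suc m))" "y (Suc k)" "y (Suc m)"] ref(1,3)[of "Suc m"] \<rho>_pos[of "Suc m"]
      by linarith
  qed simp
  have g_out: "g x = f k x" if x: "2 * \<rho> (Suc k) \<le> dist x (y (Suc k))" for k x
  proof -
    have "f m x = f k x" if "k \<le> m" for m
      using that
    proof (induction rule: dec_induct)
      case (step m)
      have "2 * \<rho> (Suc m) \<le> dist x (y (Suc m))"
        using nested[of k m] step(1) x dist_triangle[of x "y (Suc k)" "y (Suc m)"] by linarith
      then show ?case
        using step.IH plateau_outside[of "\<rho> (Suc m)" x "y (Suc m)"] \<rho>_pos[of "Suc m"] by (simp add: ref(4))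
    qed simp
    then have "\<forall>\<^sub>F m in sequentially. f m x = f k x"
      by (intro eventually_sequentiallyI)
    then have "(\<lambda>m. f m x) \<longlonglongrightarrow> f k x"
      by (rule tendsto_eventually)
    then show ?thesis
      by (rule LIMSEQ_unique[OF lim])
  qed
  have inst: "lipschitz_mab_instance X g (\<lambda>x. bernoulli_reward (g x))"
    using g_lip by (rule bernoulli_instance) (rule order_trans[OF g_range], auto)
  have large: "\<exists>t\<ge>1. real k * real t powr (1 - 1 / (e + 2)) < regret X A g (\<lambda>x. bernoulli_reward (g x)) t" for k
  proof -
    obtain t N where tN: "1 \<le> t" "2 \<le> N" "6 * (2 * w k * \<rho> (Suc k))\<^sup>2 * (real t / N) \<le> 1 / 96"
      "(\<integral>\<^sup>+h. ennreal (\<Sum>s<t. indicator (X \<inter> ball (y (Suc k)) (2 * \<rho> (Suc k))) (fst (h s)))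
          \<partial>history_law X A (\<lambda>x. bernoulli_reward (f k x)) t) \<le> ennreal (real t / N)"
      "real k * real t powr (1 - 1 / (e + 2)) < real t * (w k * \<rho> (Suc k)) / 4"
      using S(2)[of k] unfolding Sk refines_def prod.case by blast
    define B where "B = X \<inter> ball (y (Suc k)) (2 * \<rho> (Suc k))"
    interpret needle X A "f k" g B "2 * w k * \<rho> (Suc k)"
    proof unfold_locales
      show "B \<in> sets (arm_space X)"
        by (auto simp: B_def arm_space_def sets_restrict_space)
      show "0 \<le> 2 * w k * \<rho> (Suc k)"
        using w_bounds(1)[of k] \<rho>_pos[of "Suc k"] by simp
      have "w k * \<rho> (Suc k) \<le> (1/4) * (1/12)"
        using w_bounds[of k] \<rho>_pos[of "Suc k"] ref(2)[of k] by (intro mult_mono) auto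
      then show "2 * w k * \<rho> (Suc k) \<le> 1 / 8"
        by simp
      show "\<bar>g x - f k x\<bar> \<le> 2 * w k * \<rho> (Suc k) * indicator B x" if "x \<in> X" for x
        using that g_ge[of k x] g_diff[of x k] g_out[of k x]
        by (auto simp: B_def dist_commute split: split_indicator)
    qed (use alg g_lip g_range admissible_lipschitz[OF adm] in auto)
    have "real t * (w k * \<rho> (Suc k)) / 4 \<le> regret X A g (\<lambda>x. bernoulli_reward (g x)) t"
    proof (rule regret_lower_bound[OF _ tN(2,3)])
      show "(\<integral>\<^sup>+h. ennreal (visits t h) \<partial>F.H t) \<le> ennreal (real t / N)"
        using tN(4)[folded B_def] by (simp only: visits_def)
      show "0 \<le> w k * \<rho> (Suc k)"
        using w_bounds(1)[of k] \<rho>_pos[of "Suc k"] by simp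
      fix x assume x: "x \<in> X" "x \<notin> B"
      have "f k (y (Suc k)) = f k (y k)"
        using ref(3)[of k] \<rho>_pos[of k] by (intro f_flat) auto
      then have "f (Suc k) (y (Suc k)) = f k (y k) + w k * \<rho> (Suc k)"
        using plateau_inside[of "\<rho> (Suc k)" "y (Suc k)" "y (Suc k)"] \<rho>_pos[of "Suc k"] by (simp add: ref(4))
      then have "f k (y k) + w k * \<rho> (Suc k) \<le> g (y (Suc k))"
        using g_ge[of "Suc k" "y (Suc k)"] by simp
      also have "\<dots> \<le> (SUP x\<in>X. g x)"
        using yX G.payoff_le_opt by (simp add: G.opt_def)
      finally have "f k (y k) + w k * \<rho> (Suc k) \<le> (SUP x\<in>X. g x)" .
      moreover have "g x \<le> f k (y k)"
        using x g_out[of k x] f_max[of k x] by (auto simp: B_def dist_commute)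
      ultimately show "w k * \<rho> (Suc k) \<le> (SUP x\<in>X. g x) - g x"
        by linarith
    qed
    then show ?thesis
      using tN(1,5) by (intro exI[of _ t]) auto
  qed
  have "ereal e \<le> regret_dim_inst X A g (\<lambda>x. bernoulli_reward (g x))"
    unfolding regret_dim_inst_def
  proof (rule Inf_greatest, clarify)
    fix b C assume b: "0 \<le> b" "\<forall>t. regret X A g (\<lambda>x. bernoulli_reward (g x)) t \<le> C * real t powr (1 - 1 / (b + 2))"
    show "ereal e \<le> ereal b"
    proof (rule ccontr)
      assume "\<not> ereal e \<le> ereal b"
      then have be: "b < e"
        by simp
      obtain k where k: "\<bar>C\<bar> \<le> real k"
        using real_arch_simple by blast
      obtain t where t: "1 \<le> t" "real k * real t powr (1 - 1 / (e + 2)) < regret X A g (\<lambda>x. bernoulli_reward (g x)) t"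
        using large by blast
      have "1 - 1 / (b + 2) \<le> 1 - 1 / (e + 2)"
        using be b(1) by (simp add: field_simps)
      then have "real t powr (1 - 1 / (b + 2)) \<le> real t powr (1 - 1 / (e + 2))"
        using t(1) by (intro powr_mono) auto
      then have "C * real t powr (1 - 1 / (b + 2)) \<le> real k * real t powr (1 - 1 / (e + 2))"
        using k by (intro mult_mono) auto
      then show False
        using t(2) b(2) by (meson not_le order_trans)
    qed
  qed
  also have "\<dots> \<le> regret_dim X A"
    unfolding regret_dim_def using inst by (intro Sup_upper) auto
  finally show ?thesis .
qed

end

text \<open>Exhibits an instance: the supremum over no instances would be
  \<open>-\<infinity>\<close>.\<close>

lemma regret_dim_nonneg:
  fixes X :: "'a::metric_space set"
  shows "0 \<le> regret_dim X A"
proof -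
  have "lipschitz_mab_instance X (\<lambda>_. 1/2) (\<lambda>x. bernoulli_reward (1/2))"
    by (rule bernoulli_instance) (auto intro!: lipschitz_onI)
  moreover have "0 \<le> regret_dim_inst X A (\<lambda>_. 1/2) (\<lambda>x. bernoulli_reward (1/2))"
    unfolding regret_dim_inst_def by (rule Inf_greatest) auto
  ultimately show ?thesis
    unfolding regret_dim_def by (intro Sup_upper2) auto
qed

text \<open>A regret dimension below \<open>MinCOV Y\<close> would leave room for two exponents
  \<open>e < d\<close> in between, which \<open>regret_dim_ge\<close> excludes.\<close>

theorem regret_dim_lower_bound:
  fixes X :: "'a::metric_space set"
  assumes "compact X" "bandit_algorithm X A"
  shows "MaxMinCOV X \<le> regret_dim X A"
  unfolding MaxMinCOV_def
proof (rule Sup_least, clarify)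
  fix Y assume Y: "Y \<subseteq> X" "Y \<noteq> {}"
  show "MinCOV Y \<le> regret_dim X A"
  proof (rule ccontr)
    assume "\<not> MinCOV Y \<le> regret_dim X A"
    then obtain e where less: "regret_dim X A < ereal e" "ereal e < MinCOV Y"
      using ereal_dense2 by (metis not_le)
    obtain d where "ereal e < ereal d" "ereal d < MinCOV Y"
      using ereal_dense2[OF less(2)] by blast
    moreover have "0 < ereal e"
      using regret_dim_nonneg less(1) by (rule le_less_trans)
    ultimately interpret lower_bound X A Y d e
      using assms Y by unfold_locales auto
    show False
      using regret_dim_ge less(1) by simp
  qed
qed

section \<open>Successive elimination\<close>

text \<open>A list, because the arms of a stage are pulled in consecutive blocks in this order;
  \<open>SOME\<close> makes it a function of the region.\<close>

definition net :: "real \<Rightarrow> 'a::metric_space set \<Rightarrow> 'a list" where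
  "net s R = (SOME L. distinct L \<and> set L \<subseteq> R \<and> pairwise (\<lambda>x y. s \<le> dist x y) (set L) \<and>
     R \<subseteq> (\<Union>x\<in>set L. ball x s))"

lemma net:
  fixes R :: "'a::metric_space set"
  assumes "compact R" "0 < s"
  shows "distinct (net s R)" "set (net s R) \<subseteq> R" "pairwise (\<lambda>x y. s \<le> dist x y) (set (net s R))"
    "R \<subseteq> (\<Union>x\<in>set (net s R). ball x s)"
proof -
  obtain L where L: "finite L" "L \<subseteq> R" "pairwise (\<lambda>x y. s \<le> dist x y) L" "R \<subseteq> (\<Union>x\<in>L. ball x s)"
    using finite_separated_net[OF assms(1) order_refl assms(2)] by blast
  obtain l where "set l = L" "distinct l"
    using finite_distinct_list[OF L(1)] by blast
  then have "\<exists>L. distinct L \<and> set L \<subseteq> R \<and> pairwise (\<lambda>x y. s \<le> dist x y) (set L) \<and>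
     R \<subseteq> (\<Union>x\<in>set L. ball x s)"
    using L by blast
  from someI_ex[OF this] show "distinct (net s R)" "set (net s R) \<subseteq> R"
    "pairwise (\<lambda>x y. s \<le> dist x y) (set (net s R))" "R \<subseteq> (\<Union>x\<in>set (net s R). ball x s)"
    unfolding net_def by blast+
qed

text \<open>
  The rewards enter only through the integer parts \<open>z b\<close> of their prefix sums, so that the
  algorithm is a function on a countable set and hence measurable. Phase \<open>k\<close> occupies the rounds
  from \<open>2 ^ k\<close> to \<open>2 ^ Suc k - 1\<close>; a stage is described by its first round and its region.
\<close>

locale elimination =
  fixes X :: "'a::metric_space set" and restr :: "'a set \<Rightarrow> 'a set" and lev :: "nat \<Rightarrow> nat" and x0 :: 'a
  assumes compact_X: "compact X" and x0: "x0 \<in> X"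
    and restr: "\<And>Z. compact Z \<Longrightarrow> compact (restr Z)" "\<And>Z. restr Z \<subseteq> Z"
begin

definition scale :: "nat \<Rightarrow> nat \<Rightarrow> real" where "scale k j = (1/2) ^ (lev k + j)"
text \<open>That is, \<open>128 * (k + 1)\<close> divided by the squared scale; the average reward
  of a block is then accurate to a quarter of the scale, see \<open>noise_le\<close>.\<close>

definition pulls :: "nat \<Rightarrow> nat \<Rightarrow> nat" where "pulls k j = 128 * (k + 1) * 4 ^ (lev k + j)"

definition reward_sum :: "(nat \<Rightarrow> int) \<Rightarrow> nat \<Rightarrow> nat \<Rightarrow> nat \<Rightarrow> nat \<Rightarrow> int" where
  "reward_sum z k j \<tau> m = z (\<tau> + Suc m * pulls k j) - z (\<tau> + m * pulls k j)"

text \<open>The tolerance 3/2 is 1 for the distance of the nearest net point to an optimal arm and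
  1/4 for the error of each of the two compared blocks.\<close>

definition retained :: "(nat \<Rightarrow> int) \<Rightarrow> nat \<Rightarrow> nat \<Rightarrow> nat \<Rightarrow> 'a set \<Rightarrow> nat set" where
  "retained z k j \<tau> R = {m. m < length (net (scale k j) R) \<and> (\<forall>m' < length (net (scale k j) R).
     real_of_int (reward_sum z k j \<tau> m') - 3/2 * scale k j * pulls k j \<le> real_of_int (reward_sum z k j \<tau> m))}"

definition next_region :: "(nat \<Rightarrow> int) \<Rightarrow> nat \<Rightarrow> nat \<Rightarrow> nat \<Rightarrow> 'a set \<Rightarrow> 'a set" where
  "next_region z k j \<tau> R =
     restr (R \<inter> (\<Union>m\<in>retained z k j \<tau> R. cball (net (scale k j) R ! m) (scale k j)))"

primrec stage :: "nat \<Rightarrow> (nat \<Rightarrow> int) \<Rightarrow> nat \<Rightarrow> nat \<times> 'a set" where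
  "stage k z 0 = (2 ^ k, X)"
| "stage k z (Suc j) = (fst (stage k z j) + pulls k j * length (net (scale k j) (snd (stage k z j))),
     next_region z k j (fst (stage k z j)) (snd (stage k z j)))"

definition start :: "nat \<Rightarrow> (nat \<Rightarrow> int) \<Rightarrow> nat \<Rightarrow> nat" where "start k z j = fst (stage k z j)"
definition region :: "nat \<Rightarrow> (nat \<Rightarrow> int) \<Rightarrow> nat \<Rightarrow> 'a set" where "region k z j = snd (stage k z j)"
definition arms :: "nat \<Rightarrow> (nat \<Rightarrow> int) \<Rightarrow> nat \<Rightarrow> 'a list" where "arms k z j = net (scale k j) (region k z j)"

definition phase :: "nat \<Rightarrow> nat" where "phase t = (LEAST k. t < 2 ^ Suc k)"

definition stage_of :: "nat \<Rightarrow> (nat \<Rightarrow> int) \<Rightarrow> nat \<Rightarrow> nat" where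
  "stage_of k z t = (LEAST j. t < start k z (Suc j))"

definition raw_arm :: "nat \<Rightarrow> nat \<Rightarrow> (nat \<Rightarrow> int) \<Rightarrow> 'a" where
  "raw_arm k t z = arms k z (stage_of k z t) ! ((t - start k z (stage_of k z t)) div pulls k (stage_of k z t))"

text \<open>Round 0 precedes phase 0, which starts at round 1. The membership test keeps the
  function well-behaved for sequences \<open>z\<close> that no run produces, where the stage or the
  index may be meaningless.\<close>

definition arm :: "nat \<Rightarrow> (nat \<Rightarrow> int) \<Rightarrow> 'a" where
  "arm t z = (if 0 < t \<and> raw_arm (phase t) t z \<in> X then raw_arm (phase t) t z else x0)"

lemma arm_in_X: "arm t z \<in> X"
  using x0 by (simp add: arm_def)

lemma pulls_pos: "0 < pulls k j"
  by (simp add: pulls_def)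

lemma scale_pos: "0 < scale k j"
  by (simp add: scale_def)

lemma start_Suc: "start k z (Suc j) = start k z j + pulls k j * length (arms k z j)"
  by (simp add: start_def arms_def region_def)

lemma region_Suc: "region k z (Suc j) = next_region z k j (start k z j) (region k z j)"
  by (simp add: start_def region_def)

lemma start_0: "start k z 0 = 2 ^ k" and region_0: "region k z 0 = X"
  by (simp_all add: start_def region_def)

lemma start_mono: "i \<le> j \<Longrightarrow> start k z i \<le> start k z j"
  by (rule lift_Suc_mono_le[of "start k z"]) (simp_all add: start_Suc)

lemma compact_region: "compact (region k z j) \<and> region k z j \<subseteq> X"
proof (induction j)
  case 0
  then show ?case
    using compact_X by (simp add: region_0)
next
  case (Suc j)
  let ?Z = "region k z j \<inter> (\<Union>m\<in>retained z k j (start k z j) (region k z j). cball (arms k z j ! m) (scale k j))"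
  have "finite (retained z k j (start k z j) (region k z j))"
    by (simp add: retained_def)
  then have "compact ?Z"
    using Suc by (intro compact_Int_closed closed_UN) auto
  then show ?case
    using restr(1)[of ?Z] restr(2)[of ?Z] Suc unfolding region_Suc next_region_def arms_def[symmetric]
    by (meson Int_lower1 order_trans)
qed

lemma arms:
  "distinct (arms k z j)" "set (arms k z j) \<subseteq> region k z j"
  "pairwise (\<lambda>x y. scale k j \<le> dist x y) (set (arms k z j))"
  "region k z j \<subseteq> (\<Union>x\<in>set (arms k z j). ball x (scale k j))"
  unfolding arms_def using net[OF conjunct1[OF compact_region] scale_pos] by this+

text \<open>No anticipation: all blocks of earlier stages end by \<open>start k z j\<close>. The
  entry \<open>z t\<close> may be read in round \<open>t\<close>, as it sums the rewards of rounds
  before \<open>t\<close>.\<close>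

lemma stage_adapted:
  assumes "\<And>b. b \<le> t \<Longrightarrow> z b = z' b" "start k z j \<le> t"
  shows "stage k z j = stage k z' j"
  using assms(2)
proof (induction j)
  case (Suc j)
  have "start k z j \<le> t"
    using Suc.prems start_mono[of j "Suc j" k z] by simp
  then have eq: "stage k z j = stage k z' j"
    by (rule Suc.IH)
  let ?R = "region k z j" and ?\<tau> = "start k z j"
  have "reward_sum z k j ?\<tau> m = reward_sum z' k j ?\<tau> m" if "m < length (arms k z j)" for m
  proof -
    have "Suc m * pulls k j \<le> length (arms k z j) * pulls k j"
      using that by (intro mult_le_mono1) simp
    then have "?\<tau> + Suc m * pulls k j \<le> t"
      using Suc.prems by (simp add: start_Suc mult.commute)
    then show ?thesis
      using assms(1) by (simp add: reward_sum_def)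
  qed
  then have "retained z k j ?\<tau> ?R = retained z' k j ?\<tau> ?R"
    unfolding retained_def by (auto simp: arms_def)
  then show ?case
    using eq by (simp add: next_region_def start_def region_def)
qed simp

lemma arm_adapted:
  assumes "\<And>b. b \<le> t \<Longrightarrow> z b = z' b"
  shows "arm t z = arm t z'"
proof (cases "t = 0")
  case False
  let ?k = "phase t"
  \<comment> \<open>Whether a stage has begun by time \<open>t\<close> itself depends on
    \<open>z\<close>, so adaptedness is applied in both directions.\<close>
  have st: "start ?k z j \<le> t \<longleftrightarrow> start ?k z' j \<le> t" for j
    using stage_adapted[of t z z' ?k j] stage_adapted[of t z' z ?k j] assms unfolding start_def by auto
  then have so: "stage_of ?k z t = stage_of ?k z' t"
    unfolding stage_of_def by (simp add: not_le[symmetric])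
  \<comment> \<open>Minimality of \<open>LEAST\<close> suffices, so this also covers a
    \<open>z\<close> whose stages never get past \<open>t\<close>.\<close>
  have "start ?k z (stage_of ?k z t) \<le> t"
  proof (cases "stage_of ?k z t")
    case 0
    have "2 ^ phase t \<le> t"
    proof (cases "phase t")
      case (Suc k)
      then show ?thesis
        using not_less_Least[of k "\<lambda>k. t < 2 ^ Suc k"] unfolding phase_def by simp
    qed (use False in simp)
    then show ?thesis
      using 0 by (simp add: start_0)
  next
    case (Suc j)
    then show ?thesis
      using not_less_Least[of j "\<lambda>j. t < start ?k z (Suc j)"] unfolding stage_of_def by simp
  qed
  then have "stage ?k z (stage_of ?k z t) = stage ?k z' (stage_of ?k z t)"
    using assms by (intro stage_adapted) auto
  then have "raw_arm ?k t z = raw_arm ?k t z'"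
    unfolding raw_arm_def arms_def region_def start_def so by simp
  then show ?thesis
    by (simp add: arm_def)
qed (simp add: arm_def)

section \<open>The algorithm as a measurable kernel\<close>

definition prefix_floor :: "(nat \<Rightarrow> 'a \<times> real) \<Rightarrow> nat \<Rightarrow> int" where
  "prefix_floor h b = \<lfloor>\<Sum>s<b. snd (h s)\<rfloor>"

text \<open>Cutting the sequence to a list makes the range countable; the last entry sums all
  rewards received before round \<open>t\<close>.\<close>

definition digest :: "nat \<Rightarrow> (nat \<Rightarrow> 'a \<times> real) \<Rightarrow> int list" where
  "digest t h = map (prefix_floor h) [0..<Suc t]"

definition algo :: "'a bandit_alg" where
  "algo t h = return (arm_space X) (arm t (nth (digest t h)))"

lemma arm_digest: "arm t (nth (digest t h)) = arm t (prefix_floor h)"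
  unfolding digest_def by (rule arm_adapted) (simp del: upt_Suc)

lemma measurable_digest:
  assumes "t \<le> n"
  shows "digest t \<in> (\<Pi>\<^sub>M i\<in>{0..<n}. round_space X) \<rightarrow>\<^sub>M count_space UNIV"
  unfolding measurable_count_space_eq2_countable
proof (intro conjI ballI)
  let ?M = "\<Pi>\<^sub>M i\<in>{0..<n}. round_space X"
  have [measurable]: "(\<lambda>h. snd (h s)) \<in> borel_measurable ?M" if "s < n" for s
    using that by (intro measurable_compose[OF measurable_component_singleton]) (auto simp: round_space_def)
  have [measurable]: "(\<lambda>h. prefix_floor h b) \<in> ?M \<rightarrow>\<^sub>M count_space UNIV" if "b \<le> t" for b
  proof -
    have "(\<lambda>h. \<Sum>s<b. snd (h s)) \<in> borel_measurable ?M"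
      using that assms by (intro borel_measurable_sum) auto
    then show ?thesis
      unfolding prefix_floor_def by measurable
  qed
  fix l :: "int list"
  have "digest t -` {l} \<inter> space ?M = {h\<in>space ?M. length l = Suc t \<and> (\<forall>b\<in>{..t}. prefix_floor h b = l ! b)}"
    by (auto simp: digest_def list_eq_iff_nth_eq less_Suc_eq_le simp del: upt_Suc)
  also have "\<dots> \<in> sets ?M"
    by measurable
  finally show "digest t -` {l} \<inter> space ?M \<in> sets ?M" .
qed auto

lemma bandit_algorithm_algo: "bandit_algorithm X algo"
  unfolding bandit_algorithm_def
proof
  fix t
  have "(\<lambda>l. return (arm_space X) (arm t (nth l))) \<in> count_space UNIV \<rightarrow>\<^sub>M prob_algebra (arm_space X)"
    using arm_in_X by (auto simp: space_prob_algebra arm_space_def space_restrict_space intro!: prob_space_return)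
  from measurable_compose[OF measurable_digest[OF order_refl] this]
  show "algo t \<in> (\<Pi>\<^sub>M i\<in>{0..<t}. round_space X) \<rightarrow>\<^sub>M prob_algebra (arm_space X)"
    unfolding algo_def[abs_def] .
qed

text \<open>The kernel is a point mass, so almost surely the arms in the history are those computed
  from its rewards. This is what permits a pathwise analysis.\<close>

lemma AE_arm:
  assumes "lipschitz_mab_instance X \<mu> P"
  shows "AE h in history_law X algo P n. \<forall>s<n. fst (h s) = arm s (prefix_floor h)"
proof -
  interpret mab_run X algo \<mu> P
    using bandit_algorithm_algo assms by unfold_locales
  have eq_pred: "Measurable.pred (arm_space X) (\<lambda>x. x = c)" for c
    unfolding arm_space_def by (intro measurable_restrict_space1) (simp add: pred_def)
  have pred: "Measurable.pred (history_space n) (\<lambda>h. \<forall>s<m. fst (h s) = arm s (nth (digest s h)))" if "m \<le> n" for n m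
  proof -
    have "Measurable.pred (history_space n) (\<lambda>h. fst (h s) = arm s (nth (digest s h)))" if "s < n" for s
    proof -
      have [measurable]: "digest s \<in> history_space n \<rightarrow>\<^sub>M count_space UNIV"
        using that by (intro measurable_digest) simp
      have [measurable]: "Measurable.pred (history_space n) (\<lambda>h. fst (h s) = c)" for c
        by (rule measurable_compose[OF measurable_arm_component[OF that] eq_pred])
      \<comment> \<open>Splitting over the countably many digests reduces measurability to
        comparisons with fixed arms.\<close>
      have "Measurable.pred (history_space n) (\<lambda>h. \<exists>l. digest s h = l \<and> fst (h s) = arm s (nth l))"
        by measurable
      then show ?thesis
        by simp
    qed
    then have "Measurable.pred (history_space n) (\<lambda>h. \<forall>s\<in>{..<m}. fst (h s) = arm s (nth (digest s h)))"
      using that by (intro pred_intros_finite(3) finite_lessThan) (simp only: lessThan_iff)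
    then show ?thesis
      by (simp only: Ball_def lessThan_iff)
  qed
  have "AE h in H n. \<forall>s<n. fst (h s) = arm s (nth (digest s h))"
  proof (induction n)
    case (Suc n)
    have digest_upd: "digest s (h(n := w)) = digest s h" if "s \<le> n" for s h w
      using that by (auto simp: digest_def prefix_floor_def simp del: upt_Suc intro!: arg_cong[where f = floor] sum.cong)
    show ?case
      unfolding AE_H_Suc[OF pred[OF order_refl]]
    proof (rule AE_mp[OF Suc], rule AE_I2, rule impI)
      fix h assume h: "h \<in> space (H n)" and eq: "\<forall>s<n. fst (h s) = arm s (nth (digest s h))"
      then have h': "h \<in> space (history_space n)"
        by (simp add: space_H)
      have "(AE w in round_law X algo P n h. \<forall>s<Suc n. fst ((h(n := w)) s) = arm s (nth (digest s (h(n := w)))))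
          \<longleftrightarrow> (AE w in round_law X algo P n h. fst w = arm n (nth (digest n h)))"
        using eq by (intro AE_cong) (auto simp: digest_upd less_Suc_eq)
      also have "\<dots> \<longleftrightarrow> (AE x in algo n h. AE y in P x. fst (x, y) = arm n (nth (digest n h)))"
      proof (rule AE_round_law[OF h'])
        show "Measurable.pred (round_space X) (\<lambda>w. fst w = arm n (nth (digest n h)))"
          by (rule measurable_compose[OF measurable_fst_round eq_pred])
      qed
      also have "\<dots>"
      proof -
        have "AE x in algo n h. x = arm n (nth (digest n h))"
          unfolding algo_def by (rule AE_return[THEN iffD2, OF _ eq_pred]) (simp_all add: space_arm_space arm_in_X)
        then show ?thesis
          by eventually_elim simp
      qed
      finally show "AE w in round_law X algo P n h. \<forall>s<Suc n. fst ((h(n := w)) s) = arm s (nth (digest s (h(n := w))))" .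
    qed
  qed simp
  then show ?thesis
    by (simp add: arm_digest)
qed

end

section \<open>Regret of a single phase\<close>

text \<open>\<open>C\<close> and \<open>e\<close> are left open: they come once from the covering of
  \<open>Q\<close> and once from the coverings of the gap shells in the zooming dimension.
  \<open>initial\<close> pays for the first stage, which runs on all of \<open>X\<close> before any
  restriction.\<close>

locale elimination_instance = elimination +
  fixes f :: "'a \<Rightarrow> real" and xo :: 'a and \<epsilon> :: real and Q :: "'a set" and C e :: real and W :: nat
  assumes lip: "1-lipschitz_on X f" and xo: "xo \<in> X" "\<And>x. x \<in> X \<Longrightarrow> f x \<le> f xo"
    and unit: "\<And>x. x \<in> X \<Longrightarrow> 0 \<le> f x \<and> f x \<le> 1"
    and restr_near_optimum: "\<And>Z. xo \<in> Z \<Longrightarrow> Z \<subseteq> X \<Longrightarrow> (\<And>z. z \<in> Z \<Longrightarrow> f xo - f z < \<epsilon>) \<Longrightarrow>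
       xo \<in> restr Z \<and> restr Z \<subseteq> Q"
    and e: "0 \<le> e" and C: "0 \<le> C"
    and shells: "\<And>L s m. L \<subseteq> Q \<Longrightarrow> L \<subseteq> X \<Longrightarrow> pairwise (\<lambda>x y. s \<le> dist x y) L \<Longrightarrow> 0 < s \<Longrightarrow> s \<le> 1 \<Longrightarrow>
       (1/2) ^ m \<le> 8 * s \<Longrightarrow> (\<And>x. x \<in> L \<Longrightarrow> (1/2) ^ Suc m < f xo - f x \<and> f xo - f x \<le> (1/2) ^ m) \<Longrightarrow>
       real (card L) \<le> C * 2 powr (real m * e)"
    and initial: "\<And>k. 4 ^ lev k * length (net ((1/2) ^ lev k) X) \<le> k + W"
begin

definition gap :: "'a \<Rightarrow> real" where "gap x = f xo - f x"

definition shell :: "nat \<Rightarrow> 'a set" where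
  "shell m = {x. (1/2) ^ Suc m < gap x \<and> gap x \<le> (1/2) ^ m}"

lemma gap_bounds: "x \<in> X \<Longrightarrow> 0 \<le> gap x \<and> gap x \<le> 1"
  using xo(2)[of x] unit[of x] unit[OF xo(1)] by (simp add: gap_def)

lemma f_dist: "x \<in> X \<Longrightarrow> y \<in> X \<Longrightarrow> \<bar>f x - f y\<bar> \<le> dist x y"
  using lipschitz_onD[OF lip] by (simp add: dist_real_def)

lemma pulls_scale: "real (pulls k j) * (scale k j)\<^sup>2 = 128 * (real k + 1)"
proof -
  have "(4::real) ^ n * ((1/2) ^ n)\<^sup>2 = 1" for n
    by (simp add: power2_eq_square flip: power_mult_distrib)
  then show ?thesis
    by (simp add: pulls_def scale_def algebra_simps)
qed

lemma scale_le_1: "scale k j \<le> 1"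
  by (simp add: scale_def power_le_one)

lemma scale_Suc: "scale k (Suc j) = scale k j / 2"
  by (simp add: scale_def)

text \<open>Origin of the constant 128: the noise and the rounding error 1 each get one eighth of
  \<open>pulls * scale\<close>.\<close>

lemma noise_le:
  "sqrt (2 * real k * real (pulls k j)) + 1 \<le> real (pulls k j) * scale k j / 4"
proof -
  let ?n = "real (pulls k j)" and ?s = "scale k j"
  have s: "0 < ?s" "?s \<le> 1"
    using scale_pos scale_le_1 by auto
  have "2 * real k * ?n \<le> ?n * (128 * (real k + 1)) / 64"
    by (simp add: algebra_simps)
  also have "\<dots> = ?n * (?n * ?s\<^sup>2) / 64"
    by (simp only: pulls_scale)
  also have "\<dots> = (?n * ?s / 8)\<^sup>2"
    by (simp add: power2_eq_square)
  finally have "sqrt (2 * real k * ?n) \<le> ?n * ?s / 8"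
    using s by (intro real_le_lsqrt) auto
  moreover have "1 \<le> ?n * ?s / 8"
  proof -
    have "128 \<le> ?n * ?s\<^sup>2"
      unfolding pulls_scale by simp
    also have "\<dots> \<le> ?n * ?s"
      using s by (intro mult_left_mono) (auto simp: power2_eq_square mult_left_le)
    finally show ?thesis
      by simp
  qed
  ultimately show ?thesis
    by simp
qed

section \<open>Pathwise analysis of one phase on the event of bounded noise\<close>

context
  fixes k :: nat and z :: "nat \<Rightarrow> int" and xs :: "nat \<Rightarrow> 'a" and ys :: "nat \<Rightarrow> real"
  assumes z: "\<And>b. z b = \<lfloor>\<Sum>s<b. ys s\<rfloor>"
    and xs: "\<And>s. s \<in> {2^k..<2^Suc k} \<Longrightarrow> xs s = arm s z"
    and noise: "\<And>a b. b \<in> {2^k..2^Suc k} \<Longrightarrow> a \<in> {2^k..<b} \<Longrightarrow>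
      \<bar>\<Sum>s=a..<b. ys s - f (xs s)\<bar> \<le> sqrt (2 * real k * real (b - a))"
    and fine: "4 * scale k 0 < \<epsilon>"
begin

lemma arm_index_less:
  assumes "start k z j \<le> s" "s < start k z (Suc j)"
  shows "(s - start k z j) div pulls k j < length (arms k z j)"
proof -
  have "s - start k z j < length (arms k z j) * pulls k j"
    using assms by (simp add: start_Suc mult.commute less_diff_conv2)
  then show ?thesis
    using pulls_pos[of k j] by (subst div_less_iff_less_mult)
qed

lemma xs_eq:
  assumes s: "s \<in> {2^k..<2^Suc k}" and j: "start k z j \<le> s" "s < start k z (Suc j)"
  shows "xs s = arms k z j ! ((s - start k z j) div pulls k j)"
proof -
  have "phase s = k"
    unfolding phase_def
  proof (rule Least_equality)
    fix i assume i: "s < 2 ^ Suc i"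
    have "2 ^ k \<le> s"
      using s by simp
    then have "2 ^ k < (2::nat) ^ Suc i"
      using i by (rule le_less_trans)
    then show "k \<le> i"
      using power_less_imp_less_exp[of "2::nat" k "Suc i"] by simp
  qed (use s in simp)
  moreover have "stage_of k z s = j"
    unfolding stage_of_def
  proof (rule Least_equality)
    fix i assume i: "s < start k z (Suc i)"
    show "j \<le> i"
    proof (rule ccontr)
      assume "\<not> j \<le> i"
      then have "start k z (Suc i) \<le> start k z j"
        by (intro start_mono) simp
      then show False
        using i j by simp
    qed
  qed (rule j)
  moreover have "0 < s"
    using s by (auto intro: less_le_trans[of 0 "2^k"])
  moreover have "arms k z j ! ((s - start k z j) div pulls k j) \<in> X"
    using nth_mem[OF arm_index_less[OF j]] arms(2)[of k z j] compact_region[of k z j] by blast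
  ultimately show ?thesis
    using xs[OF s] by (simp add: arm_def raw_arm_def)
qed

text \<open>During a block the arm is constant, so the noise bound controls its reward sum; taking
  the difference of two integer parts costs at most 1 more.\<close>

lemma block_estimate:
  assumes m: "m < length (arms k z j)" and le: "start k z (Suc j) \<le> 2 ^ Suc k"
  shows "\<bar>real_of_int (reward_sum z k j (start k z j) m) - real (pulls k j) * f (arms k z j ! m)\<bar>
    \<le> real (pulls k j) * scale k j / 4"
proof -
  let ?n = "pulls k j"
  define a where "a = start k z j + m * ?n"
  define b where "b = start k z j + Suc m * ?n"
  have ba: "b = a + ?n"
    by (simp add: a_def b_def)
  have "Suc m * ?n \<le> length (arms k z j) * ?n"
    using m by (intro mult_le_mono1) simp
  then have b_le: "b \<le> start k z (Suc j)"
    by (simp add: b_def start_Suc mult.commute)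
  have a_ge: "2 ^ k \<le> a"
    using start_mono[of 0 j k z] by (simp add: a_def start_0)
  have const: "xs s = arms k z j ! m" if "s \<in> {a..<b}" for s
  proof -
    have "xs s = arms k z j ! ((s - start k z j) div ?n)"
      using that a_ge b_le le by (intro xs_eq) (auto simp: a_def)
    moreover have "(s - start k z j) div ?n = m"
      using that pulls_pos[of k j] by (intro div_nat_eqI) (auto simp: a_def b_def mult.commute)
    ultimately show ?thesis
      by simp
  qed
  have "(\<Sum>s=a..<b. ys s - f (xs s)) = (\<Sum>s=a..<b. ys s - f (arms k z j ! m))"
    using const by (intro sum.cong) auto
  also have "\<dots> = (\<Sum>s=a..<b. ys s) - real ?n * f (arms k z j ! m)"
    by (simp add: sum_subtractf ba)
  also have "(\<Sum>s=a..<b. ys s) = (\<Sum>s<b. ys s) - (\<Sum>s<a. ys s)"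
    using sum_diff_nat_ivl[of 0 a b ys] ba by (simp add: atLeast0LessThan)
  finally have eq: "(\<Sum>s=a..<b. ys s - f (xs s)) = (\<Sum>s<b. ys s) - (\<Sum>s<a. ys s) - real ?n * f (arms k z j ! m)" .
  have "\<bar>\<Sum>s=a..<b. ys s - f (xs s)\<bar> \<le> sqrt (2 * real k * real (b - a))"
    using a_ge b_le le ba pulls_pos[of k j] by (intro noise) auto
  then have 1: "\<bar>(\<Sum>s<b. ys s) - (\<Sum>s<a. ys s) - real ?n * f (arms k z j ! m)\<bar> \<le> sqrt (2 * real k * real ?n)"
    unfolding eq by (simp add: ba)
  have "reward_sum z k j (start k z j) m = z b - z a"
    by (simp add: reward_sum_def a_def b_def)
  then have "\<bar>real_of_int (reward_sum z k j (start k z j) m) - ((\<Sum>s<b. ys s) - (\<Sum>s<a. ys s))\<bar> \<le> 1"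
    unfolding z by simp linarith
  then show ?thesis
    using 1 noise_le[of k j] by linarith
qed

text \<open>The hypothesis on \<open>start\<close> says that all stages before \<open>j\<close> were
  completed within the phase. The bound \<open>8 * scale k j\<close> is four times the scale of the
  preceding stage, and \<open>fine\<close> makes the restriction correct already at the first
  stage.\<close>

lemma region_invariant:
  assumes "start k z j \<le> 2 ^ Suc k"
  shows "xo \<in> region k z j \<and> (0 < j \<longrightarrow> region k z j \<subseteq> Q \<and> (\<forall>x\<in>region k z j. gap x \<le> 8 * scale k j))"
  using assms
proof (induction j)
  case 0
  then show ?case
    by (simp add: region_0 xo)
next
  case (Suc j)
  let ?L = "arms k z j" and ?s = "scale k j" and ?n = "real (pulls k j)"
  let ?D = "\<lambda>m. real_of_int (reward_sum z k j (start k z j) m)"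
  let ?K = "retained z k j (start k z j) (region k z j)"
  let ?Z = "region k z j \<inter> (\<Union>m\<in>?K. cball (?L ! m) ?s)"
  have "start k z j \<le> 2 ^ Suc k"
    using Suc.prems start_mono[of j "Suc j" k z] by simp
  then have xoj: "xo \<in> region k z j"
    using Suc.IH by simp
  have s: "0 < ?s" and n: "0 < ?n"
    using scale_pos pulls_pos by auto
  have est: "\<bar>?D m - ?n * f (?L ! m)\<bar> \<le> ?n * ?s / 4" if "m < length ?L" for m
    using that Suc.prems by (rule block_estimate)
  have LX: "?L ! m \<in> X" if "m < length ?L" for m
    using nth_mem[OF that] arms(2)[of k z j] compact_region[of k z j] by blast
  have K: "?K = {m. m < length ?L \<and> (\<forall>m'<length ?L. ?D m' - 3/2 * ?s * ?n \<le> ?D m)}"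
    by (simp add: retained_def arms_def)
  obtain x' where "x' \<in> set ?L" and d': "dist x' xo < ?s"
    using arms(4)[of k z j] xoj by auto
  then obtain m' where m': "m' < length ?L" "?L ! m' = x'"
    by (auto simp: in_set_conv_nth)
  have near: "f xo - ?s \<le> f (?L ! m')"
    using f_dist[OF LX[OF m'(1)] xo(1)] d' m'(2) by simp
  then have near': "?n * f xo - ?n * ?s \<le> ?n * f (?L ! m')"
    using n mult_left_mono[of "f xo - ?s" "f (?L ! m')" ?n] by (simp add: algebra_simps)
  have "m' \<in> ?K"
    unfolding K
  proof (intro CollectI conjI allI impI)
    fix i assume i: "i < length ?L"
    have "?n * f (?L ! i) \<le> ?n * f xo"
      using n xo(2)[OF LX[OF i]] by simp
    moreover have "3/2 * ?s * ?n = ?n * ?s + ?n * ?s / 4 + ?n * ?s / 4"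
      by (simp add: algebra_simps)
    ultimately show "?D i - 3/2 * ?s * ?n \<le> ?D m'"
      using est[OF i] est[OF m'(1)] near' by linarith
  qed (rule m')
  then have xoZ: "xo \<in> ?Z"
    using xoj d' m' by (auto intro!: bexI[of _ m'])
  \<comment> \<open>A retained arm has gap at most 3 scales: 1 for the net point near
    \<open>xo\<close>, 3/2 for the tolerance and 1/2 for two block errors; the ball around it adds
    one more.\<close>
  have gapZ: "gap x \<le> 4 * ?s" if x: "x \<in> ?Z" for x
  proof -
    obtain i where i: "i \<in> ?K" "dist (?L ! i) x \<le> ?s"
      using x by auto
    have iL: "i < length ?L" and Di: "?D m' - 3/2 * ?s * ?n \<le> ?D i"
      using i(1) m'(1) unfolding K by auto
    have "?n * f xo - 3 * (?n * ?s) \<le> ?n * f (?L ! i)"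
    proof -
      have "3/2 * ?s * ?n = 3/2 * (?n * ?s)"
        by simp
      then show ?thesis
        using est[OF iL] est[OF m'(1)] Di near' by linarith
    qed
    then have "?n * (f xo - 3 * ?s) \<le> ?n * f (?L ! i)"
      by (simp add: algebra_simps)
    then have "f xo - 3 * ?s \<le> f (?L ! i)"
      using n by simp
    moreover have "\<bar>f (?L ! i) - f x\<bar> \<le> ?s"
      using f_dist[OF LX[OF iL], of x] x compact_region[of k z j] i(2) by force
    ultimately show ?thesis
      by (simp add: gap_def)
  qed
  have "?s \<le> scale k 0"
    by (simp add: scale_def power_decreasing)
  then have "gap x < \<epsilon>" if "x \<in> ?Z" for x
    using gapZ[OF that] fine by linarith
  then have "xo \<in> restr ?Z \<and> restr ?Z \<subseteq> Q"
    using xoZ compact_region[of k z j] by (intro restr_near_optimum) (auto simp: gap_def)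
  moreover have "region k z (Suc j) = restr ?Z"
    by (simp add: region_Suc next_region_def arms_def)
  moreover have "gap x \<le> 8 * scale k (Suc j)" if "x \<in> restr ?Z" for x
    using gapZ[OF subsetD[OF restr(2) that]] by (simp add: scale_Suc)
  ultimately show ?case
    by simp
qed

text \<open>Stage \<open>k\<close> alone, if completed, would last at least
  \<open>pulls k k \<ge> 2 ^ Suc k\<close> rounds and so end after the phase; its net is nonempty
  since \<open>xo\<close> survives.\<close>

lemma stage_exists:
  assumes s: "s \<in> {2^k..<2^Suc k}"
  shows "\<exists>j\<le>k. start k z j \<le> s \<and> s < start k z (Suc j)"
proof -
  have "s < start k z (Suc k)"
  proof (rule ccontr)
    assume "\<not> s < start k z (Suc k)"
    then have le: "start k z (Suc k) \<le> s"
      by simp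
    then have "start k z k \<le> 2 ^ Suc k"
      using start_mono[of k "Suc k" k z] s by (auto intro: order_trans)
    then have "xo \<in> region k z k"
      using region_invariant by blast
    then have "arms k z k \<noteq> []"
      using arms(4)[of k z k] by auto
    then have "pulls k k * 1 \<le> pulls k k * length (arms k z k)"
      by (intro mult_le_mono2) (simp add: Suc_le_eq)
    then have "pulls k k \<le> s"
      using le unfolding start_Suc by linarith
    moreover have "2 ^ Suc k \<le> pulls k k"
    proof -
      have "(2::nat) ^ k \<le> 4 ^ k"
        by (rule power_mono) auto
      also have "(4::nat) ^ k \<le> 4 ^ (lev k + k)"
        by (rule power_increasing) auto
      finally have "2 * 2 ^ k \<le> 128 * (k + 1) * (4::nat) ^ (lev k + k)"
        by (intro mult_le_mono) auto
      then show ?thesis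
        by (simp add: pulls_def)
    qed
    ultimately show False
      using s by simp
  qed
  then have ex: "\<exists>j. s < start k z (Suc j)" ..
  define j where "j = (LEAST j. s < start k z (Suc j))"
  have "s < start k z (Suc j)"
    unfolding j_def by (rule LeastI_ex[OF ex])
  moreover have "j \<le> k"
    unfolding j_def using \<open>s < start k z (Suc k)\<close> by (rule Least_le)
  moreover have "start k z j \<le> s"
  proof (cases j)
    case 0
    then show ?thesis
      using s by (simp add: start_0)
  next
    case (Suc i)
    then show ?thesis
      using not_less_Least[of i "\<lambda>j. s < start k z (Suc j)"] by (simp add: j_def)
  qed
  ultimately show ?thesis
    by blast
qed

lemma stage_visits:
  "card {s\<in>{2^k..<2^Suc k}. start k z j \<le> s \<and> s < start k z (Suc j) \<and> xs s \<in> S}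
    \<le> pulls k j * card (set (arms k z j) \<inter> S)"
proof -
  let ?L = "arms k z j" and ?n = "pulls k j" and ?\<tau> = "start k z j"
  let ?I = "{m. m < length ?L \<and> ?L ! m \<in> S}"
  have "{s\<in>{2^k..<2^Suc k}. ?\<tau> \<le> s \<and> s < start k z (Suc j) \<and> xs s \<in> S}
      \<subseteq> (\<Union>m\<in>?I. {?\<tau> + m * ?n..<?\<tau> + m * ?n + ?n})" (is "?V \<subseteq> _")
  proof
    fix s assume s: "s \<in> ?V"
    define m where "m = (s - ?\<tau>) div ?n"
    have "m \<in> ?I"
      using s xs_eq[of s j] arm_index_less[of j s] by (auto simp: m_def)
    moreover have "m * ?n \<le> s - ?\<tau>" "s - ?\<tau> < m * ?n + ?n"
      using dividend_less_div_times[OF pulls_pos[of k j], of "s - ?\<tau>"] unfolding m_def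
      by (simp_all add: mult.commute add.commute)
    then have "s \<in> {?\<tau> + m * ?n..<?\<tau> + m * ?n + ?n}"
      using s by auto
    ultimately show "s \<in> (\<Union>m\<in>?I. {?\<tau> + m * ?n..<?\<tau> + m * ?n + ?n})"
      by blast
  qed
  then have "card ?V \<le> card (\<Union>m\<in>?I. {?\<tau> + m * ?n..<?\<tau> + m * ?n + ?n})"
    by (intro card_mono) auto
  also have "\<dots> \<le> (\<Sum>m\<in>?I. card {?\<tau> + m * ?n..<?\<tau> + m * ?n + ?n})"
    by (rule card_UN_le) simp
  also have "\<dots> = card ?I * ?n"
    by simp
  also have "card ?I = card ((\<lambda>m. ?L ! m) ` ?I)"
    using arms(1)[of k z j] by (intro card_image[symmetric] inj_on_nth) auto
  also have "(\<lambda>m. ?L ! m) ` ?I = set ?L \<inter> S"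
    by (auto simp: in_set_conv_nth)
  finally show ?thesis
    by (simp add: mult.commute)
qed

text \<open>After the first stage, an arm of shell \<open>m\<close> survives only while the scale is
  at least \<open>(1/2) ^ m / 8\<close>. This bounds the pulls by
  \<open>64 * 128 * (k + 1) * 4 ^ m\<close> independently of the stage, and \<open>shells\<close>
  bounds the number of such arms.\<close>

lemma stage_shell_cost:
  assumes "start k z j < 2 ^ Suc k"
  shows "real (pulls k j * card (set (arms k z j) \<inter> shell m))
    \<le> (if j = 0 then 128 * (real k + 1) * (real k + real W)
       else 8192 * (real k + 1) * C * 2 powr (real m * (e + 2)))"
proof (cases j)
  case 0
  have "card (set (arms k z 0) \<inter> shell m) \<le> length (net ((1/2) ^ lev k) X)"
    using card_mono[of "set (arms k z 0)" "set (arms k z 0) \<inter> shell m"] card_length[of "arms k z 0"]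
    by (simp add: arms_def region_0 scale_def)
  then have "pulls k 0 * card (set (arms k z 0) \<inter> shell m) \<le> 128 * (k + 1) * (4 ^ lev k * length (net ((1/2) ^ lev k) X))"
    by (simp add: pulls_def)
  also have "\<dots> \<le> 128 * (k + 1) * (k + W)"
    using initial by (rule mult_le_mono2)
  finally have "real (pulls k 0 * card (set (arms k z 0) \<inter> shell m)) \<le> real (128 * (k + 1) * (k + W))"
    by (rule of_nat_mono)
  then show ?thesis
    using 0 by (simp add: algebra_simps)
next
  case (Suc i)
  let ?S = "set (arms k z j) \<inter> shell m" and ?s = "scale k j"
  have j: "0 < j"
    using Suc by simp
  have inv: "region k z j \<subseteq> Q" "\<And>x. x \<in> region k z j \<Longrightarrow> gap x \<le> 8 * ?s"
    using region_invariant[of j] assms j by auto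
  have rhs: "0 \<le> 8192 * (real k + 1) * C * 2 powr (real m * (e + 2))"
    using C by simp
  show ?thesis
  proof (cases "?S = {}")
    case True
    then show ?thesis
      using rhs j by simp
  next
    case False
    then obtain x where x: "x \<in> ?S"
      by blast
    have "(1/2::real) ^ Suc m < 8 * ?s"
      using inv(2)[of x] x arms(2)[of k z j] by (auto simp: shell_def)
    then have "(1/2::real) ^ (m + 4) < (1/2) ^ (lev k + j)"
      by (simp add: scale_def power_add power_divide)
    then have "lev k + j < m + 4"
      by (subst (asm) power_strict_decreasing_iff) auto
    \<comment> \<open>Integrality of the exponents gains the factor two that \<open>shells\<close>
      requires.\<close>
    then have "(1/2::real) ^ (m + 3) \<le> (1/2) ^ (lev k + j)"
      by (intro power_decreasing) auto
    then have ms: "(1/2) ^ m \<le> 8 * ?s"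
      by (simp add: scale_def power_add power_divide)
    have "real (card ?S) \<le> C * 2 powr (real m * e)"
    proof (rule shells[OF _ _ _ scale_pos scale_le_1 ms])
      show "?S \<subseteq> Q" "?S \<subseteq> X"
        using arms(2)[of k z j] inv(1) compact_region[of k z j] by auto
      show "pairwise (\<lambda>x y. ?s \<le> dist x y) ?S"
        using arms(3) by (rule pairwise_subset) auto
    qed (auto simp: shell_def gap_def)
    moreover have "real (pulls k j) \<le> 8192 * (real k + 1) * 4 ^ m"
    proof -
      have "((1/2) ^ m)\<^sup>2 \<le> (8 * ?s)\<^sup>2"
        using ms by (intro power_mono) auto
      then have "real (pulls k j) * ((1/2) ^ m)\<^sup>2 \<le> real (pulls k j) * (8 * ?s)\<^sup>2"
        by (rule mult_left_mono) simp
      also have "\<dots> = 8192 * (real k + 1)"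
        using pulls_scale[of k j] by (simp add: power_mult_distrib)
      finally have "real (pulls k j) * ((1/2) ^ m)\<^sup>2 * 4 ^ m \<le> 8192 * (real k + 1) * 4 ^ m"
        by (rule mult_right_mono) simp
      moreover have "((1/2) ^ m)\<^sup>2 * 4 ^ m = (1::real)"
        by (simp add: power2_eq_square flip: power_mult_distrib)
      ultimately show ?thesis
        by (simp add: mult.assoc)
    qed
    ultimately have "real (pulls k j) * real (card ?S) \<le> (8192 * (real k + 1) * 4 ^ m) * (C * 2 powr (real m * e))"
      by (intro mult_mono) auto
    also have "\<dots> = 8192 * (real k + 1) * C * 2 powr (real m * (e + 2))"
    proof -
      have "2 powr (real m * 2) = 2 powr real (2 * m)"
        by (simp add: mult.commute)
      also have "\<dots> = 4 ^ m"
        by (subst powr_realpow) (simp_all add: power_mult)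
      finally show ?thesis
        by (simp add: distrib_left powr_add)
    qed
    finally show ?thesis
      using j by simp
  qed
qed

lemma shell_visits:
  "real (card {s\<in>{2^k..<2^Suc k}. xs s \<in> shell m})
    \<le> 128 * (real k + 1) * (real k + real W) + real k * (8192 * (real k + 1) * C * 2 powr (real m * (e + 2)))"
proof -
  let ?I = "{2^k..<2^Suc k::nat}"
  let ?V = "\<lambda>j. {s\<in>?I. start k z j \<le> s \<and> s < start k z (Suc j) \<and> xs s \<in> shell m}"
  let ?c = "\<lambda>j. if j = 0 then 128 * (real k + 1) * (real k + real W)
    else 8192 * (real k + 1) * C * 2 powr (real m * (e + 2))"
  have c0: "0 \<le> ?c j" for j
    using C by simp
  have "{s\<in>?I. xs s \<in> shell m} \<subseteq> (\<Union>j\<in>{..k}. ?V j)"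
    using stage_exists by blast
  then have "card {s\<in>?I. xs s \<in> shell m} \<le> card (\<Union>j\<in>{..k}. ?V j)"
    by (intro card_mono) auto
  also have "\<dots> \<le> (\<Sum>j\<le>k. card (?V j))"
    by (rule card_UN_le) simp
  finally have "real (card {s\<in>?I. xs s \<in> shell m}) \<le> real (\<Sum>j\<le>k. card (?V j))"
    by (rule of_nat_mono)
  also have "\<dots> = (\<Sum>j\<le>k. real (card (?V j)))"
    by (rule of_nat_sum)
  also have "\<dots> \<le> (\<Sum>j\<le>k. ?c j)"
  proof (rule sum_mono)
    fix j
    show "real (card (?V j)) \<le> ?c j"
    proof (cases "start k z j < 2 ^ Suc k")
      case True
      have "real (card (?V j)) \<le> real (pulls k j * card (set (arms k z j) \<inter> shell m))"
        using stage_visits[of j "shell m"] by (rule of_nat_mono)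
      also have "\<dots> \<le> ?c j"
        using True by (rule stage_shell_cost)
      finally show ?thesis .
    next
      case False
      then have "?V j = {}"
        by auto
      show ?thesis
        using c0[of j] unfolding \<open>?V j = {}\<close> card.empty of_nat_0 .
    qed
  qed
  also have "\<dots> = ?c 0 + (\<Sum>j\<in>{1..k}. ?c j)"
    unfolding atMost_atLeast0 by (subst sum.atLeast_Suc_atMost) auto
  also have "(\<Sum>j\<in>{1..k}. ?c j) = (\<Sum>j\<in>{1..k}. 8192 * (real k + 1) * C * 2 powr (real m * (e + 2)))"
    by (intro sum.cong) auto
  finally show ?thesis
    by simp
qed

text \<open>A gap above the cutoff lies in exactly one dyadic shell and is at most the upper end of
  that shell.\<close>

lemma gap_le_shells:
  assumes "x \<in> X"
  shows "gap x \<le> (1/2) ^ Suc M + (\<Sum>m\<le>M. (1/2) ^ m * indicator (shell m) x)"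
proof (induction M)
  case 0
  show ?case
    using gap_bounds[OF assms] by (auto simp: shell_def split: split_indicator)
next
  case (Suc M)
  have nonneg: "0 \<le> (\<Sum>m\<le>M. (1/2) ^ m * indicator (shell m) x :: real)"
    by (intro sum_nonneg) auto
  show ?case
  proof (cases "gap x \<le> (1/2) ^ Suc M")
    case True
    then show ?thesis
      using nonneg by (cases "gap x \<le> (1/2) ^ Suc (Suc M)") (auto simp: shell_def indicator_def)
  next
    case False
    \<comment> \<open>The shell of \<open>x\<close>; the admissible exponents are bounded because
      \<open>gap x\<close> exceeds \<open>(1/2) ^ Suc M\<close>.\<close>
    define i where "i = (GREATEST i. gap x \<le> (1/2) ^ i)"
    have i: "gap x \<le> (1/2) ^ i" and i_max: "\<And>j. gap x \<le> (1/2) ^ j \<Longrightarrow> j \<le> i"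
    proof -
      have bound: "j \<le> Suc M" if "gap x \<le> (1/2) ^ j" for j
      proof (rule ccontr)
        assume "\<not> j \<le> Suc M"
        then have "(1/2::real) ^ j \<le> (1/2) ^ Suc M"
          by (intro power_decreasing) auto
        then show False
          using that False by simp
      qed
      have "gap x \<le> (1/2) ^ 0"
        using gap_bounds[OF assms] by simp
      then show "gap x \<le> (1/2) ^ i"
        unfolding i_def using bound by (rule GreatestI_nat)
      show "j \<le> i" if "gap x \<le> (1/2) ^ j" for j
        unfolding i_def using that bound by (rule Greatest_le_nat)
    qed
    have "x \<in> shell i"
      using i i_max[of "Suc i"] by (force simp: shell_def)
    moreover have "i \<le> Suc M"
    proof (rule ccontr)
      assume "\<not> i \<le> Suc M"
      then have "(1/2::real) ^ i \<le> (1/2) ^ Suc M"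
        by (intro power_decreasing) auto
      then show False
        using i False by simp
    qed
    ultimately have "(1/2) ^ i \<le> (\<Sum>m\<le>Suc M. (1/2) ^ m * indicator (shell m) x :: real)"
      using member_le_sum[of i "{..Suc M}" "\<lambda>m. (1/2) ^ m * indicator (shell m) x :: real"] by simp
    then show ?thesis
      using i by (intro order_trans[OF i]) (simp add: add_increasing)
  qed
qed

text \<open>The cutoff \<open>M\<close>, about \<open>k / (e + 2)\<close>, balances
  \<open>2 ^ k * (1/2) ^ M\<close> against \<open>2 powr (real M * (e + 1))\<close>. The three
  factors \<open>k + 1\<close> stand for the pulls per arm, the stages and the shells; for the first
  stage, \<open>initial\<close> takes the place of the second factor.\<close>

theorem phase_regret:
  "(\<Sum>s=2^k..<2^Suc k. gap (xs s))
    \<le> (1 + 128 * (1 + real W) + 8192 * C) * (real k + 1) ^ 3 * 2 powr (real k * (1 - 1 / (e + 2)))"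
proof -
  let ?I = "{2^k..<2^Suc k::nat}"
  define M where "M = nat \<lfloor>real k / (e + 2)\<rfloor>"
  define \<theta> where "\<theta> = 2 powr (real k * (1 - 1 / (e + 2)))"
  define D where "D = 128 * (1 + real W) + 8192 * C"
  have M_le: "real M \<le> real k / (e + 2)" and M_gt: "real k / (e + 2) < real M + 1"
    unfolding M_def using e by (simp_all add: of_nat_nat)
  have Mk: "M \<le> k"
  proof -
    have "real k / (e + 2) \<le> real k / 1"
      using e by (intro divide_left_mono) auto
    then show ?thesis
      using M_le by simp
  qed
  have \<theta>1: "1 \<le> \<theta>"
    unfolding \<theta>_def using e by (intro ge_one_powr_ge_zero) auto
  have exponent: "real k * (1 - 1 / (e + 2)) = real k - real k / (e + 2)"
    by (simp add: algebra_simps)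
  have xsX: "xs s \<in> X" if "s \<in> ?I" for s
    using xs[OF that] arm_in_X by simp
  have "(\<Sum>s\<in>?I. gap (xs s)) \<le> (\<Sum>s\<in>?I. (1/2) ^ Suc M + (\<Sum>m\<le>M. (1/2) ^ m * indicator (shell m) (xs s)))"
    using xsX by (intro sum_mono gap_le_shells)
  also have "\<dots> = 2 ^ k * (1/2) ^ Suc M + (\<Sum>s\<in>?I. \<Sum>m\<le>M. (1/2) ^ m * indicator (shell m) (xs s))"
    by (simp add: sum.distrib)
  also have "(\<Sum>s\<in>?I. \<Sum>m\<le>M. (1/2) ^ m * indicator (shell m) (xs s))
      = (\<Sum>m\<le>M. (1/2) ^ m * real (card {s\<in>?I. xs s \<in> shell m}))"
  proof -
    have "(\<Sum>s\<in>?I. indicator (shell m) (xs s)) = real (card {s\<in>?I. xs s \<in> shell m})" for m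
      by (simp add: indicator_def sum.If_cases Int_def)
    then show ?thesis
      by (subst sum.swap) (simp flip: sum_distrib_left)
  qed
  also have "\<dots> \<le> (\<Sum>m\<le>M. D * (real k + 1)\<^sup>2 * \<theta>)"
  proof (rule sum_mono)
    fix m assume "m \<in> {..M}"
    then have m: "m \<le> M"
      by simp
    let ?p = "2 powr (real m * (e + 2))"
    have half: "(1/2::real) ^ m = 2 powr (- real m)"
      by (simp add: powr_minus powr_realpow power_one_over inverse_eq_divide)
    have "(1/2) ^ m * ?p = 2 powr (real m * (e + 1))"
      unfolding half by (simp add: algebra_simps flip: powr_add)
    also have "\<dots> \<le> \<theta>"
    proof -
      have "real m * (e + 1) \<le> real k / (e + 2) * (e + 1)"
        using m M_le e by (intro mult_right_mono) auto
      also have "\<dots> = real k * (1 - 1 / (e + 2))"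
        using e by (simp add: field_simps)
      finally show ?thesis
        unfolding \<theta>_def by simp
    qed
    finally have p: "(1/2) ^ m * ?p \<le> \<theta>" .
    have h1: "(1/2::real) ^ m \<le> 1"
      by (simp add: power_le_one)
    have kW: "real k + real W \<le> (real k + 1) * (1 + real W)"
      by (simp add: algebra_simps)
    have "(1/2) ^ m * real (card {s\<in>?I. xs s \<in> shell m})
        \<le> (1/2) ^ m * (128 * (real k + 1) * (real k + real W) + real k * (8192 * (real k + 1) * C * ?p))"
      using shell_visits[of m] by (rule mult_left_mono) simp
    also have "\<dots> = (1/2) ^ m * (128 * (real k + 1) * (real k + real W))
        + 8192 * C * (real k * (real k + 1)) * ((1/2) ^ m * ?p)"
      by (simp add: algebra_simps)
    also have "\<dots> \<le> 1 * (128 * (real k + 1) * ((real k + 1) * (1 + real W)) * \<theta>)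
        + 8192 * C * ((real k + 1) * (real k + 1)) * \<theta>"
    proof (rule add_mono)
      have "128 * (real k + 1) * (real k + real W) \<le> 128 * (real k + 1) * ((real k + 1) * (1 + real W))"
        using kW by (intro mult_left_mono) auto
      also have "\<dots> \<le> 128 * (real k + 1) * ((real k + 1) * (1 + real W)) * \<theta>"
        using \<theta>1 mult_left_mono[of 1 \<theta> "128 * (real k + 1) * ((real k + 1) * (1 + real W))"] by simp
      finally show "(1/2) ^ m * (128 * (real k + 1) * (real k + real W))
          \<le> 1 * (128 * (real k + 1) * ((real k + 1) * (1 + real W)) * \<theta>)"
        by (rule mult_mono[OF h1]) auto
      show "8192 * C * (real k * (real k + 1)) * ((1/2) ^ m * ?p) \<le> 8192 * C * ((real k + 1) * (real k + 1)) * \<theta>"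
        using p C by (intro mult_mono) auto
    qed
    also have "\<dots> = D * (real k + 1)\<^sup>2 * \<theta>"
      by (simp add: D_def algebra_simps power2_eq_square)
    finally show "(1/2) ^ m * real (card {s\<in>?I. xs s \<in> shell m}) \<le> D * (real k + 1)\<^sup>2 * \<theta>" .
  qed
  also have "\<dots> \<le> (real k + 1) * (D * (real k + 1)\<^sup>2 * \<theta>)"
    using Mk C \<theta>1 by (simp add: D_def mult_right_mono)
  also have "2 ^ k * (1/2) ^ Suc M \<le> 1 * (real k + 1) ^ 3 * \<theta>"
  proof -
    have "(1/2::real) ^ Suc M = 2 powr (- real (Suc M))"
      by (simp only: powr_minus powr_realpow power_one_over inverse_eq_divide zero_less_numeral)
    then have "2 ^ k * (1/2::real) ^ Suc M = 2 powr real k * 2 powr (- real (Suc M))"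
      by (simp only: powr_realpow zero_less_numeral)
    also have "\<dots> = 2 powr (real k + - real (Suc M))"
      by (rule powr_add[symmetric])
    also have "real k + - real (Suc M) = real k - (real M + 1)"
      by simp
    finally have "2 ^ k * (1/2::real) ^ Suc M = 2 powr (real k - (real M + 1))" .
    also have "\<dots> \<le> \<theta>"
      unfolding \<theta>_def exponent using M_gt by simp
    also have "\<dots> \<le> (real k + 1) ^ 3 * \<theta>"
      using mult_right_mono[of 1 "(real k + 1) ^ 3" \<theta>] \<theta>1 by (simp add: one_le_power)
    finally show ?thesis
      by simp
  qed
  finally show ?thesis
    by (simp add: D_def \<theta>_def algebra_simps power2_eq_square power3_eq_cube)
qed

end

end

section \<open>Expected regret and the upper bound\<close>

text \<open>Absorbs the polynomial factor in the number of phases; \<open>a\<close> is chosen so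
  that \<open>exp (real K * a) ^ 4 = 2 powr (real K * \<eta>)\<close>.\<close>

lemma power4_le_powr:
  fixes \<eta> :: real
  assumes "0 < \<eta>"
  obtains c where "0 \<le> c" "\<And>K::nat. (real K + 1) ^ 4 \<le> c * 2 powr (real K * \<eta>)"
proof -
  define a where "a = \<eta> * ln 2 / 4"
  define b where "b = max 1 (1 / a)"
  have a: "0 < a"
    using assms by (simp add: a_def)
  have b: "1 \<le> b" "1 \<le> a * b"
    using a by (auto simp: b_def field_simps max_def)
  have "(real K + 1) ^ 4 \<le> b ^ 4 * 2 powr (real K * \<eta>)" for K :: nat
  proof -
    have "real K * 1 \<le> real K * (a * b)"
      using b by (intro mult_left_mono) auto
    then have "real K + 1 \<le> b * (1 + real K * a)"
      using b by (simp add: algebra_simps)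
    also have "\<dots> \<le> b * exp (real K * a)"
      using b by (intro mult_left_mono) auto
    finally have "(real K + 1) ^ 4 \<le> (b * exp (real K * a)) ^ 4"
      by (intro power_mono) auto
    also have "\<dots> = b ^ 4 * 2 powr (real K * \<eta>)"
      by (simp add: power_mult_distrib powr_def a_def flip: exp_of_nat_mult)
    finally show ?thesis .
  qed
  then show ?thesis
    using that[of "b ^ 4"] b by simp
qed

text \<open>The largest index up to \<open>k\<close> whose cost fits the budget; adding
  \<open>f 0\<close> ensures that index 0 always fits.\<close>

lemma slowly_growing_index:
  fixes f :: "nat \<Rightarrow> nat"
  obtains lev where "filterlim lev at_top sequentially" "\<And>k. f (lev k) \<le> k + f 0"
proof
  let ?S = "\<lambda>k. {i. i \<le> k \<and> f i \<le> k + f 0}"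
  define lev where "lev k = Max (?S k)" for k
  have fin: "finite (?S k)" for k
    by simp
  have "lev k \<in> ?S k" for k
    unfolding lev_def using fin by (rule Max_in) auto
  then show "f (lev k) \<le> k + f 0" for k
    by simp
  show "filterlim lev at_top sequentially"
    unfolding filterlim_at_top eventually_sequentially
  proof (intro allI exI impI)
    fix N k assume "max N (f N) \<le> k"
    then show "N \<le> lev k"
      unfolding lev_def using fin by (intro Max_ge) auto
  qed
qed

lemma sum_dyadic_phases:
  fixes g :: "nat \<Rightarrow> real"
  shows "(\<Sum>s<2^K. g s) = g 0 + (\<Sum>k<K. \<Sum>s=2^k..<2^Suc k. g s)"
proof (induction K)
  case (Suc K)
  have "(\<Sum>s<2^Suc K. g s) = (\<Sum>s<2^K. g s) + (\<Sum>s=2^K..<2^Suc K. g s)"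
    using sum.atLeastLessThan_concat[of 0 "2^K" "2^Suc K" g] by (simp add: atLeast0LessThan)
  then show ?case
    using Suc by simp
qed simp

section \<open>From the pathwise bound to the regret dimension of an instance\<close>

context elimination_instance
begin

context
  fixes P :: "'a \<Rightarrow> real measure"
  assumes inst: "lipschitz_mab_instance X f P" and \<epsilon>: "0 < \<epsilon>" and lev: "filterlim lev at_top sequentially"
begin

interpretation mab_run X algo f P
  using bandit_algorithm_algo inst by unfold_locales

definition phase_bound :: real where
  "phase_bound = 1 + 128 * (1 + real W) + 8192 * C"

definition rate :: real where "rate = 1 - 1 / (e + 2)"

lemma opt_eq: "opt = f xo"
  unfolding opt_def using xo by (intro cSup_eq_maximum) auto

lemma measurable_phase_gap:
  "2^Suc k \<le> n \<Longrightarrow> (\<lambda>h. \<Sum>s=2^k..<2^Suc k. gap (fst (h s))) \<in> borel_measurable (history_space n)"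
  unfolding gap_def by (intro borel_measurable_sum borel_measurable_diff measurable_payoff_component) auto

lemma phase_gap_trivial:
  assumes "h \<in> space (history_space n)" "2^Suc k \<le> n"
  shows "0 \<le> (\<Sum>s=2^k..<2^Suc k. gap (fst (h s)))" "(\<Sum>s=2^k..<2^Suc k. gap (fst (h s))) \<le> 2^k"
proof -
  have g: "0 \<le> gap (fst (h s)) \<and> gap (fst (h s)) \<le> 1" if "s \<in> {2^k..<2^Suc k}" for s
    using that assms by (intro gap_bounds arm_in_space) auto
  then show "0 \<le> (\<Sum>s=2^k..<2^Suc k. gap (fst (h s)))"
    by (intro sum_nonneg) blast
  have "(\<Sum>s=2^k..<2^Suc k. gap (fst (h s))) \<le> (\<Sum>s=2^k..<2^Suc k::nat. 1)"
    using g by (intro sum_mono) blast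
  then show "(\<Sum>s=2^k..<2^Suc k. gap (fst (h s))) \<le> 2^k"
    by simp
qed

text \<open>If the noise is unbounded the phase loses at most \<open>2^k\<close>, which against the
  probability \<open>8 / 4^k\<close> contributes at most 8.\<close>

lemma expected_phase_gap:
  assumes n: "2^Suc k \<le> n" and fine: "4 * scale k 0 < \<epsilon>"
  shows "(\<integral>\<^sup>+h. ennreal (\<Sum>s=2^k..<2^Suc k. gap (fst (h s))) \<partial>H n)
    \<le> ennreal (phase_bound * (real k + 1) ^ 3 * 2 powr (real k * rate) + 8)"
proof -
  let ?G = "\<lambda>h. \<Sum>s=2^k..<2^Suc k. gap (fst (h s))"
  let ?B = "phase_bound * (real k + 1) ^ 3 * 2 powr (real k * rate)"
  let ?N = "{h\<in>space (H n). \<not> noise_bounded k h}"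
  have B: "0 \<le> ?B"
    using C by (simp add: phase_bound_def)
  have N: "?N \<in> sets (H n)"
    using measurable_noise_bounded[OF n] by measurable
  have "AE h in H n. ennreal (?G h) \<le> ennreal ?B + ennreal (2^k) * indicator ?N h"
    using AE_arm[OF inst, of n]
  proof (rule AE_mp, intro AE_I2 impI)
    fix h assume h: "h \<in> space (H n)" and arm: "\<forall>s<n. fst (h s) = arm s (prefix_floor h)"
    then have h': "h \<in> space (history_space n)"
      by (simp add: space_H)
    show "ennreal (?G h) \<le> ennreal ?B + ennreal (2^k) * indicator ?N h"
    proof (cases "noise_bounded k h")
      case True
      have "(\<Sum>s=2^k..<2^Suc k. gap (fst (h s))) \<le> ?B"
        unfolding phase_bound_def rate_def
      proof (rule phase_regret[where z = "prefix_floor h" and ys = "\<lambda>s. snd (h s)"])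
        show "prefix_floor h b = \<lfloor>\<Sum>s<b. snd (h s)\<rfloor>" for b
          by (simp add: prefix_floor_def)
        show "fst (h s) = arm s (prefix_floor h)" if "s \<in> {2^k..<2^Suc k}" for s
          using that arm n by simp
        show "\<bar>\<Sum>s=a..<b. snd (h s) - f (fst (h s))\<bar> \<le> sqrt (2 * real k * real (b - a))"
          if "b \<in> {2^k..2^Suc k}" "a \<in> {2^k..<b}" for a b
          using True that by (simp add: noise_bounded_def)
      qed (rule fine)
      then show ?thesis
        using True by (simp add: ennreal_leI)
    next
      case False
      have "ennreal (?G h) \<le> ennreal (2^k)"
        using phase_gap_trivial(2)[OF h' n] by (rule ennreal_leI)
      then show ?thesis
        using False h by (simp add: add_increasing)
    qed
  qed
  then have "(\<integral>\<^sup>+h. ennreal (?G h) \<partial>H n) \<le> (\<integral>\<^sup>+h. ennreal ?B + ennreal (2^k) * indicator ?N h \<partial>H n)"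
    by (rule nn_integral_mono_AE)
  also have "\<dots> = ennreal ?B + ennreal (2^k) * emeasure (H n) ?N"
    using N prob_space.emeasure_space_1[OF prob_space_H, of n]
    by (simp add: nn_integral_add nn_integral_cmult)
  also have "emeasure (H n) ?N = ennreal (measure (H n) ?N)"
    using prob_space_H[of n] by (intro finite_measure.emeasure_eq_measure prob_space.finite_measure)
  also have "ennreal (measure (H n) ?N) \<le> ennreal (8 / 4^k)"
    using prob_noise_unbounded[OF n] by (rule ennreal_leI)
  also have "ennreal ?B + ennreal (2^k) * ennreal (8 / 4^k) \<le> ennreal (?B + 8)"
  proof -
    have "(2::real)^k \<le> 4^k"
      by (rule power_mono) auto
    then have "2^k * (8 / 4^k) \<le> (8::real)"
      by (simp add: field_simps)
    then have "ennreal (2^k * (8 / 4^k)) \<le> ennreal 8"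
      by (rule ennreal_leI)
    then have "ennreal (2^k) * ennreal (8 / 4^k) \<le> ennreal 8"
      by (subst ennreal_mult[symmetric]) auto
    then have "ennreal ?B + ennreal (2^k) * ennreal (8 / 4^k) \<le> ennreal ?B + ennreal 8"
      by (rule add_left_mono)
    also have "\<dots> = ennreal (?B + 8)"
      using B by simp
    finally show ?thesis .
  qed
  finally show ?thesis
    by (simp add: add_left_mono mult_left_mono)
qed

text \<open>Only finitely many phases start with a scale too coarse for the instance; their trivial
  bound goes into \<open>D\<close>.\<close>

lemma expected_phase_gap_uniform:
  "\<exists>D\<ge>0. \<forall>k n. 2^Suc k \<le> n \<longrightarrow>
    (\<integral>\<^sup>+h. ennreal (\<Sum>s=2^k..<2^Suc k. gap (fst (h s))) \<partial>H n)
      \<le> ennreal (D * (real k + 1) ^ 3 * 2 powr (real k * rate))"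
proof -
  have "(\<lambda>k. 4 * (1/2::real) ^ lev k) \<longlonglongrightarrow> 4 * 0"
    using filterlim_compose[OF LIMSEQ_realpow_zero[of "1/2::real"] lev]
    by (intro tendsto_mult_left) auto
  then have "\<forall>\<^sub>F k in sequentially. 4 * (1/2::real) ^ lev k < \<epsilon>"
    using \<epsilon> by (intro order_tendstoD(2)) auto
  then obtain k0 where k0: "\<And>k. k0 \<le> k \<Longrightarrow> 4 * (1/2::real) ^ lev k < \<epsilon>"
    unfolding eventually_sequentially by blast
  define D where "D = phase_bound + 8 + 2 ^ k0"
  have pb: "0 \<le> phase_bound"
    using C by (simp add: phase_bound_def)
  have rate: "0 \<le> rate"
    using e by (simp add: rate_def)
  have "(\<integral>\<^sup>+h. ennreal (\<Sum>s=2^k..<2^Suc k. gap (fst (h s))) \<partial>H n)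
      \<le> ennreal (D * (real k + 1) ^ 3 * 2 powr (real k * rate))" if n: "2^Suc k \<le> n" for k n
  proof -
    let ?u = "(real k + 1) ^ 3 * 2 powr (real k * rate)"
    have u: "1 \<le> ?u"
    proof -
      have "1 * 1 \<le> ?u"
        using rate by (intro mult_mono one_le_power ge_one_powr_ge_zero) auto
      then show ?thesis
        by simp
    qed
    show ?thesis
    proof (cases "k0 \<le> k")
      case True
      have "phase_bound * (real k + 1) ^ 3 * 2 powr (real k * rate) + 8 = phase_bound * ?u + 8 * 1"
        by simp
      also have "\<dots> \<le> phase_bound * ?u + 8 * ?u"
        using u by (intro add_left_mono mult_left_mono) auto
      also have "\<dots> \<le> D * ?u"
      proof -
        have "(phase_bound + 8) * ?u \<le> D * ?u"
          by (rule mult_right_mono) (auto simp: D_def)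
        then show ?thesis
          by (simp only: distrib_right)
      qed
      finally have le: "ennreal (phase_bound * (real k + 1) ^ 3 * 2 powr (real k * rate) + 8) \<le> ennreal (D * ?u)"
        by (rule ennreal_leI)
      have "4 * scale k 0 < \<epsilon>"
        using k0[OF True] by (simp add: scale_def)
      from order_trans[OF expected_phase_gap[OF n this] le] show ?thesis
        by (simp only: mult.assoc)
    next
      case False
      have "(\<integral>\<^sup>+h. ennreal (\<Sum>s=2^k..<2^Suc k. gap (fst (h s))) \<partial>H n) \<le> (\<integral>\<^sup>+h. ennreal (2^k) \<partial>H n)"
        using phase_gap_trivial(2) n by (intro nn_integral_mono ennreal_leI) (auto simp: space_H)
      also have "\<dots> = ennreal (2^k)"
        using prob_space.emeasure_space_1[OF prob_space_H, of n] by simp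
      also have "\<dots> \<le> ennreal (D * ?u)"
      proof (rule ennreal_leI)
        have "(2::real)^k \<le> 2^k0"
          using False by (intro power_increasing) auto
        also have "\<dots> \<le> D"
          using pb by (simp add: D_def)
        finally have "2^k \<le> D * 1"
          by simp
        also have "\<dots> \<le> D * ?u"
          using u pb by (intro mult_left_mono) (auto simp: D_def)
        finally show "2^k \<le> D * ?u" .
      qed
      finally show ?thesis
        by (simp add: mult.assoc)
    qed
  qed
  moreover have "0 \<le> D"
    using pb by (simp add: D_def)
  ultimately show ?thesis
    by blast
qed

text \<open>Summing over \<open>K\<close> phases raises the power from 3 to 4, and the single round
  before phase 0 costs at most 1.\<close>

lemma regret_dyadic:
  "\<exists>D\<ge>0. \<forall>K. regret X algo f P (2^K) \<le> D * (real K + 1) ^ 4 * 2 powr (real K * rate)"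
proof -
  obtain D where D: "0 \<le> D" "\<And>k n. 2^Suc k \<le> n \<Longrightarrow>
    (\<integral>\<^sup>+h. ennreal (\<Sum>s=2^k..<2^Suc k. gap (fst (h s))) \<partial>H n)
      \<le> ennreal (D * (real k + 1) ^ 3 * 2 powr (real k * rate))"
    using expected_phase_gap_uniform by blast
  have rate: "0 \<le> rate"
    using e by (simp add: rate_def)
  have "regret X algo f P (2^K) \<le> (1 + D) * (real K + 1) ^ 4 * 2 powr (real K * rate)" for K
  proof -
    let ?\<theta> = "2 powr (real K * rate)"
    have \<theta>: "1 \<le> ?\<theta>"
      using rate by (intro ge_one_powr_ge_zero) auto
    have n: "2^Suc k \<le> (2::nat)^K" if "k < K" for k
      using that by (intro power_increasing) auto
    have "ennreal (regret X algo f P (2^K)) = (\<integral>\<^sup>+h. ennreal (\<Sum>s<2^K. gap (fst (h s))) \<partial>H (2^K))"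
      unfolding ennreal_regret opt_eq gap_def ..
    also have "\<dots> \<le> (\<integral>\<^sup>+h. ennreal 1 + (\<Sum>k<K. ennreal (\<Sum>s=2^k..<2^Suc k. gap (fst (h s)))) \<partial>H (2^K))"
    proof (rule nn_integral_mono)
      fix h assume "h \<in> space (H (2^K))"
      then have h: "h \<in> space (history_space (2^K))"
        by (simp add: space_H)
      have "gap (fst (h 0)) \<le> 1"
        using gap_bounds[OF arm_in_space[OF h, of 0]] by simp
      then have "ennreal (\<Sum>s<2^K. gap (fst (h s))) \<le> ennreal (1 + (\<Sum>k<K. \<Sum>s=2^k..<2^Suc k. gap (fst (h s))))"
        unfolding sum_dyadic_phases by (intro ennreal_leI) simp
      also have "\<dots> = ennreal 1 + ennreal (\<Sum>k<K. \<Sum>s=2^k..<2^Suc k. gap (fst (h s)))"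
        by (intro ennreal_plus sum_nonneg[of "{..<K}"] phase_gap_trivial(1)[OF h n]) auto
      also have "ennreal (\<Sum>k<K. \<Sum>s=2^k..<2^Suc k. gap (fst (h s))) = (\<Sum>k<K. ennreal (\<Sum>s=2^k..<2^Suc k. gap (fst (h s))))"
        by (intro sum_ennreal[symmetric] phase_gap_trivial(1)[OF h n]) auto
      finally show "ennreal (\<Sum>s<2^K. gap (fst (h s)))
          \<le> ennreal 1 + (\<Sum>k<K. ennreal (\<Sum>s=2^k..<2^Suc k. gap (fst (h s))))" .
    qed
    also have "\<dots> = ennreal 1 + (\<Sum>k<K. \<integral>\<^sup>+h. ennreal (\<Sum>s=2^k..<2^Suc k. gap (fst (h s))) \<partial>H (2^K))"
    proof -
      have m: "(\<lambda>h. ennreal (\<Sum>s=2^k..<2^Suc k. gap (fst (h s)))) \<in> borel_measurable (H (2^K))" if "k < K" for k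
        using measurable_phase_gap[OF n[OF that]] by measurable
      have "(\<integral>\<^sup>+h. ennreal 1 + (\<Sum>k<K. ennreal (\<Sum>s=2^k..<2^Suc k. gap (fst (h s)))) \<partial>H (2^K))
          = (\<integral>\<^sup>+h. ennreal 1 \<partial>H (2^K)) + (\<integral>\<^sup>+h. (\<Sum>k<K. ennreal (\<Sum>s=2^k..<2^Suc k. gap (fst (h s)))) \<partial>H (2^K))"
        using m by (intro nn_integral_add borel_measurable_sum) auto
      also have "(\<integral>\<^sup>+h. ennreal 1 \<partial>H (2^K)) = ennreal 1"
        using prob_space.emeasure_space_1[OF prob_space_H, of "2^K"] by simp
      also have "(\<integral>\<^sup>+h. (\<Sum>k<K. ennreal (\<Sum>s=2^k..<2^Suc k. gap (fst (h s)))) \<partial>H (2^K))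
          = (\<Sum>k<K. \<integral>\<^sup>+h. ennreal (\<Sum>s=2^k..<2^Suc k. gap (fst (h s))) \<partial>H (2^K))"
        using m by (intro nn_integral_sum) auto
      finally show ?thesis .
    qed
    also have "\<dots> \<le> ennreal 1 + (\<Sum>k<K. ennreal (D * (real K + 1) ^ 3 * ?\<theta>))"
    proof (intro add_left_mono sum_mono)
      fix k assume "k \<in> {..<K}"
      then have k: "k < K"
        by simp
      have "D * (real k + 1) ^ 3 * 2 powr (real k * rate) \<le> D * (real K + 1) ^ 3 * ?\<theta>"
        using k D(1) rate by (intro mult_mono power_mono powr_mono mult_right_mono) auto
      then show "(\<integral>\<^sup>+h. ennreal (\<Sum>s=2^k..<2^Suc k. gap (fst (h s))) \<partial>H (2^K)) \<le> ennreal (D * (real K + 1) ^ 3 * ?\<theta>)"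
        by (intro order_trans[OF D(2)[OF n[OF k]]] ennreal_leI)
    qed
    also have "\<dots> = ennreal (1 + real K * (D * (real K + 1) ^ 3 * ?\<theta>))"
      using D(1) by (simp add: ennreal_of_nat_eq_real_of_nat ennreal_mult flip: ennreal_1)
    finally have "regret X algo f P (2^K) \<le> 1 + real K * (D * (real K + 1) ^ 3 * ?\<theta>)"
      using D(1) by (subst (asm) ennreal_le_iff) (auto intro!: add_nonneg_nonneg mult_nonneg_nonneg)
    also have "\<dots> \<le> 1 * (real K + 1) ^ 4 * ?\<theta> + D * (real K + 1) ^ 4 * ?\<theta>"
    proof (rule add_mono)
      have "1 * 1 \<le> (real K + 1) ^ 4 * ?\<theta>"
        using \<theta> by (intro mult_mono one_le_power) auto
      then show "1 \<le> 1 * (real K + 1) ^ 4 * ?\<theta>"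
        by simp
      have "real K * (D * (real K + 1) ^ 3 * ?\<theta>) \<le> (real K + 1) * (D * (real K + 1) ^ 3 * ?\<theta>)"
        using D(1) by (intro mult_right_mono) auto
      also have "\<dots> = D * (real K + 1) ^ 4 * ?\<theta>"
        by (simp add: power3_eq_cube power4_eq_xxxx mult_ac)
      finally show "real K * (D * (real K + 1) ^ 3 * ?\<theta>) \<le> D * (real K + 1) ^ 4 * ?\<theta>" .
    qed
    also have "\<dots> = (1 + D) * (real K + 1) ^ 4 * ?\<theta>"
      by (simp add: distrib_right)
    finally show ?thesis .
  qed
  then show ?thesis
    using D(1) by (intro exI[of _ "1 + D"]) auto
qed

text \<open>Any larger exponent absorbs the polynomial factor, and the infimum allows that. A
  general \<open>t\<close> is replaced by the next power of two, which is at most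
  \<open>2 * t\<close>.\<close>

theorem regret_dim_inst_le: "regret_dim_inst X algo f P \<le> ereal e"
proof (rule dense_ge)
  fix x assume x: "ereal e < x"
  then obtain e' where e': "ereal e < ereal e'" "ereal e' < x"
    using ereal_dense2 by blast
  define r where "r = 1 - 1 / (e' + 2)"
  have "1 / (e' + 2) < 1 / (e + 2)"
    using e' e by (intro divide_strict_left_mono) auto
  then have "0 < r - rate"
    by (simp add: r_def rate_def)
  then obtain c where c: "0 \<le> c" "\<And>K::nat. (real K + 1) ^ 4 \<le> c * 2 powr (real K * (r - rate))"
    using power4_le_powr by blast
  obtain D where D: "0 \<le> D" "\<And>K. regret X algo f P (2^K) \<le> D * (real K + 1) ^ 4 * 2 powr (real K * rate)"
    using regret_dyadic by blast
  have r: "0 \<le> r"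
    using e' e by (simp add: r_def)
  have "regret X algo f P t \<le> D * c * 2 powr r * real t powr r" for t
  proof (cases "t = 0")
    case True
    then show ?thesis
      by (simp add: regret_def)
  next
    case False
    define K where "K = (LEAST K. t \<le> 2 ^ K)"
    have "\<exists>K. t \<le> 2 ^ K"
      using less_imp_le[OF less_exp] by blast
    then have tK: "t \<le> 2 ^ K"
      unfolding K_def by (rule LeastI_ex)
    have Kt: "(2::real) ^ K \<le> 2 * real t"
    proof (cases K)
      case 0
      then show ?thesis
        using False by simp
    next
      case (Suc i)
      then have "\<not> t \<le> 2 ^ i"
        using not_less_Least[of i "\<lambda>K. t \<le> 2 ^ K"] by (simp add: K_def)
      then have "(2::nat) ^ i \<le> t"
        by simp
      then have "real (2 ^ i) \<le> real t"
        by (rule of_nat_mono)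
      then show ?thesis
        using Suc by simp
    qed
    have "regret X algo f P t \<le> regret X algo f P (2^K)"
      using tK by (rule regret_mono)
    also have "\<dots> \<le> D * (real K + 1) ^ 4 * 2 powr (real K * rate)"
      by (rule D)
    also have "\<dots> \<le> D * (c * 2 powr (real K * (r - rate))) * 2 powr (real K * rate)"
      using c(2)[of K] D(1) by (intro mult_right_mono mult_left_mono) auto
    also have "\<dots> = D * c * (2 powr (real K * (r - rate)) * 2 powr (real K * rate))"
      by (simp add: mult_ac)
    also have "2 powr (real K * (r - rate)) * 2 powr (real K * rate) = (2 powr real K) powr r"
      by (simp add: powr_powr algebra_simps flip: powr_add)
    also have "D * c * (2 powr real K) powr r \<le> D * c * (2 * real t) powr r"
      using Kt D(1) c(1) r by (intro mult_left_mono powr_mono2) (auto simp: powr_realpow)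
    also have "\<dots> = D * c * 2 powr r * real t powr r"
      by (simp add: powr_mult)
    finally show ?thesis .
  qed
  then have "\<exists>C. \<forall>t. regret X algo f P t \<le> C * real t powr (1 - 1 / (e' + 2))"
    unfolding r_def by blast
  then have "regret_dim_inst X algo f P \<le> ereal e'"
    unfolding regret_dim_inst_def using e e' by (intro Inf_lower) auto
  then show "regret_dim_inst X algo f P \<le> x"
    using e'(2) by simp
qed

end

end

lemma MaxMinCOV_nonneg:
  fixes X :: "'a::metric_space set"
  assumes "X \<noteq> {}"
  shows "0 \<le> MaxMinCOV X"
proof -
  have "0 \<le> COV U" for U :: "'a set"
    unfolding COV_def by (rule Inf_greatest) auto
  then have "0 \<le> MinCOV X"
    unfolding MinCOV_def by (intro Inf_greatest) auto
  also have "\<dots> \<le> MaxMinCOV X"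
    unfolding MaxMinCOV_def using assms by (intro Sup_upper) auto
  finally show ?thesis .
qed

text \<open>The separation is at least \<open>(1/2) ^ m / 8\<close>, whence the factor
  \<open>8 powr d\<close>.\<close>

lemma covered_shell_card:
  fixes L :: "'a::metric_space set"
  assumes c: "\<forall>r\<in>{0<..1}. ereal_of_enat (covering_number r Q) \<le> ereal (c * r powr (-d))" and "0 \<le> d"
    and L: "L \<subseteq> Q" "pairwise (\<lambda>x y. s \<le> dist x y) L" and s: "0 < s" "s \<le> 1" "(1/2) ^ m \<le> 8 * s"
  shows "real (card L) \<le> (max c 0 * 8 powr d) * 2 powr (real m * d)"
proof -
  have "real (card L) \<le> c * s powr (-d)"
    using separated_card_le_covering_number[of s Q "c * s powr (-d)" L] c L s by auto
  also have "\<dots> \<le> max c 0 * s powr (-d)"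
    by (rule mult_right_mono) auto
  also have "\<dots> \<le> max c 0 * (2 powr (- real m) / 8) powr (-d)"
  proof (rule mult_left_mono)
    have "(1/2::real) ^ m = 2 powr (- real m)"
      by (simp add: powr_minus powr_realpow power_one_over inverse_eq_divide)
    then have "2 powr (- real m) / 8 \<le> s"
      using s(3) by simp
    then show "s powr (-d) \<le> (2 powr (- real m) / 8) powr (-d)"
      using s assms(2) by (intro powr_mono2') auto
  qed simp
  also have "(2 powr (- real m) / 8) powr (-d) = 8 powr d * 2 powr (real m * d)"
    by (simp add: powr_divide powr_powr) (simp add: powr_minus divide_inverse)
  finally show ?thesis
    by (simp add: mult.assoc)
qed

text \<open>\<open>elimination\<close> is interpreted before any instance is fixed, so one algorithm
  serves all payoffs. The two bounds then interpret \<open>elimination_instance\<close> for the same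
  \<open>algo\<close> with different exponents.\<close>

theorem regret_dim_upper_bound:
  fixes X :: "'a::metric_space set"
  assumes "compact X" "X \<noteq> {}" "MaxMinCOV X < ereal d"
  shows "\<exists>A. bandit_algorithm X A \<and> regret_dim X A \<le> ereal d \<and>
    (\<forall>\<mu> P. lipschitz_mab_instance X \<mu> P \<longrightarrow> regret_dim_inst X A \<mu> P \<le> zooming_dim X \<mu>)"
proof -
  have "0 < ereal d"
    using MaxMinCOV_nonneg[OF assms(2)] assms(3) by (rule le_less_trans)
  then have d: "0 \<le> d"
    by simp
  obtain x0 where x0: "x0 \<in> X"
    using assms(2) by blast
  \<comment> \<open>Up to the factor \<open>128 * (k + 1)\<close>, the sequence fed in is the number
    of rounds of a first stage at scale \<open>(1/2) ^ i\<close>.\<close>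
  obtain lev where lev: "filterlim lev at_top sequentially"
    "\<And>k. 4 ^ lev k * length (net ((1/2) ^ lev k) X) \<le> k + 4 ^ 0 * length (net ((1/2) ^ 0) X)"
    using slowly_growing_index[of "\<lambda>i. 4 ^ i * length (net ((1/2) ^ i) X)"] by blast
  let ?W = "4 ^ 0 * length (net ((1/2) ^ 0) X)"
  interpret elimination X "fat_restriction d X" lev x0
    by unfold_locales (rule assms(1), rule x0, rule compact_fat_restriction[OF assms(1)], assumption,
        rule fat_restriction_subset)
  have bounds: "regret_dim_inst X algo \<mu> P \<le> ereal d" "regret_dim_inst X algo \<mu> P \<le> zooming_dim X \<mu>"
    if inst: "lipschitz_mab_instance X \<mu> P" for \<mu> P
  proof -
    have lip: "1-lipschitz_on X \<mu>" and unit: "\<And>x. x \<in> X \<Longrightarrow> 0 \<le> \<mu> x \<and> \<mu> x \<le> 1"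
      using inst by (auto simp: lipschitz_mab_instance_def)
    have cont: "continuous_on X \<mu>"
      using lip by (rule lipschitz_on_continuous_on)
    obtain xo \<epsilon> Q where opt: "xo \<in> X" "\<And>y. y \<in> X \<Longrightarrow> \<mu> y \<le> \<mu> xo" "0 < \<epsilon>" "covered_with_exponent d Q"
      "\<And>Z. xo \<in> Z \<Longrightarrow> Z \<subseteq> X \<Longrightarrow> (\<And>z. z \<in> Z \<Longrightarrow> \<mu> xo - \<mu> z < \<epsilon>) \<Longrightarrow>
         xo \<in> fat_restriction d X Z \<and> fat_restriction d X Z \<subseteq> Q"
      using fat_restriction_near_optimum[OF assms(1-3) cont] by blast
    obtain c where c: "\<forall>r\<in>{0<..1}. ereal_of_enat (covering_number r Q) \<le> ereal (c * r powr (-d))"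
      using opt(4) unfolding covered_with_exponent_def by (elim exE)
    show "regret_dim_inst X algo \<mu> P \<le> ereal d"
    proof -
      interpret elimination_instance X "fat_restriction d X" lev x0 \<mu> xo \<epsilon> Q "max c 0 * 8 powr d" d ?W
      proof unfold_locales
        fix L s m
        assume "L \<subseteq> Q" "pairwise (\<lambda>x y. s \<le> dist x y) L" "0 < s" "s \<le> 1" "(1/2) ^ m \<le> 8 * s"
        then show "real (card L) \<le> max c 0 * 8 powr d * 2 powr (real m * d)"
          by (rule covered_shell_card[OF c d])
      qed (use lip unit opt d lev(2) in auto)
      show ?thesis
        using inst opt(3) lev(1) by (rule regret_dim_inst_le)
    qed
    have sup: "(SUP y\<in>X. \<mu> y) = \<mu> xo"
      using opt(1,2) by (intro cSup_eq_maximum) auto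
    show "regret_dim_inst X algo \<mu> P \<le> zooming_dim X \<mu>"
      unfolding zooming_dim_def zooming_dim_mult_def sup
    proof (intro INF_greatest Inf_greatest)
      fix b :: real and u
      assume b: "b \<in> {0<..}" and "u \<in> {ereal d | d. 0 \<le> d \<and> (\<forall>r\<in>{0<..1}.
          ereal_of_enat (covering_number (r / 8) {x \<in> X. r / 2 < \<mu> xo - \<mu> x \<and> \<mu> xo - \<mu> x \<le> r})
            \<le> ereal (b * r powr (-d)))}"
      then obtain e where u: "u = ereal e" and e: "0 \<le> e"
        and zoom: "\<forall>r\<in>{0<..1}. ereal_of_enat (covering_number (r / 8)
            {x \<in> X. r / 2 < \<mu> xo - \<mu> x \<and> \<mu> xo - \<mu> x \<le> r}) \<le> ereal (b * r powr (-e))"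
        by (elim CollectE exE conjE)
      interpret elimination_instance X "fat_restriction d X" lev x0 \<mu> xo \<epsilon> Q b e ?W
      proof unfold_locales
        fix L :: "'a set" and s :: real and m :: nat
        assume L: "L \<subseteq> X" "pairwise (\<lambda>x y. s \<le> dist x y) L" "(1/2) ^ m \<le> 8 * s"
          "\<And>x. x \<in> L \<Longrightarrow> (1/2) ^ Suc m < \<mu> xo - \<mu> x \<and> \<mu> xo - \<mu> x \<le> (1/2) ^ m"
        let ?r = "(1/2::real) ^ m"
        have "?r \<in> {0<..1}"
          by (simp add: power_le_one)
        from bspec[OF zoom this]
        have "real (card L) \<le> b * ?r powr (-e)"
        proof (rule separated_card_le_covering_number[THEN conjunct2])
          show "L \<subseteq> {x \<in> X. ?r / 2 < \<mu> xo - \<mu> x \<and> \<mu> xo - \<mu> x \<le> ?r}"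
            using L(1,4) by auto
          show "pairwise (\<lambda>x y. ?r / 8 \<le> dist x y) L"
            \<comment> \<open>The survivors of the shell are separated by at least an eighth of its
              upper end, the covering scale in the zooming dimension.\<close>
            using L(2,3) by (intro pairwise_mono[OF L(2)]) auto
        qed
        also have "?r powr (-e) = 2 powr (real m * e)"
        proof -
          have "?r = 2 powr (- real m)"
            by (simp add: powr_minus powr_realpow power_one_over inverse_eq_divide)
          then show ?thesis
            by (simp add: powr_powr)
        qed
        finally show "real (card L) \<le> b * 2 powr (real m * e)" .
      qed (use lip unit opt e b lev(2) in auto)
      show "regret_dim_inst X algo \<mu> P \<le> u"
        unfolding u using inst opt(3) lev(1) by (rule regret_dim_inst_le)
    qed
  qed
  have "regret_dim X algo \<le> ereal d"
    unfolding regret_dim_def using bounds(1) by (intro Sup_least) auto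
  then show ?thesis
    using bandit_algorithm_algo bounds(2) by blast
qed

theorem theorem5p2:
  fixes X :: "'a::metric_space set"
  assumes "compact X" and "X \<noteq> {}" and "diameter X \<le> 1"
  shows "(\<forall>d::real. MaxMinCOV X < ereal d \<longrightarrow>
            (\<exists>A. bandit_algorithm X A \<and> regret_dim X A \<le> ereal d \<and>
               (\<forall>\<mu> P. lipschitz_mab_instance X \<mu> P \<longrightarrow>
                  regret_dim_inst X A \<mu> P \<le> zooming_dim X \<mu>))) \<and>
         (\<forall>A. bandit_algorithm X A \<longrightarrow> \<not> regret_dim X A < MaxMinCOV X)"
proof (intro conjI allI impI)
  fix d :: real assume "MaxMinCOV X < ereal d"
  with assms(1,2) show "\<exists>A. bandit_algorithm X A \<and> regret_dim X A \<le> ereal d \<and>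
      (\<forall>\<mu> P. lipschitz_mab_instance X \<mu> P \<longrightarrow> regret_dim_inst X A \<mu> P \<le> zooming_dim X \<mu>)"
    by (rule regret_dim_upper_bound)
next
  fix A assume "bandit_algorithm X A"
  with assms(1) show "\<not> regret_dim X A < MaxMinCOV X"
    using regret_dim_lower_bound by (simp add: not_less)
qed

end
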